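(* Let $\Bbbk$ be an algebraically closed field of characteristic zero, $N > 1$ an odd integer, and $q \in \Bbbk$ a primitive $N$-th root of unity. Put $\tilde F = (q - q^{-1}) K F \in \overline{U}_q(\mathfrak{sl}_2)$. A complete list of right coideal subalgebras of $\overline{U}_q(\mathfrak{sl}_2)$ is: \begin{gather*} \overline{U}_q(\mathfrak{sl}_2), \quad \langle K^r \rangle, \quad \langle K^r, E \rangle, \quad \langle K^r, \tilde F \rangle \quad (r \text{ a positive divisor of } N), \\ \langle E + \alpha \tilde F + \beta K \rangle \quad (\alpha,\beta \in \Bbbk,\ (\alpha,\beta) \ne (0,0)), \quad \langle \tilde F + \beta K \rangle \quad (\beta \in \Bbbk,\ \beta \ne 0), \\ \langle E + \lambda K, \tilde F + \mu K \rangle \quad (\lambda,\mu \in \Bbbk,\ (1-q^2)\lambda\mu = 1). \end{gather*}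
   Context: $\overline{U}_q(\mathfrak{sl}_2)$ is the algebra generated by $K, E, F$ subject to $K^N = 1$, $KE = q^2 EK$, $KF = q^{-2}FK$, $E^N = F^N = 0$, $EF - FE = (K - K^{-1})/(q - q^{-1})$. It is a Hopf algebra with $\Delta(K) = K \otimes K$, $\Delta(E) = E \otimes K + 1 \otimes E$, $\Delta(F) = F \otimes 1 + K^{-1} \otimes F$, $\varepsilon(K)=1$, $\varepsilon(E)=\varepsilon(F)=0$. A right coideal subalgebra of a Hopf algebra $H$ is a (unital) subalgebra $A$ with $\Delta(A) \subset A \otimes H$. $\langle \cdots \rangle$ denotes the unital subalgebra generated by the indicated elements. *)

theory Defs
  imports "HOL-Algebra.Algebra" "HOL-Library.Poly_Mapping" "HOL-Computational_Algebra.Polynomial"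
begin

section \<open>Algebras over a field\<close>

text \<open>
  The base field is a type \<open>'k\<close> of class \<^class>\<open>field\<close>; a \<open>'k\<close>-algebra is a record of type
  \<open>('k, 'a) module\<close>, i.e. a (not necessarily commutative) ring together with a scalar
  multiplication by \<open>'k\<close>.
\<close>

definition algebra_hom ::
    "('k::field, 'a, 'm) module_scheme \<Rightarrow> ('k, 'b, 'n) module_scheme \<Rightarrow> ('a \<Rightarrow> 'b) set" where
  "algebra_hom A B =
     {h \<in> ring_hom A B. \<forall>c. \<forall>x \<in> carrier A. h (c \<odot>\<^bsub>A\<^esub> x) = c \<odot>\<^bsub>B\<^esub> h x}"

definition unital_subalgebra :: "('k::field, 'a, 'm) module_scheme \<Rightarrow> 'a set \<Rightarrow> bool" where
  "unital_subalgebra A S \<longleftrightarrow> subring S A \<and> (\<forall>c. \<forall>x \<in> S. c \<odot>\<^bsub>A\<^esub> x \<in> S)"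

definition subalgebra_generated :: "('k::field, 'a, 'm) module_scheme \<Rightarrow> 'a set \<Rightarrow> 'a set" where
  "subalgebra_generated A G = \<Inter> {S. unital_subalgebra A S \<and> G \<subseteq> S}"

definition quotient_algebra ::
    "('k::field, 'a, 'm) module_scheme \<Rightarrow> 'a set \<Rightarrow> ('k, 'a set) module" where
  "quotient_algebra A I =
     ring.extend (A Quot I) \<lparr>module.smult = (\<lambda>c Y. \<Union>y \<in> Y. I +>\<^bsub>A\<^esub> (c \<odot>\<^bsub>A\<^esub> y))\<rparr>"

text \<open>Finite formal \<open>'k\<close>-linear combinations of elements of \<open>M\<close>, with the multiplication of \<open>M\<close>
  extended bilinearly.\<close>

definition monoid_algebra :: "('a, 'm) monoid_scheme \<Rightarrow> ('k::field, 'a \<Rightarrow>\<^sub>0 'k) module" where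
  "monoid_algebra M =
     \<lparr>carrier = {x. Poly_Mapping.keys x \<subseteq> carrier M},
      monoid.mult = (\<lambda>x y. \<Sum>a \<in> Poly_Mapping.keys x. \<Sum>b \<in> Poly_Mapping.keys y.
                Poly_Mapping.single (a \<otimes>\<^bsub>M\<^esub> b)
                  (Poly_Mapping.lookup x a * Poly_Mapping.lookup y b)),
      one = Poly_Mapping.single \<one>\<^bsub>M\<^esub> 1,
      ring.zero = 0,
      ring.add = (+),
      module.smult = (\<lambda>c. Poly_Mapping.map ((*) c))\<rparr>"

definition free_algebra :: "('k::field, 'g list \<Rightarrow>\<^sub>0 'k) module" where
  "free_algebra = monoid_algebra \<lparr>carrier = UNIV, monoid.mult = (@), one = []\<rparr>"

definition free_gen :: "'g \<Rightarrow> ('g list \<Rightarrow>\<^sub>0 'k::field)" where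
  "free_gen g = Poly_Mapping.single [g] 1"


section \<open>Tensor products of algebras\<close>

text \<open>
  The formal combinations of pairs \<open>(a, b)\<close>, modulo bilinearity. A relator multiplied by a pair on
  either side is again a relator of the same kind, so the two-sided ideal generated by the
  relators is their linear span: the underlying vector space is the usual tensor product.
\<close>

definition tensor_relators ::
    "('k::field, 'a, 'm) module_scheme \<Rightarrow> ('k, 'b, 'n) module_scheme \<Rightarrow> ('a \<times> 'b \<Rightarrow>\<^sub>0 'k) set" where
  "tensor_relators A B =
     {Poly_Mapping.single (a \<oplus>\<^bsub>A\<^esub> a', b) 1
        - Poly_Mapping.single (a, b) 1 - Poly_Mapping.single (a', b) 1 | a a' b.
        a \<in> carrier A \<and> a' \<in> carrier A \<and> b \<in> carrier B} \<union>
     {Poly_Mapping.single (a, b \<oplus>\<^bsub>B\<^esub> b') 1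
        - Poly_Mapping.single (a, b) 1 - Poly_Mapping.single (a, b') 1 | a b b'.
        a \<in> carrier A \<and> b \<in> carrier B \<and> b' \<in> carrier B} \<union>
     {Poly_Mapping.single (c \<odot>\<^bsub>A\<^esub> a, b) 1 - Poly_Mapping.single (a, b) c | c a b.
        a \<in> carrier A \<and> b \<in> carrier B} \<union>
     {Poly_Mapping.single (a, c \<odot>\<^bsub>B\<^esub> b) 1 - Poly_Mapping.single (a, b) c | c a b.
        a \<in> carrier A \<and> b \<in> carrier B}"

definition tensor_ideal ::
    "('k::field, 'a, 'm) module_scheme \<Rightarrow> ('k, 'b, 'n) module_scheme \<Rightarrow> ('a \<times> 'b \<Rightarrow>\<^sub>0 'k) set" where
  "tensor_ideal A B = genideal (monoid_algebra (A \<times>\<times> B)) (tensor_relators A B)"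

definition tensor_algebra ::
    "('k::field, 'a, 'm) module_scheme \<Rightarrow> ('k, 'b, 'n) module_scheme
      \<Rightarrow> ('k, ('a \<times> 'b \<Rightarrow>\<^sub>0 'k) set) module" where
  "tensor_algebra A B = quotient_algebra (monoid_algebra (A \<times>\<times> B)) (tensor_ideal A B)"

definition pure_tensor ::
    "('k::field, 'a, 'm) module_scheme \<Rightarrow> ('k, 'b, 'n) module_scheme
      \<Rightarrow> 'a \<Rightarrow> 'b \<Rightarrow> ('a \<times> 'b \<Rightarrow>\<^sub>0 'k) set" where
  "pure_tensor A B a b =
     tensor_ideal A B +>\<^bsub>monoid_algebra (A \<times>\<times> B)\<^esub> Poly_Mapping.single (a, b) 1"

text \<open>For a subspace \<open>S\<close> of \<open>A\<close>, the subspace \<open>S \<otimes> B\<close> of \<open>A \<otimes> B\<close>; scalars need not be mentioned,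
  since \<open>c (s \<otimes> b) = (c s) \<otimes> b\<close>.\<close>

definition left_subtensor ::
    "('k::field, 'a, 'm) module_scheme \<Rightarrow> ('k, 'b, 'n) module_scheme
      \<Rightarrow> 'a set \<Rightarrow> ('a \<times> 'b \<Rightarrow>\<^sub>0 'k) set set" where
  "left_subtensor A B S =
     generate (add_monoid (tensor_algebra A B)) {pure_tensor A B s b | s b. s \<in> S \<and> b \<in> carrier B}"

definition right_coideal_subalgebra ::
    "('k::field, 'a, 'm) module_scheme \<Rightarrow> ('a \<Rightarrow> ('a \<times> 'a \<Rightarrow>\<^sub>0 'k) set) \<Rightarrow> 'a set \<Rightarrow> bool" where
  "right_coideal_subalgebra H \<Delta> S \<longleftrightarrow>
     unital_subalgebra H S \<and> \<Delta> ` S \<subseteq> left_subtensor H H S"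


section \<open>The small quantum group\<close>

definition primitive_root_of_unity :: "nat \<Rightarrow> 'k::field \<Rightarrow> bool" where
  "primitive_root_of_unity n q \<longleftrightarrow> n > 0 \<and> q ^ n = 1 \<and> (\<forall>m. 0 < m \<and> m < n \<longrightarrow> q ^ m \<noteq> 1)"

datatype gen = GK | GE | GF

text \<open>In the free algebra \<open>K\<^sup>-\<^sup>1\<close> is written as \<open>K ^ (N - 1)\<close>, which is what it equals once
  \<open>K ^ N = 1\<close>.\<close>

definition Ubar_relators :: "'k::field \<Rightarrow> nat \<Rightarrow> (gen list \<Rightarrow>\<^sub>0 'k) set" where
  "Ubar_relators q N =
     (let A = free_algebra; K = free_gen GK; E = free_gen GE; F = free_gen GF in
       {K [^]\<^bsub>A\<^esub> N \<ominus>\<^bsub>A\<^esub> \<one>\<^bsub>A\<^esub>,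
        (K \<otimes>\<^bsub>A\<^esub> E) \<ominus>\<^bsub>A\<^esub> (q ^ 2 \<odot>\<^bsub>A\<^esub> (E \<otimes>\<^bsub>A\<^esub> K)),
        (K \<otimes>\<^bsub>A\<^esub> F) \<ominus>\<^bsub>A\<^esub> (inverse (q ^ 2) \<odot>\<^bsub>A\<^esub> (F \<otimes>\<^bsub>A\<^esub> K)),
        E [^]\<^bsub>A\<^esub> N,
        F [^]\<^bsub>A\<^esub> N,
        ((E \<otimes>\<^bsub>A\<^esub> F) \<ominus>\<^bsub>A\<^esub> (F \<otimes>\<^bsub>A\<^esub> E))
          \<ominus>\<^bsub>A\<^esub> (inverse (q - inverse q) \<odot>\<^bsub>A\<^esub> (K \<ominus>\<^bsub>A\<^esub> (K [^]\<^bsub>A\<^esub> (N - 1))))})"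

definition Ubar_ideal :: "'k::field \<Rightarrow> nat \<Rightarrow> (gen list \<Rightarrow>\<^sub>0 'k) set" where
  "Ubar_ideal q N = genideal free_algebra (Ubar_relators q N)"

definition Ubar :: "'k::field \<Rightarrow> nat \<Rightarrow> ('k, (gen list \<Rightarrow>\<^sub>0 'k) set) module" where
  "Ubar q N = quotient_algebra free_algebra (Ubar_ideal q N)"

definition Ubar_gen :: "'k::field \<Rightarrow> nat \<Rightarrow> gen \<Rightarrow> (gen list \<Rightarrow>\<^sub>0 'k) set" where
  "Ubar_gen q N g = Ubar_ideal q N +>\<^bsub>free_algebra\<^esub> free_gen g"

abbreviation Ubar_K :: "'k::field \<Rightarrow> nat \<Rightarrow> (gen list \<Rightarrow>\<^sub>0 'k) set" where
  "Ubar_K q N \<equiv> Ubar_gen q N GK"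
abbreviation Ubar_E :: "'k::field \<Rightarrow> nat \<Rightarrow> (gen list \<Rightarrow>\<^sub>0 'k) set" where
  "Ubar_E q N \<equiv> Ubar_gen q N GE"
abbreviation Ubar_F :: "'k::field \<Rightarrow> nat \<Rightarrow> (gen list \<Rightarrow>\<^sub>0 'k) set" where
  "Ubar_F q N \<equiv> Ubar_gen q N GF"

definition Ubar_Ftilde :: "'k::field \<Rightarrow> nat \<Rightarrow> (gen list \<Rightarrow>\<^sub>0 'k) set" where
  "Ubar_Ftilde q N = (q - inverse q) \<odot>\<^bsub>Ubar q N\<^esub> (Ubar_K q N \<otimes>\<^bsub>Ubar q N\<^esub> Ubar_F q N)"

text \<open>The comultiplication is the algebra homomorphism determined by its values on the generators.
  (It is made extensional only so that it is unique as a HOL function.)\<close>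

definition Ubar_comult ::
    "'k::field \<Rightarrow> nat \<Rightarrow> (gen list \<Rightarrow>\<^sub>0 'k) set
      \<Rightarrow> ((gen list \<Rightarrow>\<^sub>0 'k) set \<times> (gen list \<Rightarrow>\<^sub>0 'k) set \<Rightarrow>\<^sub>0 'k) set" where
  "Ubar_comult q N =
     (let U = Ubar q N; T = tensor_algebra U U; tens = pure_tensor U U;
          K = Ubar_K q N; E = Ubar_E q N; F = Ubar_F q N in
       (THE \<Delta>. \<Delta> \<in> algebra_hom U T \<and> \<Delta> \<in> extensional (carrier U) \<and>
          \<Delta> K = tens K K \<and>
          \<Delta> E = tens E K \<oplus>\<^bsub>T\<^esub> tens \<one>\<^bsub>U\<^esub> E \<and>
          \<Delta> F = tens F \<one>\<^bsub>U\<^esub> \<oplus>\<^bsub>T\<^esub> tens (inv\<^bsub>U\<^esub> K) F))"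

end

(* Write Ft for the normalised F. Both E and Ft are (1, K)-skew primitive, so in the basis E^a Ft^b K^i
   the coproduct is, up to nonzero scalars, the one of divided powers:
     E^a Ft^b K^i  |->  sum of c(s,t) E^s Ft^t K^i (x) E^(a-s) Ft^(b-t) K^(i+s+t).
   Pairing the second factor with coordinate functionals therefore splits a right coideal subalgebra S
   into weight spaces and lowers a and b. If z in S has weight w and degree d (in a + b), lowering a
   leading monomial to degree zero shows K^(w-d) in S; hence S is determined by the powers of K it
   contains and by the leading forms of its elements of weight equal to their degree.

   The leading forms are closed under lowering, which plays the role of partial differentiation. If
   those of degree one span a line, every form of degree d is a multiple of the d-th power of the linear
   form: a form without the pivot monomial has vanishing derivatives by induction. So S is generated by
   its powers of K and its elements x E + y Ft + c K. If S contains a nontrivial power of K,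
   conjugation separates the three summands; if it contains E + l K and Ft + m K, then
     (Ft + m K)(E + l K) - q^2 (E + l K)(Ft + m K) = 1 + ((1 - q^2) l m - 1) K^2
   puts K into S unless (1 - q^2) l m = 1.

   Linear independence of the basis comes from an explicit regular representation, and the existence of
   the coproduct from the q-binomial theorem at a root of unity. *)

theory Submission
  imports Defs
begin

section \<open>Algebras and linear maps\<close>

text \<open>\<open>Ft\<close> replaces \<open>F\<close> for two reasons: its coproduct has the same
  shape as that of \<open>E\<close>, so \<open>x E + y Ft + c K\<close> can be handled as one
  family, and the commutator turns into \<open>Ft E = q^2 E Ft + 1 - K^2\<close>, free of
  \<open>K^(-1)\<close>. These relations are verified in three algebras: the quotient itself,
  operators on functions, and the tensor square. That relation mixes the weights 0 and 2. A product
  built inside a subalgebra to imitate a given leading form is therefore not homogeneous; it has to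
  be projected to one weight before it is subtracted, and right coideals are stable under this
  projection. Oddness of \<open>N\<close> keeps \<open>q^2\<close> a root of unity of exact order
  \<open>N\<close>, so \<open>q\<close>-factorials below \<open>N\<close> are nonzero; it also makes
  \<open>K\<close> a power of \<open>K^2\<close> and keeps the conjugation eigenvalues
  \<open>p\<close>, \<open>p^(-1)\<close>, 1 apart. Characteristic zero enters through division by
  \<open>N\<close>: \<open>K\<close> acts diagonally on functions, and its exponents are recovered
  by a discrete Fourier inversion.\<close>

locale kalg = ring A for A :: "('k::field, 'a, 'm) module_scheme" (structure) +
  assumes smult_closed [simp, intro]: "x \<in> carrier A \<Longrightarrow> c \<odot> x \<in> carrier A"
    and smult_add_l: "x \<in> carrier A \<Longrightarrow> (c + d) \<odot> x = c \<odot> x \<oplus> d \<odot> x"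
    and smult_add_r: "\<lbrakk>x \<in> carrier A; y \<in> carrier A\<rbrakk> \<Longrightarrow> c \<odot> (x \<oplus> y) = c \<odot> x \<oplus> c \<odot> y"
    and smult_smult [simp]: "x \<in> carrier A \<Longrightarrow> c \<odot> (d \<odot> x) = (c * d) \<odot> x"
    and smult_1 [simp]: "x \<in> carrier A \<Longrightarrow> 1 \<odot> x = x"
    and smult_mult_l [simp]: "\<lbrakk>x \<in> carrier A; y \<in> carrier A\<rbrakk> \<Longrightarrow> (c \<odot> x) \<otimes> y = c \<odot> (x \<otimes> y)"
    and smult_mult_r [simp]: "\<lbrakk>x \<in> carrier A; y \<in> carrier A\<rbrakk> \<Longrightarrow> x \<otimes> (c \<odot> y) = c \<odot> (x \<otimes> y)"
begin

lemma smult_0_l [simp]: "x \<in> carrier A \<Longrightarrow> 0 \<odot> x = \<zero>"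
proof -
  assume x: "x \<in> carrier A"
  have "0 \<odot> x \<oplus> 0 \<odot> x = 0 \<odot> x \<oplus> \<zero>" using smult_add_l[OF x, of 0 0] x by simp
  then show ?thesis using x by (metis add.l_cancel smult_closed zero_closed)
qed

lemma smult_0_r [simp]: "c \<odot> \<zero> = \<zero>"
  by (metis mult_zero_right smult_0_l smult_smult zero_closed)

lemma minus_eq_smult: "x \<in> carrier A \<Longrightarrow> \<ominus> x = (- 1) \<odot> x"
proof -
  assume x: "x \<in> carrier A"
  have "x \<oplus> (- 1) \<odot> x = \<zero>" using smult_add_l[OF x, of 1 "- 1"] x by simp
  then show ?thesis using x by (metis minus_equality a_comm smult_closed)
qed

lemma diff_eq_smult: "y \<in> carrier A \<Longrightarrow> x \<ominus> y = x \<oplus> (- 1) \<odot> y"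
  by (simp add: a_minus_def minus_eq_smult)

lemma smult_finsum:
  assumes "f \<in> I \<rightarrow> carrier A"
  shows "c \<odot> (\<Oplus>i\<in>I. f i) = (\<Oplus>i\<in>I. c \<odot> f i)"
  using assms by (induction I rule: infinite_finite_induct) (auto simp: smult_add_r Pi_iff)

lemma smult_pow:
  assumes "x \<in> carrier A"
  shows "(c \<odot> x) [^] (n::nat) = (c ^ n) \<odot> (x [^] n)"
  using assms by (induction n) (auto simp: ac_simps)

end

definition lin_map ::
    "('k::field, 'a, 'm) module_scheme \<Rightarrow> ('k, 'b, 'n) module_scheme \<Rightarrow> ('a \<Rightarrow> 'b) \<Rightarrow> bool" where
  "lin_map A B g \<longleftrightarrow> g \<in> carrier A \<rightarrow> carrier B \<and>
     (\<forall>x\<in>carrier A. \<forall>y\<in>carrier A. g (x \<oplus>\<^bsub>A\<^esub> y) = g x \<oplus>\<^bsub>B\<^esub> g y) \<and>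
     (\<forall>c. \<forall>x\<in>carrier A. g (c \<odot>\<^bsub>A\<^esub> x) = c \<odot>\<^bsub>B\<^esub> g x)"

text \<open>The base field is a type and not an algebra record, so linear forms need their own
  predicate besides \<open>lin_map\<close>.\<close>

definition functional :: "('k::field, 'a, 'm) module_scheme \<Rightarrow> ('a \<Rightarrow> 'k) \<Rightarrow> bool" where
  "functional A f \<longleftrightarrow>
     (\<forall>x\<in>carrier A. \<forall>y\<in>carrier A. f (x \<oplus>\<^bsub>A\<^esub> y) = f x + f y) \<and>
     (\<forall>c. \<forall>x\<in>carrier A. f (c \<odot>\<^bsub>A\<^esub> x) = c * f x)"

lemma lin_map_zero:
  assumes "kalg A" "kalg B" "lin_map A B g"
  shows "g \<zero>\<^bsub>A\<^esub> = \<zero>\<^bsub>B\<^esub>"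
proof -
  interpret A: kalg A by fact
  interpret B: kalg B by fact
  have "g (0 \<odot>\<^bsub>A\<^esub> \<zero>\<^bsub>A\<^esub>) = 0 \<odot>\<^bsub>B\<^esub> g \<zero>\<^bsub>A\<^esub>" "g \<zero>\<^bsub>A\<^esub> \<in> carrier B"
    using assms(3) by (auto simp: lin_map_def simp del: A.smult_0_l A.smult_0_r)
  then show ?thesis by simp
qed

lemma functional_zero:
  assumes "kalg A" "functional A f"
  shows "f \<zero>\<^bsub>A\<^esub> = 0"
proof -
  interpret A: kalg A by fact
  have "f (0 \<odot>\<^bsub>A\<^esub> \<zero>\<^bsub>A\<^esub>) = 0 * f \<zero>\<^bsub>A\<^esub>"
    using assms(2) A.zero_closed unfolding functional_def by blast
  then show ?thesis by simp
qed

lemma lin_map_minus: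
  assumes "kalg A" "kalg B" "lin_map A B g" "x \<in> carrier A"
  shows "g (\<ominus>\<^bsub>A\<^esub> x) = \<ominus>\<^bsub>B\<^esub> g x"
proof -
  interpret A: kalg A by fact
  interpret B: kalg B by fact
  have "g x \<in> carrier B" using assms(3,4) by (auto simp: lin_map_def)
  then show ?thesis using assms(3,4) by (auto simp: lin_map_def A.minus_eq_smult B.minus_eq_smult)
qed

lemma functional_finsum:
  assumes "kalg A" "functional A f" "x \<in> I \<rightarrow> carrier A"
  shows "f (\<Oplus>\<^bsub>A\<^esub>i\<in>I. x i) = (\<Sum>i\<in>I. f (x i))"
proof -
  interpret A: kalg A by fact
  show ?thesis using assms(3)
  proof (induction I rule: infinite_finite_induct)
    case (insert a F)
    then show ?case using assms(2) by (auto simp: functional_def Pi_iff)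
  qed (auto simp: functional_zero[OF assms(1,2)])
qed

lemma algebra_hom_lin_map: "h \<in> algebra_hom A B \<Longrightarrow> lin_map A B h"
  by (auto simp: algebra_hom_def lin_map_def ring_hom_def)

lemma algebra_homD:
  assumes "h \<in> algebra_hom A B"
  shows "x \<in> carrier A \<Longrightarrow> h x \<in> carrier B"
    and "x \<in> carrier A \<Longrightarrow> y \<in> carrier A \<Longrightarrow> h (x \<oplus>\<^bsub>A\<^esub> y) = h x \<oplus>\<^bsub>B\<^esub> h y"
    and "x \<in> carrier A \<Longrightarrow> y \<in> carrier A \<Longrightarrow> h (x \<otimes>\<^bsub>A\<^esub> y) = h x \<otimes>\<^bsub>B\<^esub> h y"
    and "x \<in> carrier A \<Longrightarrow> h (c \<odot>\<^bsub>A\<^esub> x) = c \<odot>\<^bsub>B\<^esub> h x"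
    and "h \<one>\<^bsub>A\<^esub> = \<one>\<^bsub>B\<^esub>"
  using assms by (auto simp: algebra_hom_def ring_hom_def)

lemma algebra_hom_pow:
  assumes "kalg A" "kalg B" "h \<in> algebra_hom A B" "x \<in> carrier A"
  shows "h (x [^]\<^bsub>A\<^esub> (n::nat)) = h x [^]\<^bsub>B\<^esub> n"
proof -
  interpret A: kalg A by fact
  interpret B: kalg B by fact
  show ?thesis using assms(4) by (induction n) (auto simp: algebra_homD[OF assms(3)])
qed

lemma algebra_hom_zero_minus:
  assumes "kalg A" "kalg B" "h \<in> algebra_hom A B"
  shows "h \<zero>\<^bsub>A\<^esub> = \<zero>\<^bsub>B\<^esub>" "x \<in> carrier A \<Longrightarrow> h (\<ominus>\<^bsub>A\<^esub> x) = \<ominus>\<^bsub>B\<^esub> h x"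
    "x \<in> carrier A \<Longrightarrow> y \<in> carrier A \<Longrightarrow> h (x \<ominus>\<^bsub>A\<^esub> y) = h x \<ominus>\<^bsub>B\<^esub> h y"
proof -
  interpret A: kalg A by fact
  interpret B: kalg B by fact
  note l = algebra_hom_lin_map[OF assms(3)]
  show "h \<zero>\<^bsub>A\<^esub> = \<zero>\<^bsub>B\<^esub>" using lin_map_zero[OF assms(1,2) l] .
  show 1: "h (\<ominus>\<^bsub>A\<^esub> x) = \<ominus>\<^bsub>B\<^esub> h x" if "x \<in> carrier A" for x
    using lin_map_minus[OF assms(1,2) l that] .
  show "x \<in> carrier A \<Longrightarrow> y \<in> carrier A \<Longrightarrow> h (x \<ominus>\<^bsub>A\<^esub> y) = h x \<ominus>\<^bsub>B\<^esub> h y"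
    by (simp add: a_minus_def 1 algebra_homD[OF assms(3)])
qed

section \<open>Monoid algebras\<close>

text \<open>A finitely supported function is the sum of its monomials. The support bound is carried
  through the partial sums, so that an induction over a monoid algebra never leaves its
  carrier.\<close>

lemma poly_mapping_span_induct [consumes 1, case_names zero single add]:
  fixes x :: "'a \<Rightarrow>\<^sub>0 'b::comm_monoid_add"
  assumes "Poly_Mapping.keys x \<subseteq> S"
    and "P 0" and "\<And>a c. a \<in> S \<Longrightarrow> P (Poly_Mapping.single a c)"
    and "\<And>x y. \<lbrakk>Poly_Mapping.keys x \<subseteq> S; Poly_Mapping.keys y \<subseteq> S; P x; P y\<rbrakk> \<Longrightarrow> P (x + y)"
  shows "P x"
proof -
  have eq: "x = (\<Sum>a\<in>Poly_Mapping.keys x. Poly_Mapping.single a (Poly_Mapping.lookup x a))"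
    by (rule poly_mapping_eqI)
      (auto simp: lookup_sum lookup_single when_def sum.delta in_keys_iff)
  have "P (\<Sum>a\<in>F. Poly_Mapping.single a (Poly_Mapping.lookup x a)) \<and>
      Poly_Mapping.keys (\<Sum>a\<in>F. Poly_Mapping.single a (Poly_Mapping.lookup x a)) \<subseteq> S"
    if "finite F" "F \<subseteq> S" for F
    using that
  proof (induction F)
    case (insert a F)
    have k: "Poly_Mapping.keys (Poly_Mapping.single a (Poly_Mapping.lookup x a)) \<subseteq> S"
      using insert.prems by auto
    show ?case using insert k assms(3)[of a]
      by (auto intro!: assms(4) dest!: subsetD[OF keys_add])
  qed (use assms(2) in simp)
  then show ?thesis using assms(1) eq finite_keys by metis
qed

lemma monoid_algebra_simps [simp]:
  "carrier (monoid_algebra M) = {x. Poly_Mapping.keys x \<subseteq> carrier M}"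
  "\<one>\<^bsub>monoid_algebra M\<^esub> = Poly_Mapping.single \<one>\<^bsub>M\<^esub> 1"
  "\<zero>\<^bsub>monoid_algebra M\<^esub> = 0"
  "x \<oplus>\<^bsub>monoid_algebra M\<^esub> y = x + y"
  "c \<odot>\<^bsub>monoid_algebra M\<^esub> x = Poly_Mapping.map ((*) c) x"
  by (simp_all add: monoid_algebra_def)

lemma lookup_scale [simp]:
  "Poly_Mapping.lookup (Poly_Mapping.map ((*) (c::'k::field)) x) a = c * Poly_Mapping.lookup x a"
  by (transfer) (simp add: when_def)

lemma keys_scale: "Poly_Mapping.keys (Poly_Mapping.map ((*) (c::'k::field)) x) \<subseteq> Poly_Mapping.keys x"
  by (auto simp: in_keys_iff)

lemma scale_single [simp]:
  "Poly_Mapping.map ((*) (c::'k::field)) (Poly_Mapping.single a d) = Poly_Mapping.single a (c * d)"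
  by (rule poly_mapping_eqI) (simp add: lookup_single when_def)

lemma scale_add: "Poly_Mapping.map ((*) (c::'k::field)) (x + y)
    = Poly_Mapping.map ((*) c) x + Poly_Mapping.map ((*) c) y"
  by (rule poly_mapping_eqI) (simp add: lookup_add algebra_simps)

text \<open>Keys outside the supports contribute zero. Enlarged index sets are what makes
  distributivity provable, because cancellation can shrink the support of a sum below the union of
  the supports.\<close>

lemma monoid_algebra_mult_superset:
  assumes "finite A" "finite B" "Poly_Mapping.keys x \<subseteq> A" "Poly_Mapping.keys y \<subseteq> B"
  shows "x \<otimes>\<^bsub>monoid_algebra M\<^esub> y = (\<Sum>a\<in>A. \<Sum>b\<in>B.
      Poly_Mapping.single (a \<otimes>\<^bsub>M\<^esub> b) (Poly_Mapping.lookup x a * Poly_Mapping.lookup y b))"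
proof -
  have "x \<otimes>\<^bsub>monoid_algebra M\<^esub> y = (\<Sum>a\<in>Poly_Mapping.keys x. \<Sum>b\<in>B.
      Poly_Mapping.single (a \<otimes>\<^bsub>M\<^esub> b) (Poly_Mapping.lookup x a * Poly_Mapping.lookup y b))"
    unfolding monoid_algebra_def monoid.simps
    by (intro sum.cong refl sum.mono_neutral_left) (use assms in \<open>auto simp: in_keys_iff\<close>)
  also have "\<dots> = (\<Sum>a\<in>A. \<Sum>b\<in>B.
      Poly_Mapping.single (a \<otimes>\<^bsub>M\<^esub> b) (Poly_Mapping.lookup x a * Poly_Mapping.lookup y b))"
    by (intro sum.mono_neutral_left) (use assms in \<open>auto simp: in_keys_iff\<close>)
  finally show ?thesis .
qed

lemma monoid_algebra_mult_add:
  "(x + x') \<otimes>\<^bsub>monoid_algebra M\<^esub> y = x \<otimes>\<^bsub>monoid_algebra M\<^esub> y + x' \<otimes>\<^bsub>monoid_algebra M\<^esub> y"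
  "x \<otimes>\<^bsub>monoid_algebra M\<^esub> (y + y') = x \<otimes>\<^bsub>monoid_algebra M\<^esub> y + x \<otimes>\<^bsub>monoid_algebra M\<^esub> y'"
proof -
  note ms = monoid_algebra_mult_superset
  let ?K = Poly_Mapping.keys
  show "(x + x') \<otimes>\<^bsub>monoid_algebra M\<^esub> y = x \<otimes>\<^bsub>monoid_algebra M\<^esub> y + x' \<otimes>\<^bsub>monoid_algebra M\<^esub> y"
    by (subst (1 2 3) ms[where A = "?K x \<union> ?K x'" and B = "?K y"])
      (auto simp: lookup_add single_add algebra_simps sum.distrib dest!: subsetD[OF keys_add])
  show "x \<otimes>\<^bsub>monoid_algebra M\<^esub> (y + y') = x \<otimes>\<^bsub>monoid_algebra M\<^esub> y + x \<otimes>\<^bsub>monoid_algebra M\<^esub> y'"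
    by (subst (1 2 3) ms[where B = "?K y \<union> ?K y'" and A = "?K x"])
      (auto simp: lookup_add single_add algebra_simps sum.distrib dest!: subsetD[OF keys_add])
qed

lemma monoid_algebra_mult_single [simp]:
  "Poly_Mapping.single a c \<otimes>\<^bsub>monoid_algebra M\<^esub> Poly_Mapping.single b d
    = Poly_Mapping.single (a \<otimes>\<^bsub>M\<^esub> b) (c * d)"
  by (subst monoid_algebra_mult_superset[where A = "{a}" and B = "{b}"]) auto

lemma monoid_algebra_mult_0 [simp]:
  "0 \<otimes>\<^bsub>monoid_algebra M\<^esub> x = 0" "x \<otimes>\<^bsub>monoid_algebra M\<^esub> 0 = 0"
  by (simp_all add: monoid_algebra_def)

text \<open>Associativity, units and compatibility with scalars are linear in each argument, so they
  reduce to monomials, where they are laws of \<open>M\<close> and of the field.\<close>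

lemma kalg_monoid_algebra:
  fixes M :: "('a, 'm) monoid_scheme"
  assumes "Group.monoid M"
  shows "kalg (monoid_algebra M :: ('k::field, 'a \<Rightarrow>\<^sub>0 'k) module)"
proof -
  interpret M: Group.monoid M by fact
  let ?A = "monoid_algebra M :: ('k, 'a \<Rightarrow>\<^sub>0 'k) module"
  let ?K = Poly_Mapping.keys
  have closed: "?K (x \<otimes>\<^bsub>?A\<^esub> y) \<subseteq> carrier M" if "?K x \<subseteq> carrier M" "?K y \<subseteq> carrier M" for x y
    using that(1)
  proof (induction x rule: poly_mapping_span_induct)
    case (single a c)
    show ?case using that(2)
      by (induction y rule: poly_mapping_span_induct)
        (use single in \<open>auto simp: monoid_algebra_mult_add dest!: subsetD[OF keys_add]\<close>)
  qed (auto simp: monoid_algebra_mult_add dest!: subsetD[OF keys_add])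
  have assoc: "(x \<otimes>\<^bsub>?A\<^esub> y) \<otimes>\<^bsub>?A\<^esub> z = x \<otimes>\<^bsub>?A\<^esub> (y \<otimes>\<^bsub>?A\<^esub> z)"
    if "?K x \<subseteq> carrier M" "?K y \<subseteq> carrier M" "?K z \<subseteq> carrier M" for x y z
    using that(1)
  proof (induction x rule: poly_mapping_span_induct)
    case (single a c)
    show ?case using that(2)
    proof (induction y rule: poly_mapping_span_induct)
      case (single b d)
      show ?case using that(3)
        by (induction z rule: poly_mapping_span_induct)
          (use single \<open>a \<in> carrier M\<close> in \<open>auto simp: monoid_algebra_mult_add M.m_assoc mult.assoc\<close>)
    qed (auto simp: monoid_algebra_mult_add)
  qed (auto simp: monoid_algebra_mult_add)
  have one_l: "\<one>\<^bsub>?A\<^esub> \<otimes>\<^bsub>?A\<^esub> x = x" and one_r: "x \<otimes>\<^bsub>?A\<^esub> \<one>\<^bsub>?A\<^esub> = x" if "?K x \<subseteq> carrier M" for x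
    using that by (induction x rule: poly_mapping_span_induct) (auto simp: monoid_algebra_mult_add)
  have sl: "Poly_Mapping.map ((*) c) x \<otimes>\<^bsub>?A\<^esub> y = Poly_Mapping.map ((*) c) (x \<otimes>\<^bsub>?A\<^esub> y)"
    and sr: "x \<otimes>\<^bsub>?A\<^esub> Poly_Mapping.map ((*) c) y = Poly_Mapping.map ((*) c) (x \<otimes>\<^bsub>?A\<^esub> y)"
    if "?K x \<subseteq> carrier M" "?K y \<subseteq> carrier M" for x y c
  proof -
    have "Poly_Mapping.map ((*) c) x \<otimes>\<^bsub>?A\<^esub> y = Poly_Mapping.map ((*) c) (x \<otimes>\<^bsub>?A\<^esub> y) \<and>
      x \<otimes>\<^bsub>?A\<^esub> Poly_Mapping.map ((*) c) y = Poly_Mapping.map ((*) c) (x \<otimes>\<^bsub>?A\<^esub> y)"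
      using that(1)
    proof (induction x rule: poly_mapping_span_induct)
      case zero
      have "Poly_Mapping.map ((*) c) (0 :: 'a \<Rightarrow>\<^sub>0 'k) = 0" by (rule poly_mapping_eqI) simp
      then show ?case by simp
    next
      case (single a d)
      show ?case using that(2)
      proof (induction y rule: poly_mapping_span_induct)
        case zero
        have "Poly_Mapping.map ((*) c) (0 :: 'a \<Rightarrow>\<^sub>0 'k) = 0" by (rule poly_mapping_eqI) simp
        then show ?case by simp
      qed (use single in \<open>auto simp: monoid_algebra_mult_add scale_add mult.assoc mult.left_commute\<close>)
    qed (auto simp: monoid_algebra_mult_add scale_add)
    then show "Poly_Mapping.map ((*) c) x \<otimes>\<^bsub>?A\<^esub> y = Poly_Mapping.map ((*) c) (x \<otimes>\<^bsub>?A\<^esub> y)"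
      "x \<otimes>\<^bsub>?A\<^esub> Poly_Mapping.map ((*) c) y = Poly_Mapping.map ((*) c) (x \<otimes>\<^bsub>?A\<^esub> y)" by auto
  qed
  have ab: "abelian_group ?A"
  proof (rule abelian_groupI)
    fix x assume "x \<in> carrier ?A"
    then show "\<exists>y\<in>carrier ?A. y \<oplus>\<^bsub>?A\<^esub> x = \<zero>\<^bsub>?A\<^esub>"
      by (intro bexI[of _ "- x"]) (auto simp: keys_minus in_keys_iff)
  qed (auto simp: ac_simps dest!: subsetD[OF keys_add])
  have mon: "Group.monoid ?A"
    by (rule monoidI) (use closed assoc one_l one_r in auto)
  have "ring ?A" by (rule ringI[OF ab mon]) (auto simp: monoid_algebra_mult_add)
  then show ?thesis
  proof (rule kalg.intro)
    show "kalg_axioms ?A"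
    proof
      fix x y :: "'a \<Rightarrow>\<^sub>0 'k" and c d :: 'k
      show "(c + d) \<odot>\<^bsub>?A\<^esub> x = c \<odot>\<^bsub>?A\<^esub> x \<oplus>\<^bsub>?A\<^esub> d \<odot>\<^bsub>?A\<^esub> x"
        by (auto intro!: poly_mapping_eqI simp: lookup_add algebra_simps)
      show "c \<odot>\<^bsub>?A\<^esub> (d \<odot>\<^bsub>?A\<^esub> x) = (c * d) \<odot>\<^bsub>?A\<^esub> x" "1 \<odot>\<^bsub>?A\<^esub> x = x"
        by (auto intro!: poly_mapping_eqI simp: algebra_simps)
    qed (use sl sr in \<open>auto simp: scale_add dest!: subsetD[OF keys_scale]\<close>)
  qed
qed

text \<open>The linear extension of a map given on the basis; the maps out of free algebras and out
  of tensor products are built from it.\<close>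

definition lin :: "('k::field, 'b, 'n) module_scheme \<Rightarrow> ('a \<Rightarrow> 'b) \<Rightarrow> ('a \<Rightarrow>\<^sub>0 'k) \<Rightarrow> 'b" where
  "lin B \<phi> x = (\<Oplus>\<^bsub>B\<^esub>a\<in>Poly_Mapping.keys x. Poly_Mapping.lookup x a \<odot>\<^bsub>B\<^esub> \<phi> a)"

context kalg
begin

lemma lin_superset:
  assumes "finite S" "Poly_Mapping.keys x \<subseteq> S" "\<phi> \<in> S \<rightarrow> carrier A"
  shows "lin A \<phi> x = (\<Oplus>a\<in>S. Poly_Mapping.lookup x a \<odot> \<phi> a)"
  unfolding lin_def
  by (rule add.finprod_mono_neutral_cong_left)
    (use assms in \<open>auto simp: in_keys_iff Pi_iff\<close>)

lemma lin_single [simp]: "\<phi> a \<in> carrier A \<Longrightarrow> lin A \<phi> (Poly_Mapping.single a c) = c \<odot> \<phi> a"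
  by (subst lin_superset[of "{a}"]) auto

lemma lin_map_lin:
  assumes "\<phi> \<in> carrier M \<rightarrow> carrier A"
  shows "lin_map (monoid_algebra M) A (lin A \<phi>)"
  unfolding lin_map_def
proof (intro conjI ballI allI)
  let ?K = Poly_Mapping.keys
  show "lin A \<phi> \<in> carrier (monoid_algebra M) \<rightarrow> carrier A"
    using assms unfolding lin_def by (auto intro!: finsum_closed)
  show "lin A \<phi> (x \<oplus>\<^bsub>monoid_algebra M\<^esub> y) = lin A \<phi> x \<oplus> lin A \<phi> y"
    if "x \<in> carrier (monoid_algebra M)" "y \<in> carrier (monoid_algebra M)" for x y
  proof -
    have *: "\<phi> \<in> ?K x \<union> ?K y \<rightarrow> carrier A" using assms that by auto
    have "?K (x + y) \<subseteq> ?K x \<union> ?K y" by (rule keys_add)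
    then have e: "lin A \<phi> z = (\<Oplus>a\<in>?K x \<union> ?K y. Poly_Mapping.lookup z a \<odot> \<phi> a)" if "z \<in> {x, y, x + y}" for z
      using * that by (intro lin_superset) auto
    have "(\<Oplus>a\<in>?K x \<union> ?K y. Poly_Mapping.lookup (x + y) a \<odot> \<phi> a)
        = (\<Oplus>a\<in>?K x \<union> ?K y. Poly_Mapping.lookup x a \<odot> \<phi> a \<oplus> Poly_Mapping.lookup y a \<odot> \<phi> a)"
      using * by (intro finsum_cong') (auto simp: lookup_add smult_add_l Pi_iff)
    then show ?thesis using * by (simp add: e Pi_iff finsum_addf)
  qed
  show "lin A \<phi> (c \<odot>\<^bsub>monoid_algebra M\<^esub> x) = c \<odot> lin A \<phi> x"
    if "x \<in> carrier (monoid_algebra M)" for c x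
  proof -
    have *: "\<phi> \<in> ?K x \<rightarrow> carrier A" using assms that by auto
    show ?thesis using * keys_scale[of c x]
      by (subst (1 2) lin_superset[of "?K x"])
        (auto simp: Pi_iff smult_finsum intro!: finsum_cong')
  qed
qed

lemma algebra_hom_lin:
  fixes M :: "('c, 'd) monoid_scheme"
  assumes "Group.monoid M" and \<phi>: "\<phi> \<in> carrier M \<rightarrow> carrier A" and "\<phi> \<one>\<^bsub>M\<^esub> = \<one>"
    and mult: "\<And>a b. \<lbrakk>a \<in> carrier M; b \<in> carrier M\<rbrakk> \<Longrightarrow> \<phi> (a \<otimes>\<^bsub>M\<^esub> b) = \<phi> a \<otimes> \<phi> b"
  shows "lin A \<phi> \<in> algebra_hom (monoid_algebra M) A"
proof -
  interpret M: Group.monoid M by fact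
  let ?K = Poly_Mapping.keys
  interpret MA: kalg "monoid_algebra M :: ('k, 'c \<Rightarrow>\<^sub>0 'k) module"
    by (rule kalg_monoid_algebra) fact
  have l: "lin_map (monoid_algebra M) A (lin A \<phi>)" by (rule lin_map_lin[OF \<phi>])
  have ladd: "lin A \<phi> (x + y) = lin A \<phi> x \<oplus> lin A \<phi> y" and lcl: "lin A \<phi> x \<in> carrier A"
    if "?K x \<subseteq> carrier M" "?K y \<subseteq> carrier M" for x y
    using l that by (auto simp: lin_map_def)
  have l0: "lin A \<phi> 0 = \<zero>"
    using lin_map_zero[OF MA.kalg_axioms kalg_axioms l] by simp
  have lm: "lin A \<phi> (x \<otimes>\<^bsub>monoid_algebra M\<^esub> y) = lin A \<phi> x \<otimes> lin A \<phi> y"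
    if x: "?K x \<subseteq> carrier M" and y: "?K y \<subseteq> carrier M" for x y
    using x
  proof (induction x rule: poly_mapping_span_induct)
    case zero
    then show ?case using lcl y by (simp add: l0)
  next
    case (single a c)
    show ?case using y
    proof (induction y rule: poly_mapping_span_induct)
      case zero
      then show ?case using single \<phi> by (auto simp: l0 Pi_iff)
    next
      case (single b d)
      then have "\<phi> a \<in> carrier A" "\<phi> b \<in> carrier A" "\<phi> (a \<otimes>\<^bsub>M\<^esub> b) \<in> carrier A"
        using \<phi> \<open>a \<in> carrier M\<close> by auto
      then show ?case using single \<open>a \<in> carrier M\<close> by (simp add: mult ac_simps)
    next
      case (add x y)
      have s: "?K (Poly_Mapping.single a c) \<subseteq> carrier M" using single by auto
      have "?K (Poly_Mapping.single a c \<otimes>\<^bsub>monoid_algebra M\<^esub> x) \<subseteq> carrier M"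
        "?K (Poly_Mapping.single a c \<otimes>\<^bsub>monoid_algebra M\<^esub> y) \<subseteq> carrier M"
        using s add.hyps MA.m_closed[of "Poly_Mapping.single a c"] by auto
      then show ?case using add s
        by (simp add: monoid_algebra_mult_add ladd lcl r_distr)
    qed
  next
    case (add x x')
    have "?K (x \<otimes>\<^bsub>monoid_algebra M\<^esub> y) \<subseteq> carrier M"
        "?K (x' \<otimes>\<^bsub>monoid_algebra M\<^esub> y) \<subseteq> carrier M"
        using y add.hyps MA.m_closed[of _ y] by auto
    then show ?case using add y
      by (simp add: monoid_algebra_mult_add ladd lcl l_distr)
  qed
  have "\<phi> \<one>\<^bsub>M\<^esub> \<in> carrier A" using assms(3) by simp
  then have "lin A \<phi> \<one>\<^bsub>monoid_algebra M\<^esub> = \<one>" using assms(3) by simp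
  then show ?thesis using lm l by (auto simp: algebra_hom_def ring_hom_def lin_map_def)
qed

end

text \<open>A linear map need not be multiplicative, so its vanishing on the generators of a two-sided ideal
  has to be checked on all their multiples.\<close>

lemma lin_map_genideal_zero:
  assumes "kalg A" "kalg B" "lin_map A B g" "R \<subseteq> carrier A"
    and R: "\<And>r u v. \<lbrakk>r \<in> R; u \<in> carrier A; v \<in> carrier A\<rbrakk> \<Longrightarrow> g (u \<otimes>\<^bsub>A\<^esub> r \<otimes>\<^bsub>A\<^esub> v) = \<zero>\<^bsub>B\<^esub>"
    and x: "x \<in> genideal A R"
  shows "g x = \<zero>\<^bsub>B\<^esub>"
proof -
  interpret A: kalg A by fact
  interpret B: kalg B by fact
  note l = assms(3)
  have ladd: "g (x \<oplus>\<^bsub>A\<^esub> y) = g x \<oplus>\<^bsub>B\<^esub> g y" if "x \<in> carrier A" "y \<in> carrier A" for x y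
    using l that by (auto simp: lin_map_def)
  \<comment> \<open>\<open>J\<close> is the largest two-sided ideal inside the kernel of
    \<open>g\<close>; the hypothesis \<open>R\<close> puts the generators into it.\<close>
  define J where "J = {x \<in> carrier A. \<forall>u\<in>carrier A. \<forall>v\<in>carrier A. g (u \<otimes>\<^bsub>A\<^esub> x \<otimes>\<^bsub>A\<^esub> v) = \<zero>\<^bsub>B\<^esub>}"
  have "ideal J A"
  proof (rule idealI)
    show "ring A" by (rule A.ring_axioms)
    show "subgroup J (add_monoid A)"
    proof (rule A.add.subgroupI)
      show "J \<subseteq> carrier A" "J \<noteq> {}"
        using lin_map_zero[OF assms(1-3)] by (auto simp: J_def intro!: exI[of _ "\<zero>\<^bsub>A\<^esub>"])
      show "\<ominus>\<^bsub>A\<^esub> x \<in> J" if "x \<in> J" for x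
        using that lin_map_minus[OF assms(1-3)] by (auto simp: J_def A.l_minus A.r_minus)
      show "x \<oplus>\<^bsub>A\<^esub> y \<in> J" if "x \<in> J" "y \<in> J" for x y
        using that by (auto simp: J_def A.l_distr A.r_distr ladd)
    qed
    show "x \<otimes>\<^bsub>A\<^esub> a \<in> J" if "a \<in> J" "x \<in> carrier A" for a x
    proof -
      have "g (u \<otimes>\<^bsub>A\<^esub> (x \<otimes>\<^bsub>A\<^esub> a) \<otimes>\<^bsub>A\<^esub> v) = \<zero>\<^bsub>B\<^esub>" if uv: "u \<in> carrier A" "v \<in> carrier A" for u v
      proof -
        have "g ((u \<otimes>\<^bsub>A\<^esub> x) \<otimes>\<^bsub>A\<^esub> a \<otimes>\<^bsub>A\<^esub> v) = \<zero>\<^bsub>B\<^esub>" using that \<open>a \<in> J\<close> \<open>x \<in> carrier A\<close> by (simp add: J_def)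
        then show ?thesis using uv \<open>a \<in> J\<close> \<open>x \<in> carrier A\<close> by (simp add: J_def A.m_assoc)
      qed
      then show ?thesis using that by (simp add: J_def)
    qed
    show "a \<otimes>\<^bsub>A\<^esub> x \<in> J" if "a \<in> J" "x \<in> carrier A" for a x
    proof -
      have "g (u \<otimes>\<^bsub>A\<^esub> (a \<otimes>\<^bsub>A\<^esub> x) \<otimes>\<^bsub>A\<^esub> v) = \<zero>\<^bsub>B\<^esub>" if uv: "u \<in> carrier A" "v \<in> carrier A" for u v
      proof -
        have "g (u \<otimes>\<^bsub>A\<^esub> a \<otimes>\<^bsub>A\<^esub> (x \<otimes>\<^bsub>A\<^esub> v)) = \<zero>\<^bsub>B\<^esub>" using that \<open>a \<in> J\<close> \<open>x \<in> carrier A\<close> by (simp add: J_def)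
        then show ?thesis using uv \<open>a \<in> J\<close> \<open>x \<in> carrier A\<close> by (simp add: J_def A.m_assoc)
      qed
      then show ?thesis using that by (simp add: J_def)
    qed
  qed
  moreover have "R \<subseteq> J" using assms(4) R by (auto simp: J_def)
  ultimately have "x \<in> J" using A.genideal_minimal x by blast
  then have "g (\<one>\<^bsub>A\<^esub> \<otimes>\<^bsub>A\<^esub> x \<otimes>\<^bsub>A\<^esub> \<one>\<^bsub>A\<^esub>) = \<zero>\<^bsub>B\<^esub>" "x \<in> carrier A"
    unfolding J_def by blast+
  then show ?thesis by simp
qed

section \<open>Quotient algebras\<close>

text \<open>An arbitrary representative is evaluated; for a linear \<open>g\<close> that vanishes on
  the ideal the choice does not matter.\<close>

definition descend :: "('a \<Rightarrow> 'b) \<Rightarrow> 'a set \<Rightarrow> 'b" where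
  "descend g Y = g (SOME y. y \<in> Y)"

locale kalg_ideal = kalg A + ideal I A for A :: "('k::field, 'a, 'm) module_scheme" (structure) and I
begin

abbreviation "Q \<equiv> quotient_algebra A I"

lemma smult_in_ideal: "x \<in> I \<Longrightarrow> c \<odot> x \<in> I"
  using I_l_closed[of x "c \<odot> \<one>"] a_Hcarr by simp

lemma Q_fields:
  "carrier Q = (\<lambda>x. I +> x) ` carrier A" "\<one>\<^bsub>Q\<^esub> = I +> \<one>" "\<zero>\<^bsub>Q\<^esub> = I"
  "Y \<oplus>\<^bsub>Q\<^esub> Z = set_add A Y Z" "Y \<otimes>\<^bsub>Q\<^esub> Z = rcoset_mult A I Y Z"
  by (auto simp: quotient_algebra_def ring.defs FactRing_def A_RCOSETS_defs a_r_coset_defs)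

lemma coset_zero: "x \<in> I \<Longrightarrow> I +> x = I"
  by (rule a_rcos_const)

lemma coset_eqI: "\<lbrakk>x \<in> carrier A; y \<in> carrier A; x \<ominus> y \<in> I\<rbrakk> \<Longrightarrow> I +> x = I +> y"
  using quotient_eq_iff_same_a_r_cos[OF is_ideal, of x y] by simp

text \<open>Scalar multiplication on the quotient is a union over all representatives. They differ
  by elements of \<open>I\<close>, which absorbs scalars, so the union is a single coset.\<close>

lemma smult_coset:
  assumes "x \<in> carrier A"
  shows "c \<odot>\<^bsub>Q\<^esub> (I +> x) = I +> (c \<odot> x)"
proof -
  have "I +> (c \<odot> y) = I +> (c \<odot> x)" if y: "y \<in> I +> x" for y
  proof -
    obtain h where h: "h \<in> I" "y = h \<oplus> x" using y by (auto simp: a_r_coset_def')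
    then have "c \<odot> y = c \<odot> h \<oplus> c \<odot> x" using assms a_Hcarr by (simp add: smult_add_r)
    moreover have "c \<odot> h \<in> I" using h smult_in_ideal by simp
    ultimately have "c \<odot> y \<ominus> c \<odot> x \<in> I"
      using assms by (simp add: a_minus_def a_assoc r_neg)
    moreover have "c \<odot> y \<in> carrier A" using \<open>c \<odot> y = _\<close> \<open>c \<odot> h \<in> I\<close> a_Hcarr assms by simp
    ultimately show ?thesis using assms by (intro coset_eqI) auto
  qed
  moreover have "x \<in> I +> x" using a_rcos_self assms .
  ultimately have "(\<Union>y\<in>I +> x. I +> (c \<odot> y)) = I +> (c \<odot> x)" by blast
  then show ?thesis by (simp add: quotient_algebra_def ring.defs)
qed

lemma kalg_Q: "kalg Q"
proof -
  interpret QQ: ring "A Quot I" by (rule quotient_is_ring)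
  \<comment> \<open>\<open>Q\<close> adds only the scalar action to the record
    \<open>A Quot I\<close>, so the ring axioms transfer field by field.\<close>
  have f: "carrier Q = carrier (A Quot I)" "monoid.mult Q = monoid.mult (A Quot I)"
    "monoid.one Q = monoid.one (A Quot I)" "ring.zero Q = ring.zero (A Quot I)" "ring.add Q = ring.add (A Quot I)"
    by (auto simp: quotient_algebra_def ring.defs)
  have "ring Q"
  proof (rule ringI)
    show "abelian_group Q"
      by (rule abelian_groupI) (auto simp: f QQ.a_assoc QQ.a_comm QQ.a_lcomm simp del: Q_fields intro: QQ.add.l_inv_ex)
    show "Group.monoid Q"
      by (rule monoidI) (auto simp: f QQ.m_assoc)
  qed (auto simp: f QQ.l_distr QQ.r_distr)
  then show ?thesis
  proof (rule kalg.intro)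
    show "kalg_axioms Q"
      by standard (auto simp: Q_fields smult_coset a_rcos_sum rcoset_mult_add smult_add_l smult_add_r)
  qed
qed

lemma proj_hom: "(+>) I \<in> algebra_hom A Q"
  by (auto simp: algebra_hom_def ring_hom_def Q_fields smult_coset a_rcos_sum rcoset_mult_add)

lemma descend_coset:
  assumes "kalg B" "lin_map A B g" "\<And>x. x \<in> I \<Longrightarrow> g x = \<zero>\<^bsub>B\<^esub>" "x \<in> carrier A"
  shows "descend g (I +> x) = g x"
proof -
  interpret B: kalg B by fact
  have "x \<in> I +> x" using a_rcos_self assms(4) .
  then have "(SOME y. y \<in> I +> x) \<in> I +> x" by (rule someI)
  then obtain h where "h \<in> I" "(SOME y. y \<in> I +> x) = h \<oplus> x" by (auto simp: a_r_coset_def')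
  then show ?thesis using assms a_Hcarr by (auto simp: descend_def lin_map_def Pi_iff)
qed

lemma lin_map_descend:
  assumes "kalg B" "lin_map A B g" "\<And>x. x \<in> I \<Longrightarrow> g x = \<zero>\<^bsub>B\<^esub>"
  shows "lin_map Q B (descend g)"
  using assms(2)
  by (auto simp: lin_map_def Q_fields smult_coset a_rcos_sum descend_coset[OF assms])

lemma algebra_hom_descend:
  assumes "kalg B" "h \<in> algebra_hom A B" "\<And>x. x \<in> I \<Longrightarrow> h x = \<zero>\<^bsub>B\<^esub>"
  shows "descend h \<in> algebra_hom Q B"
  using algebra_homD[OF assms(2)]
  by (auto simp: algebra_hom_def ring_hom_def Q_fields smult_coset a_rcos_sum rcoset_mult_add
      descend_coset[OF assms(1) algebra_hom_lin_map[OF assms(2)] assms(3)])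

end

section \<open>Tensor products\<close>

lemma tensor_relatorsE:
  assumes "\<rho> \<in> tensor_relators A B"
  obtains (1) a a' b where "a \<in> carrier A" "a' \<in> carrier A" "b \<in> carrier B"
      "\<rho> = Poly_Mapping.single (a \<oplus>\<^bsub>A\<^esub> a', b) 1 - Poly_Mapping.single (a, b) 1 - Poly_Mapping.single (a', b) 1"
    | (2) a b b' where "a \<in> carrier A" "b \<in> carrier B" "b' \<in> carrier B"
      "\<rho> = Poly_Mapping.single (a, b \<oplus>\<^bsub>B\<^esub> b') 1 - Poly_Mapping.single (a, b) 1 - Poly_Mapping.single (a, b') 1"
    | (3) a b d where "a \<in> carrier A" "b \<in> carrier B"
      "\<rho> = Poly_Mapping.single (d \<odot>\<^bsub>A\<^esub> a, b) 1 - Poly_Mapping.single (a, b) d"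
    | (4) a b d where "a \<in> carrier A" "b \<in> carrier B"
      "\<rho> = Poly_Mapping.single (a, d \<odot>\<^bsub>B\<^esub> b) 1 - Poly_Mapping.single (a, b) d"
proof -
  from assms show thesis
    unfolding tensor_relators_def
  proof (elim UnE CollectE exE conjE, goal_cases)
    case (1 a a' b) show ?case by (rule that(1)[OF 1(2-4) 1(1)])
  next
    case (2 a b b') show ?case by (rule that(2)[OF 2(2-4) 2(1)])
  next
    case (3 c a b) show ?case by (rule that(3)[OF 3(2-3) 3(1)])
  next
    case (4 c a b) show ?case by (rule that(4)[OF 4(2-3) 4(1)])
  qed
qed

locale kalg_pair = A: kalg A + B: kalg B
  for A :: "('k::field, 'a, 'm) module_scheme" and B :: "('k, 'b, 'n) module_scheme"
begin

abbreviation "MA \<equiv> monoid_algebra (A \<times>\<times> B) :: ('k, 'a \<times> 'b \<Rightarrow>\<^sub>0 'k) module"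
abbreviation "T \<equiv> tensor_algebra A B"
abbreviation "tens \<equiv> pure_tensor A B"
abbreviation "TI \<equiv> tensor_ideal A B"

lemma monoid_pair: "Group.monoid (A \<times>\<times> B)"
  by (intro DirProd_monoid A.monoid_axioms B.monoid_axioms)

sublocale MA: kalg MA by (rule kalg_monoid_algebra[OF monoid_pair])

lemma relators_subset: "tensor_relators A B \<subseteq> carrier MA"
  unfolding tensor_relators_def
  by (auto simp: in_keys_iff lookup_add lookup_minus lookup_single when_def split: if_splits)

sublocale MI: kalg_ideal MA TI
  by (intro kalg_ideal.intro MA.kalg_axioms) (simp add: tensor_ideal_def MA.genideal_ideal[OF relators_subset])

lemma T_eq: "T = quotient_algebra MA TI" by (simp add: tensor_algebra_def)

sublocale T: kalg T unfolding T_eq by (rule MI.kalg_Q)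

lemma tens_eq: "tens a b = TI +>\<^bsub>MA\<^esub> Poly_Mapping.single (a, b) 1"
  by (simp add: pure_tensor_def)

lemma relator_in: "r \<in> tensor_relators A B \<Longrightarrow> r \<in> TI"
  using MA.genideal_self[OF relators_subset] by (auto simp: tensor_ideal_def)

lemma tens_closed [simp]: "a \<in> carrier A \<Longrightarrow> b \<in> carrier B \<Longrightarrow> tens a b \<in> carrier T"
  unfolding T_eq tens_eq MI.Q_fields by (intro imageI) simp

lemma proj_add: "\<lbrakk>x \<in> carrier MA; y \<in> carrier MA\<rbrakk> \<Longrightarrow>
    TI +>\<^bsub>MA\<^esub> (x + y) = (TI +>\<^bsub>MA\<^esub> x) \<oplus>\<^bsub>T\<^esub> (TI +>\<^bsub>MA\<^esub> y)"
  using algebra_homD(2)[OF MI.proj_hom] by (simp add: T_eq)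

lemma proj_smult: "x \<in> carrier MA \<Longrightarrow>
    TI +>\<^bsub>MA\<^esub> (Poly_Mapping.map ((*) c) x) = c \<odot>\<^bsub>T\<^esub> (TI +>\<^bsub>MA\<^esub> x)"
  using algebra_homD(4)[OF MI.proj_hom, of x c] by (simp add: T_eq)

lemma a_minus_MA: "x \<in> carrier MA \<Longrightarrow> y \<in> carrier MA \<Longrightarrow> x \<ominus>\<^bsub>MA\<^esub> y = x - y"
proof -
  assume x: "x \<in> carrier MA" and y: "y \<in> carrier MA"
  have "Poly_Mapping.map ((*) (- 1)) y = - y" by (rule poly_mapping_eqI) simp
  then show ?thesis using x y MA.diff_eq_smult[of y x] by simp
qed

lemma tens_add_l: "\<lbrakk>a \<in> carrier A; a' \<in> carrier A; b \<in> carrier B\<rbrakk> \<Longrightarrow>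
    tens (a \<oplus>\<^bsub>A\<^esub> a') b = tens a b \<oplus>\<^bsub>T\<^esub> tens a' b"
proof -
  assume H: "a \<in> carrier A" "a' \<in> carrier A" "b \<in> carrier B"
  let ?s = "\<lambda>a. Poly_Mapping.single (a, b) (1::'k)"
  have m: "?s a \<in> carrier MA" "?s a' \<in> carrier MA" "?s (a \<oplus>\<^bsub>A\<^esub> a') \<in> carrier MA" using H by auto
  then have p: "?s a + ?s a' \<in> carrier MA" using MA.a_closed[OF m(1,2)] by simp
  have "?s (a \<oplus>\<^bsub>A\<^esub> a') - ?s a - ?s a' \<in> TI"
    by (rule relator_in) (use H in \<open>auto simp: tensor_relators_def\<close>)
  then have "?s (a \<oplus>\<^bsub>A\<^esub> a') \<ominus>\<^bsub>MA\<^esub> (?s a + ?s a') \<in> TI"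
    unfolding a_minus_MA[OF m(3) p] by (simp only: diff_diff_eq)
  then have "TI +>\<^bsub>MA\<^esub> ?s (a \<oplus>\<^bsub>A\<^esub> a') = TI +>\<^bsub>MA\<^esub> (?s a + ?s a')"
    using m p by (intro MI.coset_eqI) auto
  then show ?thesis using proj_add[OF m(1,2)] by (simp add: tens_eq)
qed

lemma tens_add_r: "\<lbrakk>a \<in> carrier A; b \<in> carrier B; b' \<in> carrier B\<rbrakk> \<Longrightarrow>
    tens a (b \<oplus>\<^bsub>B\<^esub> b') = tens a b \<oplus>\<^bsub>T\<^esub> tens a b'"
proof -
  assume H: "a \<in> carrier A" "b \<in> carrier B" "b' \<in> carrier B"
  let ?s = "\<lambda>b. Poly_Mapping.single (a, b) (1::'k)"
  have m: "?s b \<in> carrier MA" "?s b' \<in> carrier MA" "?s (b \<oplus>\<^bsub>B\<^esub> b') \<in> carrier MA" using H by auto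
  then have p: "?s b + ?s b' \<in> carrier MA" using MA.a_closed[OF m(1,2)] by simp
  have "?s (b \<oplus>\<^bsub>B\<^esub> b') - ?s b - ?s b' \<in> TI"
    by (rule relator_in) (use H in \<open>auto simp: tensor_relators_def\<close>)
  then have "?s (b \<oplus>\<^bsub>B\<^esub> b') \<ominus>\<^bsub>MA\<^esub> (?s b + ?s b') \<in> TI"
    unfolding a_minus_MA[OF m(3) p] by (simp only: diff_diff_eq)
  then have "TI +>\<^bsub>MA\<^esub> ?s (b \<oplus>\<^bsub>B\<^esub> b') = TI +>\<^bsub>MA\<^esub> (?s b + ?s b')"
    using m p by (intro MI.coset_eqI) auto
  then show ?thesis using proj_add[OF m(1,2)] by (simp add: tens_eq)
qed

lemma coset_single: "\<lbrakk>a \<in> carrier A; b \<in> carrier B\<rbrakk> \<Longrightarrow>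
    TI +>\<^bsub>MA\<^esub> Poly_Mapping.single (a, b) c = c \<odot>\<^bsub>T\<^esub> tens a b"
  using proj_smult[of "Poly_Mapping.single (a, b) 1" c] by (simp add: tens_eq)

lemma tens_smult_l: "\<lbrakk>a \<in> carrier A; b \<in> carrier B\<rbrakk> \<Longrightarrow> tens (c \<odot>\<^bsub>A\<^esub> a) b = c \<odot>\<^bsub>T\<^esub> tens a b"
proof -
  assume H: "a \<in> carrier A" "b \<in> carrier B"
  have m: "Poly_Mapping.single (c \<odot>\<^bsub>A\<^esub> a, b) (1::'k) \<in> carrier MA"
    "Poly_Mapping.single (a, b) c \<in> carrier MA" using H by auto
  have "Poly_Mapping.single (c \<odot>\<^bsub>A\<^esub> a, b) (1::'k) - Poly_Mapping.single (a, b) c \<in> TI"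
    by (rule relator_in) (use H in \<open>auto simp: tensor_relators_def\<close>)
  then show ?thesis
    unfolding coset_single[OF H, symmetric] tens_eq[of "c \<odot>\<^bsub>A\<^esub> a"]
    using m a_minus_MA[OF m] by (intro MI.coset_eqI) auto
qed

lemma tens_smult_r: "\<lbrakk>a \<in> carrier A; b \<in> carrier B\<rbrakk> \<Longrightarrow> tens a (c \<odot>\<^bsub>B\<^esub> b) = c \<odot>\<^bsub>T\<^esub> tens a b"
proof -
  assume H: "a \<in> carrier A" "b \<in> carrier B"
  have m: "Poly_Mapping.single (a, c \<odot>\<^bsub>B\<^esub> b) (1::'k) \<in> carrier MA"
    "Poly_Mapping.single (a, b) c \<in> carrier MA" using H by auto
  have "Poly_Mapping.single (a, c \<odot>\<^bsub>B\<^esub> b) (1::'k) - Poly_Mapping.single (a, b) c \<in> TI"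
    by (rule relator_in) (use H in \<open>auto simp: tensor_relators_def\<close>)
  then show ?thesis
    unfolding coset_single[OF H, symmetric] tens_eq[of _ "c \<odot>\<^bsub>B\<^esub> b"]
    using m a_minus_MA[OF m] by (intro MI.coset_eqI) auto
qed

lemma tens_mult: "\<lbrakk>a \<in> carrier A; b \<in> carrier B; a' \<in> carrier A; b' \<in> carrier B\<rbrakk> \<Longrightarrow>
    tens a b \<otimes>\<^bsub>T\<^esub> tens a' b' = tens (a \<otimes>\<^bsub>A\<^esub> a') (b \<otimes>\<^bsub>B\<^esub> b')"
  using algebra_homD(3)[OF MI.proj_hom, of "Poly_Mapping.single (a, b) 1" "Poly_Mapping.single (a', b') 1"]
  by (simp add: T_eq tens_eq)

lemma tens_one: "tens \<one>\<^bsub>A\<^esub> \<one>\<^bsub>B\<^esub> = \<one>\<^bsub>T\<^esub>"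
  using algebra_homD(5)[OF MI.proj_hom] by (simp add: T_eq tens_eq)

lemma tens_pow: "\<lbrakk>a \<in> carrier A; b \<in> carrier B\<rbrakk> \<Longrightarrow>
    tens a b [^]\<^bsub>T\<^esub> (n::nat) = tens (a [^]\<^bsub>A\<^esub> n) (b [^]\<^bsub>B\<^esub> n)"
  by (induction n) (auto simp: tens_one tens_mult)

lemma tens_zero: "b \<in> carrier B \<Longrightarrow> tens \<zero>\<^bsub>A\<^esub> b = \<zero>\<^bsub>T\<^esub>" "a \<in> carrier A \<Longrightarrow> tens a \<zero>\<^bsub>B\<^esub> = \<zero>\<^bsub>T\<^esub>"
  using tens_smult_l[of "\<zero>\<^bsub>A\<^esub>" b 0] tens_smult_r[of a "\<zero>\<^bsub>B\<^esub>" 0] by auto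

text \<open>The extension of a bilinear map to formal combinations of pairs is linear but not
  multiplicative, while the relations generate a two-sided ideal. It still vanishes there: a relator
  multiplied by pairs on both sides is a relator of the same kind.\<close>

lemma tensor_lift:
  assumes "kalg C" and \<beta>: "\<And>a b. \<lbrakk>a \<in> carrier A; b \<in> carrier B\<rbrakk> \<Longrightarrow> \<beta> a b \<in> carrier C"
    and l: "\<And>b. b \<in> carrier B \<Longrightarrow> lin_map A C (\<lambda>a. \<beta> a b)"
    and r: "\<And>a. a \<in> carrier A \<Longrightarrow> lin_map B C (\<beta> a)"
  obtains g where "lin_map T C g" "\<And>a b. \<lbrakk>a \<in> carrier A; b \<in> carrier B\<rbrakk> \<Longrightarrow> g (tens a b) = \<beta> a b"
proof -
  interpret C: kalg C by fact
  let ?K = Poly_Mapping.keys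
  define g where "g = lin C (\<lambda>(a, b). \<beta> a b)"
  have lm: "lin_map MA C g"
    unfolding g_def by (rule C.lin_map_lin) (use \<beta> in auto)
  have gs: "g (Poly_Mapping.single (a, b) c) = c \<odot>\<^bsub>C\<^esub> \<beta> a b"
    if "a \<in> carrier A" "b \<in> carrier B" for a b c
    unfolding g_def using that \<beta> by simp
  have gadd: "g (x + y) = g x \<oplus>\<^bsub>C\<^esub> g y" if "x \<in> carrier MA" "y \<in> carrier MA" for x y
    using lm that unfolding lin_map_def by simp
  have g0: "g 0 = \<zero>\<^bsub>C\<^esub>" using lin_map_zero[OF MA.kalg_axioms assms(1) lm] by simp
  have rel0: "g (u \<otimes>\<^bsub>MA\<^esub> \<rho> \<otimes>\<^bsub>MA\<^esub> v) = \<zero>\<^bsub>C\<^esub>"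
    if \<rho>: "\<rho> \<in> tensor_relators A B" and u: "u \<in> carrier MA" and v: "v \<in> carrier MA" for \<rho> u v
  proof -
    have \<rho>c: "\<rho> \<in> carrier MA" using \<rho> relators_subset by auto
    have u': "?K u \<subseteq> carrier A \<times> carrier B" and v': "?K v \<subseteq> carrier A \<times> carrier B" using u v by auto
    show ?thesis using u'
    proof (induction u rule: poly_mapping_span_induct)
      case zero
      then show ?case by (simp add: g0)
    next
      case (add x y)
      then have "x \<in> carrier MA" "y \<in> carrier MA" by auto
      then have "x \<otimes>\<^bsub>MA\<^esub> \<rho> \<otimes>\<^bsub>MA\<^esub> v \<in> carrier MA" "y \<otimes>\<^bsub>MA\<^esub> \<rho> \<otimes>\<^bsub>MA\<^esub> v \<in> carrier MA"
        using \<rho>c v MA.m_closed by blast+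
      then show ?case using add by (simp add: monoid_algebra_mult_add gadd)
    next
      case (single p c)
      obtain a0 b0 where p: "p = (a0, b0)" "a0 \<in> carrier A" "b0 \<in> carrier B" using single by auto
      have sc: "Poly_Mapping.single p c \<in> carrier MA" using p by auto
      show ?case using v'
      proof (induction v rule: poly_mapping_span_induct)
        case zero
        then show ?case by (simp add: g0)
      next
        case (add x y)
        then have "x \<in> carrier MA" "y \<in> carrier MA" by auto
        then have "Poly_Mapping.single p c \<otimes>\<^bsub>MA\<^esub> \<rho> \<otimes>\<^bsub>MA\<^esub> x \<in> carrier MA"
          "Poly_Mapping.single p c \<otimes>\<^bsub>MA\<^esub> \<rho> \<otimes>\<^bsub>MA\<^esub> y \<in> carrier MA"
          using \<rho>c sc MA.m_closed by blast+
        then show ?case using add by (simp add: monoid_algebra_mult_add gadd)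
      next
        case (single p' c')
        obtain a1 b1 where p': "p' = (a1, b1)" "a1 \<in> carrier A" "b1 \<in> carrier B" using single by auto
        let ?s = "\<lambda>a b d. Poly_Mapping.single (a, b) (d::'k)"
        have sum3: "g (?s a b d + ?s a' b' d' + ?s a'' b'' d'') = d \<odot>\<^bsub>C\<^esub> \<beta> a b \<oplus>\<^bsub>C\<^esub> d' \<odot>\<^bsub>C\<^esub> \<beta> a' b' \<oplus>\<^bsub>C\<^esub> d'' \<odot>\<^bsub>C\<^esub> \<beta> a'' b''"
          if "a \<in> carrier A" "a' \<in> carrier A" "a'' \<in> carrier A" "b \<in> carrier B" "b' \<in> carrier B" "b'' \<in> carrier B"
          for a a' a'' b b' b'' d d' d''
        proof -
          have c: "?s a b d \<in> carrier MA" "?s a' b' d' \<in> carrier MA" "?s a'' b'' d'' \<in> carrier MA"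
            using that by auto
          have "?s a b d + ?s a' b' d' \<in> carrier MA" using MA.a_closed[OF c(1,2)] by simp
          then show ?thesis using c that by (simp add: gadd gs)
        qed
        have sum2: "g (?s a b d + ?s a' b' d') = d \<odot>\<^bsub>C\<^esub> \<beta> a b \<oplus>\<^bsub>C\<^esub> d' \<odot>\<^bsub>C\<^esub> \<beta> a' b'"
          if "a \<in> carrier A" "a' \<in> carrier A" "b \<in> carrier B" "b' \<in> carrier B" for a a' b b' d d'
        proof -
          have c: "?s a b d \<in> carrier MA" "?s a' b' d' \<in> carrier MA" using that by auto
          then show ?thesis using c that by (simp add: gadd gs)
        qed
        have dm: "x - ?s a b d = x + ?s a b (- d)" for x a b d
          by (simp add: single_uminus)
        \<comment> \<open>The additive relators reduce to \<open>cancel3\<close> and the scalar ones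
          to \<open>cancel2\<close>, always with the common factor \<open>c * c'\<close> contributed
          by the two outer monomials.\<close>
        have cancel3: "d \<odot>\<^bsub>C\<^esub> (x \<oplus>\<^bsub>C\<^esub> y) \<oplus>\<^bsub>C\<^esub> (- d) \<odot>\<^bsub>C\<^esub> x \<oplus>\<^bsub>C\<^esub> (- d) \<odot>\<^bsub>C\<^esub> y = \<zero>\<^bsub>C\<^esub>"
          if "x \<in> carrier C" "y \<in> carrier C" for x y d
        proof -
          have "(- d) \<odot>\<^bsub>C\<^esub> x \<oplus>\<^bsub>C\<^esub> (- d) \<odot>\<^bsub>C\<^esub> y = (- d) \<odot>\<^bsub>C\<^esub> (x \<oplus>\<^bsub>C\<^esub> y)" using that by (simp add: C.smult_add_r)
          then have "d \<odot>\<^bsub>C\<^esub> (x \<oplus>\<^bsub>C\<^esub> y) \<oplus>\<^bsub>C\<^esub> (- d) \<odot>\<^bsub>C\<^esub> x \<oplus>\<^bsub>C\<^esub> (- d) \<odot>\<^bsub>C\<^esub> y = (d + - d) \<odot>\<^bsub>C\<^esub> (x \<oplus>\<^bsub>C\<^esub> y)"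
            using that C.smult_add_l[of "x \<oplus>\<^bsub>C\<^esub> y" d "- d"] by (simp add: C.a_assoc)
          then show ?thesis using that by simp
        qed
        have cancel2: "d \<odot>\<^bsub>C\<^esub> (e \<odot>\<^bsub>C\<^esub> x) \<oplus>\<^bsub>C\<^esub> (- (d * e)) \<odot>\<^bsub>C\<^esub> x = \<zero>\<^bsub>C\<^esub>" if "x \<in> carrier C" for x d e
          using that C.smult_add_l[of x "d * e" "- (d * e)"] by simp
        have bl: "\<beta> (a \<oplus>\<^bsub>A\<^esub> a') b = \<beta> a b \<oplus>\<^bsub>C\<^esub> \<beta> a' b" "\<beta> (d \<odot>\<^bsub>A\<^esub> a) b = d \<odot>\<^bsub>C\<^esub> \<beta> a b"
          if "a \<in> carrier A" "a' \<in> carrier A" "b \<in> carrier B" for a a' b d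
          using l[of b] that by (auto simp: lin_map_def)
        have br: "\<beta> a (b \<oplus>\<^bsub>B\<^esub> b') = \<beta> a b \<oplus>\<^bsub>C\<^esub> \<beta> a b'" "\<beta> a (d \<odot>\<^bsub>B\<^esub> b) = d \<odot>\<^bsub>C\<^esub> \<beta> a b"
          if "a \<in> carrier A" "b \<in> carrier B" "b' \<in> carrier B" for a b b' d
          using r[of a] that by (auto simp: lin_map_def)
        note ss = sum2 sum3 p p' dm monoid_algebra_mult_add bl br
          A.l_distr A.r_distr B.l_distr B.r_distr \<beta>
        from \<rho> show ?case
        proof (cases rule: tensor_relatorsE)
          case (1 a a' b)
          then show ?thesis
            using cancel3[of "\<beta> (a0 \<otimes>\<^bsub>A\<^esub> a \<otimes>\<^bsub>A\<^esub> a1) (b0 \<otimes>\<^bsub>B\<^esub> b \<otimes>\<^bsub>B\<^esub> b1)" "\<beta> (a0 \<otimes>\<^bsub>A\<^esub> a' \<otimes>\<^bsub>A\<^esub> a1) (b0 \<otimes>\<^bsub>B\<^esub> b \<otimes>\<^bsub>B\<^esub> b1)" "c * c'"]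
            by (simp add: ss)
        next
          case (2 a b b')
          then show ?thesis
            using cancel3[of "\<beta> (a0 \<otimes>\<^bsub>A\<^esub> a \<otimes>\<^bsub>A\<^esub> a1) (b0 \<otimes>\<^bsub>B\<^esub> b \<otimes>\<^bsub>B\<^esub> b1)" "\<beta> (a0 \<otimes>\<^bsub>A\<^esub> a \<otimes>\<^bsub>A\<^esub> a1) (b0 \<otimes>\<^bsub>B\<^esub> b' \<otimes>\<^bsub>B\<^esub> b1)" "c * c'"]
            by (simp add: ss)
        next
          case (3 a b d)
          then show ?thesis
            using cancel2[of "\<beta> (a0 \<otimes>\<^bsub>A\<^esub> a \<otimes>\<^bsub>A\<^esub> a1) (b0 \<otimes>\<^bsub>B\<^esub> b \<otimes>\<^bsub>B\<^esub> b1)" "c * c'" d]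
            by (simp add: ss mult.assoc mult.commute mult.left_commute)
        next
          case (4 a b d)
          then show ?thesis
            using cancel2[of "\<beta> (a0 \<otimes>\<^bsub>A\<^esub> a \<otimes>\<^bsub>A\<^esub> a1) (b0 \<otimes>\<^bsub>B\<^esub> b \<otimes>\<^bsub>B\<^esub> b1)" "c * c'" d]
            by (simp add: ss mult.assoc mult.commute mult.left_commute)
        qed
      qed
    qed
  qed
  have kill: "g x = \<zero>\<^bsub>C\<^esub>" if "x \<in> TI" for x
    using lin_map_genideal_zero[OF MA.kalg_axioms assms(1) lm relators_subset rel0] that
    unfolding tensor_ideal_def by blast
  show ?thesis
  proof (rule that)
    show "lin_map T C (descend g)"
      unfolding T_eq by (rule MI.lin_map_descend[OF assms(1) lm kill])
    show "descend g (tens a b) = \<beta> a b" if "a \<in> carrier A" "b \<in> carrier B" for a b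
      unfolding tens_eq using MI.descend_coset[OF assms(1) lm kill, of "Poly_Mapping.single (a, b) 1"] that \<beta>
      by (simp add: gs)
  qed
qed

text \<open>This is \<open>id \<otimes> f\<close>, the contraction of the second tensor factor from
  which all slices are obtained.\<close>

lemma tensor_lift_functional:
  assumes "functional B f"
  obtains g where "lin_map T A g" "\<And>a b. \<lbrakk>a \<in> carrier A; b \<in> carrier B\<rbrakk> \<Longrightarrow> g (tens a b) = f b \<odot>\<^bsub>A\<^esub> a"
proof -
  have 1: "lin_map A A (\<lambda>a. f b \<odot>\<^bsub>A\<^esub> a)" for b
    by (auto simp: lin_map_def A.smult_add_r mult.commute)
  have 2: "lin_map B A (\<lambda>b. f b \<odot>\<^bsub>A\<^esub> a)" if "a \<in> carrier A" for a
    using assms that by (auto simp: lin_map_def functional_def A.smult_add_l)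
  obtain g where "lin_map T A g" "\<And>a b. \<lbrakk>a \<in> carrier A; b \<in> carrier B\<rbrakk> \<Longrightarrow> g (tens a b) = f b \<odot>\<^bsub>A\<^esub> a"
    by (rule tensor_lift[OF A.kalg_axioms _ 1 2]) auto
  then show thesis by (rule that)
qed

end

section \<open>Subalgebras\<close>

lemma unital_subalgebraD:
  assumes "kalg A" "unital_subalgebra A S"
  shows "S \<subseteq> carrier A" "\<one>\<^bsub>A\<^esub> \<in> S" "\<zero>\<^bsub>A\<^esub> \<in> S"
    "\<And>x y. \<lbrakk>x \<in> S; y \<in> S\<rbrakk> \<Longrightarrow> x \<oplus>\<^bsub>A\<^esub> y \<in> S"
    "\<And>x y. \<lbrakk>x \<in> S; y \<in> S\<rbrakk> \<Longrightarrow> x \<otimes>\<^bsub>A\<^esub> y \<in> S"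
    "\<And>x y. \<lbrakk>x \<in> S; y \<in> S\<rbrakk> \<Longrightarrow> x \<ominus>\<^bsub>A\<^esub> y \<in> S"
    "\<And>c x. x \<in> S \<Longrightarrow> c \<odot>\<^bsub>A\<^esub> x \<in> S"
    "\<And>x n. x \<in> S \<Longrightarrow> x [^]\<^bsub>A\<^esub> (n::nat) \<in> S"
    "\<And>I x. (\<And>i. i \<in> I \<Longrightarrow> x i \<in> S) \<Longrightarrow> (\<Oplus>\<^bsub>A\<^esub>i\<in>I. x i) \<in> S"
proof -
  interpret A: kalg A by fact
  have s: "subring S A" using assms(2) by (simp add: unital_subalgebra_def)
  note ss = subringE[OF s]
  show sc: "S \<subseteq> carrier A" and "\<one>\<^bsub>A\<^esub> \<in> S" and z: "\<zero>\<^bsub>A\<^esub> \<in> S" using ss by auto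
  show a: "\<And>x y. \<lbrakk>x \<in> S; y \<in> S\<rbrakk> \<Longrightarrow> x \<oplus>\<^bsub>A\<^esub> y \<in> S" and
    m: "\<And>x y. \<lbrakk>x \<in> S; y \<in> S\<rbrakk> \<Longrightarrow> x \<otimes>\<^bsub>A\<^esub> y \<in> S" using ss by auto
  show "\<And>x y. \<lbrakk>x \<in> S; y \<in> S\<rbrakk> \<Longrightarrow> x \<ominus>\<^bsub>A\<^esub> y \<in> S" using ss by (auto simp: a_minus_def)
  show "\<And>c x. x \<in> S \<Longrightarrow> c \<odot>\<^bsub>A\<^esub> x \<in> S" using assms(2) by (simp add: unital_subalgebra_def)
  show "x [^]\<^bsub>A\<^esub> (n::nat) \<in> S" if "x \<in> S" for x n
    using that ss m by (induction n) auto
  show "(\<Oplus>\<^bsub>A\<^esub>i\<in>I. x i) \<in> S" if "\<And>i. i \<in> I \<Longrightarrow> x i \<in> S" for I x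
    using that sc
  proof (induction I rule: infinite_finite_induct)
    case (insert i I)
    have "x \<in> I \<rightarrow> carrier A" "x i \<in> carrier A" using insert.prems by blast+
    then show ?case using insert a by simp
  qed (use z in auto)
qed

lemma unital_subalgebraI:
  assumes "kalg A" "S \<subseteq> carrier A" "\<one>\<^bsub>A\<^esub> \<in> S"
    and "\<And>x y. \<lbrakk>x \<in> S; y \<in> S\<rbrakk> \<Longrightarrow> x \<oplus>\<^bsub>A\<^esub> y \<in> S"
    and "\<And>x y. \<lbrakk>x \<in> S; y \<in> S\<rbrakk> \<Longrightarrow> x \<otimes>\<^bsub>A\<^esub> y \<in> S"
    and "\<And>c x. x \<in> S \<Longrightarrow> c \<odot>\<^bsub>A\<^esub> x \<in> S"
  shows "unital_subalgebra A S"
proof -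
  interpret A: kalg A by fact
  have "\<ominus>\<^bsub>A\<^esub> x \<in> S" if "x \<in> S" for x
    using assms(2,6) that A.minus_eq_smult by auto
  then have "subring S A"
    using assms by (intro A.subringI) auto
  then show ?thesis using assms(6) by (simp add: unital_subalgebra_def)
qed

lemma unital_subalgebra_carrier: "kalg A \<Longrightarrow> unital_subalgebra A (carrier A)"
proof -
  assume a: "kalg A"
  interpret kalg A by fact
  show ?thesis by (rule unital_subalgebraI[OF a]) auto
qed

lemma unital_subalgebra_generated:
  assumes "kalg A" "G \<subseteq> carrier A"
  shows "unital_subalgebra A (subalgebra_generated A G)"
proof (rule unital_subalgebraI[OF assms(1)])
  note D = unital_subalgebraD[OF assms(1)]
  show "subalgebra_generated A G \<subseteq> carrier A"
    using unital_subalgebra_carrier[OF assms(1)] assms(2) by (auto simp: subalgebra_generated_def)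
qed (auto simp: subalgebra_generated_def unital_subalgebraD[OF assms(1)])

lemma subalgebra_generated_incl: "G \<subseteq> subalgebra_generated A G"
  by (auto simp: subalgebra_generated_def)

lemma subalgebra_generated_minimal:
  "\<lbrakk>unital_subalgebra A S; G \<subseteq> S\<rbrakk> \<Longrightarrow> subalgebra_generated A G \<subseteq> S"
  by (auto simp: subalgebra_generated_def)

section \<open>Gaussian binomial coefficients\<close>

definition qnum :: "'k::field \<Rightarrow> nat \<Rightarrow> 'k" where
  "qnum p n = (\<Sum>i<n. p ^ i)"

text \<open>Gaussian binomials are introduced by the Pascal recursion and not as quotients of
  factorials, because at a root of unity the factorials vanish from \<open>N\<close> on.\<close>

fun qbin :: "'k::field \<Rightarrow> nat \<Rightarrow> nat \<Rightarrow> 'k" where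
  "qbin p 0 0 = 1"
| "qbin p 0 (Suc s) = 0"
| "qbin p (Suc n) 0 = 1"
| "qbin p (Suc n) (Suc s) = qbin p n s + p ^ Suc s * qbin p n (Suc s)"

lemma qnum_0 [simp]: "qnum p 0 = 0" and qnum_Suc: "qnum p (Suc n) = 1 + p * qnum p n"
  and qnum_Suc': "qnum p (Suc n) = qnum p n + p ^ n"
proof -
  show "qnum p 0 = 0" by (simp add: qnum_def)
  show "qnum p (Suc n) = qnum p n + p ^ n" by (simp add: qnum_def)
  show "qnum p (Suc n) = 1 + p * qnum p n"
    unfolding qnum_def by (simp add: sum.lessThan_Suc_shift sum_distrib_left del: sum.lessThan_Suc)
qed

lemma qnum_add: "qnum p (m + n) = qnum p m + p ^ m * qnum p n"
  by (induction n) (simp_all add: qnum_Suc' algebra_simps power_add)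

lemma qnum_geometric: "(p - 1) * qnum p n = p ^ n - 1"
  by (induction n) (simp_all add: qnum_Suc' algebra_simps)

lemma qbin_0 [simp]: "qbin p n 0 = 1" by (cases n) auto

lemma qbin_zero: "n < s \<Longrightarrow> qbin p n s = 0"
proof (induction n arbitrary: s)
  case 0 then show ?case by (cases s) auto
next
  case (Suc n) then show ?case by (cases s) auto
qed

lemma qbin_self [simp]: "qbin p n n = 1"
  by (induction n) (auto simp: qbin_zero)

text \<open>The factorial formula with cleared denominators. Pascal's recursion splits the left
  side, and \<open>[s + u] = [s] + p^s [u]\<close> reassembles the last factor.\<close>

lemma qbin_qfact:
  "qbin p (s + u) s * (\<Prod>i=1..s. qnum p i) * (\<Prod>i=1..u. qnum p i) = (\<Prod>i=1..s + u. qnum p i)"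
proof (induction "s + u" arbitrary: s u rule: less_induct)
  case less
  show ?case
  proof (cases "s = 0 \<or> u = 0")
    case False
    then obtain s' u' where su: "s = Suc s'" "u = Suc u'" by (metis not0_implies_Suc)
    let ?f = "\<lambda>n. \<Prod>i=1..n. qnum p i"
    have 1: "qbin p (s' + u) s' * ?f s' * ?f u = ?f (s' + u)" using less[of s' u] su by simp
    have 2: "qbin p (s + u') s * ?f s * ?f u' = ?f (s + u')" using less[of s u'] su by simp
    have fs: "?f s = ?f s' * qnum p s" "?f u = ?f u' * qnum p u" "?f (s + u) = ?f (s' + u) * qnum p (s + u)"
      using su by simp_all
    have eq: "s + u = Suc (s' + u)" "s + u' = s' + u" using su by auto
    have "qbin p (s + u) s = qbin p (s' + u) s' + p ^ s * qbin p (s + u') s"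
      unfolding eq using su by simp
    then have "qbin p (s + u) s * ?f s * ?f u =
        (qbin p (s' + u) s' * ?f s' * ?f u) * qnum p s + p ^ s * qnum p u * (qbin p (s + u') s * ?f s * ?f u')"
      using fs by (simp add: algebra_simps)
    also have "\<dots> = ?f (s' + u) * qnum p (s + u)"
      unfolding 1 2 unfolding eq(2) qnum_add by (simp add: algebra_simps)
    finally show ?thesis using fs by simp
  qed auto
qed

context kalg
begin

lemma q_comm_pow:
  assumes [simp]: "x \<in> carrier A" "y \<in> carrier A" and xy: "x \<otimes> y = p \<odot> (y \<otimes> x)"
  shows "x [^] (i::nat) \<otimes> y [^] (a::nat) = p ^ (i * a) \<odot> (y [^] a \<otimes> x [^] i)"
proof -
  have 1: "x \<otimes> y [^] a = p ^ a \<odot> (y [^] a \<otimes> x)" for a :: nat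
  proof (induction a)
    case (Suc a)
    have "x \<otimes> y [^] Suc a = (x \<otimes> y [^] a) \<otimes> y" by (simp add: m_assoc)
    also have "\<dots> = p ^ a \<odot> (y [^] a \<otimes> (x \<otimes> y))" by (simp add: Suc m_assoc)
    also have "\<dots> = p ^ Suc a \<odot> (y [^] Suc a \<otimes> x)" by (simp add: xy m_assoc mult.commute)
    finally show ?case .
  qed simp
  show ?thesis
  proof (induction i)
    case (Suc i)
    have "x [^] Suc i \<otimes> y [^] a = x [^] i \<otimes> (x \<otimes> y [^] a)" by (simp add: m_assoc)
    also have "\<dots> = p ^ a \<odot> ((x [^] i \<otimes> y [^] a) \<otimes> x)" by (simp add: 1 m_assoc)
    also have "\<dots> = p ^ (Suc i * a) \<odot> (y [^] a \<otimes> x [^] Suc i)"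
      by (simp add: Suc m_assoc power_add)
    finally show ?case .
  qed simp
qed

text \<open>The scalar stays unspecified because the lemma only serves to show that powers of
  \<open>x \<otimes> y\<close> vanish.\<close>

lemma q_comm_prod_pow:
  assumes [simp]: "x \<in> carrier A" "y \<in> carrier A" and yx: "y \<otimes> x = p \<odot> (x \<otimes> y)"
  shows "\<exists>c. (x \<otimes> y) [^] (n::nat) = c \<odot> (x [^] n \<otimes> y [^] n)"
proof (induction n)
  case (Suc n)
  then obtain c where c: "(x \<otimes> y) [^] n = c \<odot> (x [^] n \<otimes> y [^] n)" by blast
  have yx': "y [^] n \<otimes> x = p ^ n \<odot> (x \<otimes> y [^] n)"
    using q_comm_pow[OF assms(2,1) yx, of n 1] by simp
  have "(x \<otimes> y) [^] Suc n = c \<odot> (x [^] n \<otimes> ((y [^] n \<otimes> x) \<otimes> y))" by (simp add: c m_assoc)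
  also have "\<dots> = (c * p ^ n) \<odot> (x [^] Suc n \<otimes> y [^] Suc n)" by (simp add: yx' m_assoc)
  finally show ?case by blast
qed (auto intro: exI[of _ 1])

lemma q_binomial:
  assumes [simp]: "x \<in> carrier A" "y \<in> carrier A" and yx: "y \<otimes> x = p \<odot> (x \<otimes> y)"
  shows "(x \<oplus> y) [^] n = (\<Oplus>s\<in>{..n}. qbin p n s \<odot> (x [^] s \<otimes> y [^] (n - s)))"
proof (induction n)
  case (Suc n)
  let ?t = "\<lambda>s. qbin p n s \<odot> (x [^] s \<otimes> y [^] (n - s))"
  have yx': "y \<otimes> x [^] s = p ^ s \<odot> (x [^] s \<otimes> y)" for s :: nat
    using q_comm_pow[OF assms(2,1) yx, of 1 s] by simp
  have X: "x \<otimes> (\<Oplus>s\<in>{..n}. ?t s) = (\<Oplus>s\<in>{..n}. qbin p n s \<odot> (x [^] Suc s \<otimes> y [^] (n - s)))"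
  proof -
    have "x \<otimes> x [^] s = x [^] Suc s" for s :: nat using nat_pow_Suc2[of x s] by simp
    then show ?thesis
      by (subst finsum_rdistr) (auto simp: m_assoc[symmetric] simp del: nat_pow_Suc intro!: finsum_cong')
  qed
  have Y: "y \<otimes> (\<Oplus>s\<in>{..n}. ?t s) = (\<Oplus>s\<in>{..n}. (p ^ s * qbin p n s) \<odot> (x [^] s \<otimes> y [^] (Suc n - s)))"
  proof -
    have "y \<otimes> ?t s = (p ^ s * qbin p n s) \<odot> (x [^] s \<otimes> y [^] (Suc n - s))" if "s \<le> n" for s
    proof -
      have "y \<otimes> y [^] (n - s) = y [^] (Suc n - s)" using nat_pow_Suc2[of y "n - s"] that by (simp add: Suc_diff_le)
      moreover have "y \<otimes> ?t s = qbin p n s \<odot> ((y \<otimes> x [^] s) \<otimes> y [^] (n - s))" by (simp add: m_assoc)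
      ultimately show ?thesis by (simp add: yx' m_assoc mult.commute)
    qed
    then show ?thesis
      by (subst finsum_rdistr) (auto intro!: finsum_cong')
  qed
  have X': "(\<Oplus>s\<in>{..n}. qbin p n s \<odot> (x [^] Suc s \<otimes> y [^] (n - s)))
      = (\<Oplus>s\<in>{..n}. qbin p n s \<odot> (x [^] Suc s \<otimes> y [^] (Suc n - Suc s)))" by simp
  \<comment> \<open>The index \<open>Suc n\<close> may be added since its Gaussian binomial is zero;
    splitting off the index 0 then aligns this sum with the one coming from
    \<open>x\<close>.\<close>
  have Y': "(\<Oplus>s\<in>{..n}. (p ^ s * qbin p n s) \<odot> (x [^] s \<otimes> y [^] (Suc n - s)))
      = (\<Oplus>s\<in>{..Suc n}. (p ^ s * qbin p n s) \<odot> (x [^] s \<otimes> y [^] (Suc n - s)))"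
    by (subst finsum_Suc) (auto simp: qbin_zero)
  have "(x \<oplus> y) [^] Suc n = x \<otimes> (\<Oplus>s\<in>{..n}. ?t s) \<oplus> y \<otimes> (\<Oplus>s\<in>{..n}. ?t s)"
    unfolding nat_pow_Suc2[OF a_closed[OF assms(1,2)]] Suc by (subst l_distr) auto
  also have "\<dots> = (\<Oplus>s\<in>{..n}. qbin p n s \<odot> (x [^] Suc s \<otimes> y [^] (Suc n - Suc s))) \<oplus>
     ((\<Oplus>s\<in>{..n}. (p ^ Suc s * qbin p n (Suc s)) \<odot> (x [^] Suc s \<otimes> y [^] (Suc n - Suc s))) \<oplus> y [^] Suc n)"
    unfolding X Y X' Y' by (subst finsum_Suc2) auto
  also have "\<dots> = (\<Oplus>s\<in>{..n}. qbin p (Suc n) (Suc s) \<odot> (x [^] Suc s \<otimes> y [^] (Suc n - Suc s))) \<oplus> y [^] Suc n"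
  proof -
    let ?f = "\<lambda>s. qbin p n s \<odot> (x [^] Suc s \<otimes> y [^] (Suc n - Suc s))"
    let ?g = "\<lambda>s. (p ^ Suc s * qbin p n (Suc s)) \<odot> (x [^] Suc s \<otimes> y [^] (Suc n - Suc s))"
    have "(\<Oplus>s\<in>{..n}. qbin p (Suc n) (Suc s) \<odot> (x [^] Suc s \<otimes> y [^] (Suc n - Suc s)))
        = (\<Oplus>s\<in>{..n}. ?f s \<oplus> ?g s)"
      by (intro finsum_cong') (auto simp: smult_add_l simp del: nat_pow_Suc)
    also have "\<dots> = (\<Oplus>s\<in>{..n}. ?f s) \<oplus> (\<Oplus>s\<in>{..n}. ?g s)"
      by (rule finsum_addf) auto
    finally show ?thesis by (simp only:) (rule a_assoc[symmetric]; auto)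
  qed
  also have "\<dots> = (\<Oplus>s\<in>{..Suc n}. qbin p (Suc n) s \<odot> (x [^] s \<otimes> y [^] (Suc n - s)))"
    by (subst finsum_Suc2) auto
  finally show ?case .
qed simp

section \<open>Linear spans and generated subalgebras\<close>

inductive_set lspan :: "'a set \<Rightarrow> 'a set" for Y where
  base: "x \<in> Y \<Longrightarrow> x \<in> lspan Y"
| add: "x \<in> lspan Y \<Longrightarrow> y \<in> lspan Y \<Longrightarrow> x \<oplus> y \<in> lspan Y"
| smult: "x \<in> lspan Y \<Longrightarrow> c \<odot> x \<in> lspan Y"

lemma lspan_closed: "Y \<subseteq> carrier A \<Longrightarrow> x \<in> lspan Y \<Longrightarrow> x \<in> carrier A"
  by (erule lspan.induct) auto

lemma lspan_left_mult:
  assumes "Y \<subseteq> carrier A" "u \<in> carrier A" "\<And>x. x \<in> Y \<Longrightarrow> u \<otimes> x \<in> lspan Y" "z \<in> lspan Y"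
  shows "u \<otimes> z \<in> lspan Y"
  using assms(4)
  by induction (use assms lspan_closed[OF assms(1)] in \<open>auto simp: r_distr intro: lspan.intros\<close>)

text \<open>The elements whose left multiplication preserves the span form a subalgebra. Once it
  contains the generators it contains all that they generate, and applying such an element to
  \<open>\<one>\<close> shows that it lies in the span.\<close>

lemma subalgebra_generated_lspan:
  assumes "Y \<subseteq> carrier A" "G \<subseteq> carrier A" "\<one> \<in> Y"
    and "\<And>u x. u \<in> G \<Longrightarrow> x \<in> Y \<Longrightarrow> u \<otimes> x \<in> lspan Y"
  shows "subalgebra_generated A G \<subseteq> lspan Y"
proof -
  let ?M = "{u \<in> carrier A. \<forall>z\<in>lspan Y. u \<otimes> z \<in> lspan Y}"
  note c = lspan_closed[OF assms(1)]
  have "unital_subalgebra A ?M"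
  proof (rule unital_subalgebraI[OF kalg_axioms])
    show "\<one> \<in> ?M" using c by simp
    show "x \<oplus> y \<in> ?M" if "x \<in> ?M" "y \<in> ?M" for x y
      using that c by (simp add: l_distr lspan.add)
    show "x \<otimes> y \<in> ?M" if "x \<in> ?M" "y \<in> ?M" for x y
      using that c by (simp add: m_assoc)
    show "a \<odot> x \<in> ?M" if "x \<in> ?M" for a x
      using that c by (simp add: lspan.smult)
  qed auto
  moreover have "u \<in> ?M" if u: "u \<in> G" for u
    using lspan_left_mult[OF assms(1) _ assms(4)[OF u]] assms(2) u by auto
  then have "G \<subseteq> ?M" by blast
  ultimately have "subalgebra_generated A G \<subseteq> ?M" by (rule subalgebra_generated_minimal)
  moreover have "\<one> \<in> lspan Y" using assms(3) by (rule lspan.base)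
  ultimately show ?thesis
  proof (intro subsetI)
    fix u assume "u \<in> subalgebra_generated A G"
    then have "u \<in> carrier A" "u \<otimes> \<one> \<in> lspan Y"
      using \<open>subalgebra_generated A G \<subseteq> ?M\<close> \<open>\<one> \<in> lspan Y\<close> by blast+
    then show "u \<in> lspan Y" by simp
  qed
qed

end

section \<open>Algebras generated by K, E and the normalised F\<close>

locale odd_root =
  fixes q :: "'k::field" and N :: nat
  assumes N1: "N > 1" and oddN: "odd N" and prim: "primitive_root_of_unity N q"
begin

lemma q_pow_iff: "q ^ m = 1 \<longleftrightarrow> N dvd m"
proof -
  have qN: "q ^ N = 1" and mi: "\<And>m. \<lbrakk>0 < m; m < N\<rbrakk> \<Longrightarrow> q ^ m \<noteq> 1"
    using prim by (auto simp: primitive_root_of_unity_def)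
  have "q ^ m = q ^ (N * (m div N) + m mod N)" by simp
  then have "q ^ m = q ^ (m mod N)" by (simp only: power_add power_mult qN power_one mult_1)
  moreover have "m mod N < N" using N1 by simp
  ultimately show ?thesis using mi[of "m mod N"] by (auto simp: dvd_eq_mod_eq_0)
qed

lemma q_nz [simp]: "q \<noteq> 0"
  using prim N1 by (auto simp: primitive_root_of_unity_def power_0_left)

lemma qN [simp]: "q ^ N = 1" by (simp add: q_pow_iff)

text \<open>\<open>N\<close> is odd, so squaring does not change the order of
  \<open>q\<close>.\<close>

lemma q2_pow_iff: "(q ^ 2) ^ m = 1 \<longleftrightarrow> N dvd m"
proof -
  have "coprime N 2" using oddN by (simp add: coprime_commute)
  then show ?thesis by (simp add: power_mult[symmetric] q_pow_iff coprime_dvd_mult_right_iff)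
qed

lemma q2_inv_pow_iff: "(inverse (q ^ 2)) ^ m = 1 \<longleftrightarrow> N dvd m"
  unfolding power_inverse inverse_eq_1_iff by (rule q2_pow_iff)

definition "c0 = q - inverse q"

lemma c0_nz [simp]: "c0 \<noteq> 0"
proof
  assume "c0 = 0"
  then have "q ^ 2 = 1" by (simp add: c0_def power2_eq_square field_simps)
  then have "N dvd 1" using q2_pow_iff[of 1] by simp
  then show False using N1 by simp
qed

text \<open>\<open>p\<close> has exact order \<open>N\<close>. It is applied to \<open>q ^ 2\<close>
  for the powers of \<open>Ft\<close> and to its inverse for the powers of \<open>E\<close> in the
  coproduct.\<close>

definition "good p \<longleftrightarrow> (\<forall>m. p ^ m = 1 \<longleftrightarrow> N dvd m)" for p :: 'k

lemma good_q2: "good (q ^ 2)" and good_q2_inv: "good (inverse (q ^ 2))"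
  unfolding good_def using q2_pow_iff q2_inv_pow_iff by blast+

lemma qnum_eq_0_iff: "good p \<Longrightarrow> qnum p n = 0 \<longleftrightarrow> N dvd n"
proof -
  assume g: "good p"
  then have "p ^ 1 \<noteq> 1" using N1 unfolding good_def by (metis nat_dvd_1_iff_1 less_irrefl)
  then have "qnum p n = 0 \<longleftrightarrow> p ^ n - 1 = 0"
    using qnum_geometric[of p n] by auto
  then show ?thesis using g by (simp add: good_def)
qed

lemma qfact_nz: "good p \<Longrightarrow> n < N \<Longrightarrow> (\<Prod>i=1..n. qnum p i) \<noteq> 0"
  by (auto simp: qnum_eq_0_iff dest!: dvd_imp_le)

lemma qbin_nz: "good p \<Longrightarrow> s + u < N \<Longrightarrow> qbin p (s + u) s \<noteq> 0"
  using qbin_qfact[of p s u] qfact_nz[of p "s + u"] by auto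

text \<open>\<open>[N]!\<close> contains the vanishing factor \<open>[N]\<close>, whereas
  \<open>[s]!\<close> and \<open>[N - s]!\<close> have only nonzero factors.\<close>

lemma qbin_N: "good p \<Longrightarrow> 0 < s \<Longrightarrow> s < N \<Longrightarrow> qbin p N s = 0"
proof -
  assume H: "good p" "0 < s" "s < N"
  have "qnum p N = 0" using H by (simp add: qnum_eq_0_iff)
  then have "(\<Prod>i=1..N. qnum p i) = 0" using N1 by (auto intro!: bexI[of _ N])
  moreover have "qbin p N s * (\<Prod>i=1..s. qnum p i) * (\<Prod>i=1..N - s. qnum p i) = (\<Prod>i=1..N. qnum p i)"
    using qbin_qfact[of p s "N - s"] H by simp
  moreover have "(\<Prod>i=1..s. qnum p i) \<noteq> 0" "(\<Prod>i=1..N - s. qnum p i) \<noteq> 0"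
    using qfact_nz[OF H(1,3)] qfact_nz[OF H(1), of "N - s"] H by simp_all
  ultimately show ?thesis by (metis mult_eq_0_iff)
qed

text \<open>As for Frobenius in positive characteristic, all middle terms of the
  \<open>q\<close>-binomial expansion drop out, and the two extreme ones are zero by
  hypothesis.\<close>

lemma q_binomial_N:
  assumes "kalg A" and [simp]: "x \<in> carrier A" "y \<in> carrier A"
    and yx: "y \<otimes>\<^bsub>A\<^esub> x = p \<odot>\<^bsub>A\<^esub> (x \<otimes>\<^bsub>A\<^esub> y)" and "good p"
    and "x [^]\<^bsub>A\<^esub> N = \<zero>\<^bsub>A\<^esub>" "y [^]\<^bsub>A\<^esub> N = \<zero>\<^bsub>A\<^esub>"
  shows "(x \<oplus>\<^bsub>A\<^esub> y) [^]\<^bsub>A\<^esub> N = \<zero>\<^bsub>A\<^esub>"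
proof -
  interpret A: kalg A by fact
  have "qbin p N s \<odot>\<^bsub>A\<^esub> (x [^]\<^bsub>A\<^esub> s \<otimes>\<^bsub>A\<^esub> y [^]\<^bsub>A\<^esub> (N - s)) = \<zero>\<^bsub>A\<^esub>" if "s \<le> N" for s
    using that assms qbin_N[OF assms(5), of s]
    by (cases "s = 0"; cases "s = N") auto
  then show ?thesis
    unfolding A.q_binomial[OF assms(2,3) yx] by (intro A.add.finprod_one_eqI) auto
qed

end

text \<open>The relations of \<open>K\<close>, \<open>E\<close>, \<open>Ft\<close> without
  nilpotency: for the operators, the nilpotency of \<open>g\<close> is itself derived from these
  relations.\<close>

locale tilde_rel = kalg A + odd_root q N
  for A :: "('k::field, 'a, 'm) module_scheme" (structure) and q :: 'k and N +
  fixes k e g :: 'a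
  assumes k_closed [simp, intro]: "k \<in> carrier A" and e_closed [simp, intro]: "e \<in> carrier A"
    and g_closed [simp, intro]: "g \<in> carrier A"
    and k_pow: "k [^] N = \<one>"
    and ke: "k \<otimes> e = q ^ 2 \<odot> (e \<otimes> k)"
    and kg: "k \<otimes> g = inverse (q ^ 2) \<odot> (g \<otimes> k)"
    and ge: "g \<otimes> e = q ^ 2 \<odot> (e \<otimes> g) \<oplus> \<one> \<oplus> (- 1) \<odot> (k \<otimes> k)"
begin

lemma gk: "g \<otimes> k = q ^ 2 \<odot> (k \<otimes> g)"
  by (simp add: kg)

lemma k_pow_diff: "k \<otimes> k [^] (N - 1) = \<one>" "k [^] (N - 1) \<otimes> k = \<one>"
  "k \<otimes> k [^] (N - Suc 0) = \<one>" "k [^] (N - Suc 0) \<otimes> k = \<one>"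
  using N1 k_pow nat_pow_Suc2[of k "N - 1"] nat_pow_Suc[of k "N - 1"] by simp_all

text \<open>Solves \<open>Ft = c0 K F\<close> for \<open>F\<close>, with \<open>K^(-1)\<close>
  written as \<open>K^(N - 1)\<close>.\<close>

definition "f = inverse c0 \<odot> (k [^] (N - 1) \<otimes> g)"

lemma f_closed [simp]: "f \<in> carrier A" by (simp add: f_def)

lemma g_eq: "g = c0 \<odot> (k \<otimes> f)"
  by (simp add: f_def m_assoc[symmetric] k_pow_diff)

lemma kf: "k \<otimes> f = inverse (q ^ 2) \<odot> (f \<otimes> k)"
proof -
  have "f \<otimes> k = inverse c0 \<odot> (k [^] (N - 1) \<otimes> (g \<otimes> k))" by (simp add: f_def m_assoc)
  also have "\<dots> = (inverse c0 * q ^ 2) \<odot> g" by (simp add: gk m_assoc[symmetric] k_pow_diff)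
  finally have fk: "f \<otimes> k = (inverse c0 * q ^ 2) \<odot> g" .
  have "k \<otimes> f = inverse c0 \<odot> g" by (simp add: f_def m_assoc[symmetric] k_pow_diff)
  moreover have "inverse (q ^ 2) * (inverse c0 * q ^ 2) = inverse c0" by (simp add: field_simps)
  ultimately show ?thesis by (simp only: fk smult_smult[OF g_closed])
qed

lemma q2_N1: "(q ^ 2) ^ (N - 1) * q ^ 2 = 1"
proof -
  have "(q ^ 2) ^ (N - 1) * q ^ 2 = (q ^ 2) ^ Suc (N - 1)" by simp
  also have "\<dots> = (q ^ 2) ^ N" using N1 by simp
  finally show ?thesis using q2_pow_iff[of N] by simp
qed

text \<open>Multiplying \<open>ge\<close> from the left by \<open>k^(-1)\<close> turns
  \<open>q^2 e g\<close> into \<open>e (k^(-1) g)\<close>, since moving \<open>k^(-1)\<close> past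
  \<open>e\<close> costs \<open>q^(-2)\<close>.\<close>

lemma ef: "e \<otimes> f = f \<otimes> e \<oplus> inverse c0 \<odot> (k \<oplus> (- 1) \<odot> k [^] (N - 1))"
proof -
  have 1: "k [^] (N - 1) \<otimes> e = (q ^ 2) ^ (N - 1) \<odot> (e \<otimes> k [^] (N - 1))"
    using q_comm_pow[OF k_closed e_closed ke, of "N - 1" 1] by simp
  have "k [^] (N - 1) \<otimes> (e \<otimes> g) = (q ^ 2) ^ (N - 1) \<odot> (e \<otimes> (k [^] (N - 1) \<otimes> g))"
    using 1 by (simp add: m_assoc[symmetric])
  moreover have "k [^] (N - 1) \<otimes> (k \<otimes> k) = k" by (simp add: m_assoc[symmetric] k_pow_diff)
  ultimately have "k [^] (N - 1) \<otimes> (g \<otimes> e) = e \<otimes> (k [^] (N - 1) \<otimes> g) \<oplus> k [^] (N - 1) \<oplus> (- 1) \<odot> k"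
    using q2_N1 by (simp add: ge r_distr mult.commute)
  then have fe: "f \<otimes> e = e \<otimes> f \<oplus> inverse c0 \<odot> k [^] (N - 1) \<oplus> (- inverse c0) \<odot> k"
    by (simp add: f_def m_assoc smult_add_r)
  let ?u = "inverse c0 \<odot> k [^] (N - 1)" and ?v = "inverse c0 \<odot> k"
  have "f \<otimes> e \<oplus> inverse c0 \<odot> (k \<oplus> (- 1) \<odot> k [^] (N - 1))
      = e \<otimes> f \<oplus> ((?u \<oplus> (- inverse c0) \<odot> k [^] (N - 1)) \<oplus> (?v \<oplus> (- inverse c0) \<odot> k))"
    by (simp add: fe smult_add_r a_ac)
  also have "\<dots> = e \<otimes> f" by (simp add: smult_add_l[symmetric])
  finally show ?thesis by simp
qed

text \<open>Each passage of \<open>g\<close> across an \<open>e\<close> leaves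
  \<open>1 - k^2\<close> behind. Summing these contributions gives the \<open>q\<close>-integer; the
  extra factor \<open>(q ^ 2) ^ a\<close> comes from moving \<open>k^2\<close> to the right.\<close>

lemma g_e_pow: "g \<otimes> e [^] Suc a = (q ^ 2) ^ Suc a \<odot> (e [^] Suc a \<otimes> g) \<oplus> qnum (q ^ 2) (Suc a) \<odot> e [^] a
    \<oplus> (- (qnum (q ^ 2) (Suc a) * (q ^ 2) ^ a)) \<odot> (e [^] a \<otimes> (k \<otimes> k))"
proof (induction a)
  case 0
  then show ?case using ge by (simp add: qnum_def)
next
  case (Suc a)
  let ?p = "q ^ 2"
  have kke: "k \<otimes> k \<otimes> e = (?p * ?p) \<odot> (e \<otimes> (k \<otimes> k))"
  proof -
    have "k \<otimes> k \<otimes> e = k \<otimes> (k \<otimes> e)" by (simp add: m_assoc)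
    also have "\<dots> = ?p \<odot> ((k \<otimes> e) \<otimes> k)" by (simp add: ke m_assoc[symmetric])
    also have "\<dots> = (?p * ?p) \<odot> ((e \<otimes> k) \<otimes> k)" by (simp only: ke) simp
    finally show ?thesis by (simp add: m_assoc)
  qed
  have "g \<otimes> e [^] Suc (Suc a) = (g \<otimes> e [^] Suc a) \<otimes> e" by (simp add: m_assoc)
  also have "\<dots> = ?p ^ Suc a \<odot> (e [^] Suc a \<otimes> (g \<otimes> e)) \<oplus> qnum ?p (Suc a) \<odot> e [^] Suc a
      \<oplus> (- (qnum ?p (Suc a) * ?p ^ a)) \<odot> (e [^] a \<otimes> (k \<otimes> k \<otimes> e))"
    unfolding Suc by (simp add: l_distr m_assoc)
  also have "\<dots> = ?p ^ Suc (Suc a) \<odot> (e [^] Suc (Suc a) \<otimes> g)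
      \<oplus> (?p ^ Suc a \<odot> e [^] Suc a \<oplus> qnum ?p (Suc a) \<odot> e [^] Suc a)
      \<oplus> ((- (?p ^ Suc a)) \<odot> (e [^] Suc a \<otimes> (k \<otimes> k))
      \<oplus> (- (qnum ?p (Suc a) * ?p ^ a * ?p * ?p)) \<odot> (e [^] Suc a \<otimes> (k \<otimes> k)))"
    unfolding ge kke by (simp add: r_distr smult_add_r m_assoc a_ac ac_simps)
  also have "\<dots> = ?p ^ Suc (Suc a) \<odot> (e [^] Suc (Suc a) \<otimes> g)
      \<oplus> qnum ?p (Suc (Suc a)) \<odot> e [^] Suc a
      \<oplus> (- (qnum ?p (Suc (Suc a)) * ?p ^ Suc a)) \<odot> (e [^] Suc a \<otimes> (k \<otimes> k))"
  proof -
    have 1: "- (?p ^ Suc a) + - (qnum ?p (Suc a) * ?p ^ a * ?p * ?p) = - (qnum ?p (Suc (Suc a)) * ?p ^ Suc a)"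
      unfolding qnum_Suc[of ?p "Suc a"] by (simp add: algebra_simps)
    have 2: "?p ^ Suc a + qnum ?p (Suc a) = qnum ?p (Suc (Suc a))"
      unfolding qnum_Suc'[of ?p "Suc a"] by simp
    show ?thesis
      by (subst (1 2) smult_add_l[symmetric]) (simp_all only: 1 2 nat_pow_closed m_closed e_closed k_closed)
  qed
  finally show ?case .
qed

text \<open>The mirror image of \<open>g_e_pow\<close>. Here \<open>k^2\<close> has to pass powers
  of \<open>g\<close>, which puts the inverse of \<open>q ^ 2\<close> into the second
  \<open>q\<close>-integer.\<close>

lemma g_pow_e: "g [^] Suc n \<otimes> e = (q ^ 2) ^ Suc n \<odot> (e \<otimes> g [^] Suc n) \<oplus> qnum (q ^ 2) (Suc n) \<odot> g [^] n
    \<oplus> (- qnum (inverse (q ^ 2)) (Suc n)) \<odot> (g [^] n \<otimes> (k \<otimes> k))"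
proof (induction n)
  case 0
  then show ?case using ge by (simp add: qnum_def)
next
  case (Suc n)
  let ?p = "q ^ 2" and ?r = "inverse (q ^ 2)"
  have kkg: "k \<otimes> k \<otimes> g = (?r * ?r) \<odot> (g \<otimes> (k \<otimes> k))"
  proof -
    have "k \<otimes> k \<otimes> g = k \<otimes> (k \<otimes> g)" by (simp add: m_assoc)
    also have "\<dots> = ?r \<odot> ((k \<otimes> g) \<otimes> k)" by (simp add: kg m_assoc[symmetric])
    also have "\<dots> = (?r * ?r) \<odot> ((g \<otimes> k) \<otimes> k)" by (simp only: kg) simp
    finally show ?thesis by (simp add: m_assoc)
  qed
  have "g [^] Suc (Suc n) \<otimes> e = g [^] Suc n \<otimes> (g \<otimes> e)" by (simp add: m_assoc)
  also have "\<dots> = ?p \<odot> ((g [^] Suc n \<otimes> e) \<otimes> g) \<oplus> g [^] Suc n \<oplus> (- 1) \<odot> (g [^] Suc n \<otimes> (k \<otimes> k))"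
    unfolding ge by (simp add: r_distr m_assoc)
  also have "\<dots> = ?p ^ Suc (Suc n) \<odot> (e \<otimes> g [^] Suc (Suc n)) \<oplus> ((?p * qnum ?p (Suc n)) \<odot> g [^] Suc n \<oplus> 1 \<odot> g [^] Suc n)
      \<oplus> ((- (?p * (?r * ?r) * qnum ?r (Suc n))) \<odot> (g [^] Suc n \<otimes> (k \<otimes> k)) \<oplus> (- 1) \<odot> (g [^] Suc n \<otimes> (k \<otimes> k)))"
  proof -
    have "(g [^] Suc n \<otimes> e) \<otimes> g = ?p ^ Suc n \<odot> (e \<otimes> g [^] Suc (Suc n)) \<oplus> qnum ?p (Suc n) \<odot> g [^] Suc n
      \<oplus> (- qnum ?r (Suc n)) \<odot> (g [^] n \<otimes> (k \<otimes> k \<otimes> g))"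
      unfolding Suc by (simp add: l_distr m_assoc)
    then show ?thesis unfolding kkg by (simp add: smult_add_r m_assoc a_ac mult.assoc mult.left_commute mult.commute)
  qed
  also have "\<dots> = ?p ^ Suc (Suc n) \<odot> (e \<otimes> g [^] Suc (Suc n)) \<oplus> qnum ?p (Suc (Suc n)) \<odot> g [^] Suc n
      \<oplus> (- qnum ?r (Suc (Suc n))) \<odot> (g [^] Suc n \<otimes> (k \<otimes> k))"
  proof -
    have pr: "?p * (?r * ?r) = ?r" by simp
    have 1: "- (?p * (?r * ?r) * qnum ?r (Suc n)) + - 1 = - qnum ?r (Suc (Suc n))"
      unfolding pr qnum_Suc[of ?r "Suc n"] by simp
    have 2: "?p * qnum ?p (Suc n) + 1 = qnum ?p (Suc (Suc n))"
      unfolding qnum_Suc[of ?p "Suc n"] by simp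
    show ?thesis
      by (subst (1 2) smult_add_l[symmetric]) (simp_all only: 1 2 nat_pow_closed m_closed g_closed k_closed)
  qed
  finally show ?case .
qed

text \<open>Both \<open>q\<close>-integers vanish at \<open>N\<close>. This commutation later
  carries \<open>g^N = 0\<close> from one row of the operator representation to the next.\<close>

lemma g_pow_N_e: "g [^] N \<otimes> e = e \<otimes> g [^] N"
proof -
  obtain n where n: "N = Suc n" using N1 by (cases N) auto
  have "qnum (q ^ 2) N = 0" "qnum (inverse (q ^ 2)) N = 0" "(q ^ 2) ^ N = 1"
    using qnum_eq_0_iff[OF good_q2, of N] qnum_eq_0_iff[OF good_q2_inv, of N] q2_pow_iff[of N] by auto
  then show ?thesis using g_pow_e[of n] unfolding n[symmetric] by simp
qed

section \<open>PBW monomials and straightening formulas\<close>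

definition "pbw a b i = e [^] (a::nat) \<otimes> g [^] (b::nat) \<otimes> k [^] (i::nat)"

lemma pbw_closed [simp]: "pbw a b i \<in> carrier A" by (simp add: pbw_def)

lemma pbw_k: "pbw a b i \<otimes> k [^] j = pbw a b (i + j)"
  by (simp add: pbw_def m_assoc nat_pow_mult)

lemma k_pbw: "k \<otimes> pbw a b i = ((q ^ 2) ^ a * inverse (q ^ 2) ^ b) \<odot> pbw a b (Suc i)"
proof -
  have 1: "k \<otimes> e [^] a = (q ^ 2) ^ a \<odot> (e [^] a \<otimes> k)" using q_comm_pow[OF k_closed e_closed ke, of 1 a] by simp
  have 2: "k \<otimes> g [^] b = inverse (q ^ 2) ^ b \<odot> (g [^] b \<otimes> k)" using q_comm_pow[OF k_closed g_closed kg, of 1 b] by simp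
  have "k \<otimes> pbw a b i = (k \<otimes> e [^] a) \<otimes> (g [^] b \<otimes> k [^] i)" by (simp add: pbw_def m_assoc)
  also have "\<dots> = (q ^ 2) ^ a \<odot> (e [^] a \<otimes> (k \<otimes> g [^] b) \<otimes> k [^] i)" by (simp add: 1 m_assoc)
  also have "\<dots> = ((q ^ 2) ^ a * inverse (q ^ 2) ^ b) \<odot> (e [^] a \<otimes> g [^] b \<otimes> (k \<otimes> k [^] i))" by (simp add: 2 m_assoc)
  also have "k \<otimes> k [^] i = k [^] Suc i" using nat_pow_Suc2 by simp
  finally show ?thesis by (simp add: pbw_def m_assoc)
qed

lemma e_pbw: "e \<otimes> pbw a b i = pbw (Suc a) b i"
  using nat_pow_Suc2[of e a] by (simp add: pbw_def m_assoc[symmetric])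

lemma kk_pbw0: "k \<otimes> k \<otimes> (g [^] (b::nat) \<otimes> k [^] (i::nat)) = (inverse (q ^ 2) ^ b * inverse (q ^ 2) ^ b) \<odot> (g [^] b \<otimes> k [^] Suc (Suc i))"
proof -
  have 1: "k \<otimes> (g [^] b \<otimes> k [^] i) = inverse (q ^ 2) ^ b \<odot> (g [^] b \<otimes> k [^] Suc i)" for i :: nat
    using k_pbw[of 0 b i] by (simp add: pbw_def)
  have "k \<otimes> k \<otimes> (g [^] b \<otimes> k [^] i) = k \<otimes> (k \<otimes> (g [^] b \<otimes> k [^] i))" by (rule m_assoc) auto
  also have "\<dots> = inverse (q ^ 2) ^ b \<odot> (k \<otimes> (g [^] b \<otimes> k [^] Suc i))" by (subst 1[of i]) simp
  finally show ?thesis by (subst (asm) 1[of "Suc i"]) simp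
qed

lemma g_pbw_0: "g \<otimes> pbw 0 b i = pbw 0 (Suc b) i"
  using nat_pow_Suc2[of g b] by (simp add: pbw_def m_assoc[symmetric])

lemma g_pbw_Suc: "g \<otimes> pbw (Suc a) b i = (q ^ 2) ^ Suc a \<odot> pbw (Suc a) (Suc b) i \<oplus> qnum (q ^ 2) (Suc a) \<odot> pbw a b i
    \<oplus> (- (qnum (q ^ 2) (Suc a) * (q ^ 2) ^ a * (inverse (q ^ 2) ^ b * inverse (q ^ 2) ^ b))) \<odot> pbw a b (Suc (Suc i))"
proof -
  have "g \<otimes> pbw (Suc a) b i = (g \<otimes> e [^] Suc a) \<otimes> (g [^] b \<otimes> k [^] i)" by (simp add: pbw_def m_assoc)
  also have "\<dots> = (q ^ 2) ^ Suc a \<odot> (e [^] Suc a \<otimes> (g \<otimes> g [^] b \<otimes> k [^] i)) \<oplus> qnum (q ^ 2) (Suc a) \<odot> (e [^] a \<otimes> (g [^] b \<otimes> k [^] i))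
    \<oplus> (- (qnum (q ^ 2) (Suc a) * (q ^ 2) ^ a)) \<odot> (e [^] a \<otimes> (k \<otimes> k \<otimes> (g [^] b \<otimes> k [^] i)))"
    unfolding g_e_pow by (simp add: l_distr m_assoc del: nat_pow_Suc)
  also have "g \<otimes> g [^] b = g [^] Suc b" using nat_pow_Suc2 by simp
  finally show ?thesis unfolding kk_pbw0 by (simp add: pbw_def m_assoc ac_simps del: nat_pow_Suc)
qed

text \<open>The straightening formulas express a generator times a monomial through monomials again;
  \<open>g\<close> needs a case split because for \<open>a = 0\<close> there is no \<open>e\<close>
  to cross.\<close>

lemma pbw_span: "subalgebra_generated A {k, e, g} \<subseteq> lspan (range (\<lambda>(a, b, i). pbw a b i))" (is "_ \<subseteq> lspan ?X")
proof (rule subalgebra_generated_lspan)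
  have b: "pbw a b i \<in> lspan ?X" for a b i by (rule lspan.base) (rule range_eqI[of _ _ "(a, b, i)"], simp)
  show "\<one> \<in> ?X" by (auto simp: pbw_def image_iff intro!: exI[of _ 0])
  fix u x assume "u \<in> {k, e, g}" "x \<in> ?X"
  then obtain a b i where x: "x = pbw a b i" and u: "u = k \<or> u = e \<or> u = g" by auto
  have "g \<otimes> pbw a b i \<in> lspan ?X"
    by (cases a) (auto simp: g_pbw_0 g_pbw_Suc intro!: lspan.add lspan.smult b simp del: nat_pow_Suc)
  then show "u \<otimes> x \<in> lspan ?X" unfolding x using u by (auto simp: k_pbw e_pbw intro!: lspan.smult b)
qed auto

end

section \<open>The universal property\<close>

fun word_val :: "('a, 'm) monoid_scheme \<Rightarrow> ('g \<Rightarrow> 'a) \<Rightarrow> 'g list \<Rightarrow> 'a" where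
  "word_val A \<phi> [] = \<one>\<^bsub>A\<^esub>"
| "word_val A \<phi> (x # w) = \<phi> x \<otimes>\<^bsub>A\<^esub> word_val A \<phi> w"

lemma monoid_lists: "Group.monoid \<lparr>carrier = UNIV, monoid.mult = (@), one = []\<rparr>"
  by (rule monoidI) auto

lemma kalg_free_algebra: "kalg (free_algebra :: ('k::field, 'g list \<Rightarrow>\<^sub>0 'k) module)"
  unfolding free_algebra_def by (rule kalg_monoid_algebra[OF monoid_lists])

lemma carrier_free_algebra [simp]: "carrier free_algebra = UNIV"
  by (simp add: free_algebra_def)

context kalg
begin

lemma word_val_closed: "range \<phi> \<subseteq> carrier A \<Longrightarrow> word_val A \<phi> w \<in> carrier A"
  by (induction w) auto

lemma word_val_append:
  "range \<phi> \<subseteq> carrier A \<Longrightarrow> word_val A \<phi> (v @ w) = word_val A \<phi> v \<otimes> word_val A \<phi> w"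
  by (induction v) (auto simp: word_val_closed m_assoc range_subsetD)

lemma free_algebra_lift:
  assumes "range \<phi> \<subseteq> carrier A"
  obtains h where "h \<in> algebra_hom free_algebra A" "\<And>x. h (free_gen x) = \<phi> x"
proof
  show "lin A (word_val A \<phi>) \<in> algebra_hom free_algebra A"
    unfolding free_algebra_def
    by (rule algebra_hom_lin[OF monoid_lists]) (use assms in \<open>auto simp: word_val_closed word_val_append\<close>)
  show "lin A (word_val A \<phi>) (free_gen x) = \<phi> x" for x
    using word_val_closed[OF assms, of "[x]"] assms by (simp add: free_gen_def range_subsetD)
qed

end

context odd_root
begin

definition Urel :: "('k, 'b, 'm) module_scheme \<Rightarrow> 'b \<Rightarrow> 'b \<Rightarrow> 'b \<Rightarrow> bool" where
  "Urel A k e f \<longleftrightarrow> k [^]\<^bsub>A\<^esub> N = \<one>\<^bsub>A\<^esub> \<and> k \<otimes>\<^bsub>A\<^esub> e = q ^ 2 \<odot>\<^bsub>A\<^esub> (e \<otimes>\<^bsub>A\<^esub> k) \<and>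
     k \<otimes>\<^bsub>A\<^esub> f = inverse (q ^ 2) \<odot>\<^bsub>A\<^esub> (f \<otimes>\<^bsub>A\<^esub> k) \<and> e [^]\<^bsub>A\<^esub> N = \<zero>\<^bsub>A\<^esub> \<and> f [^]\<^bsub>A\<^esub> N = \<zero>\<^bsub>A\<^esub> \<and>
     e \<otimes>\<^bsub>A\<^esub> f \<ominus>\<^bsub>A\<^esub> f \<otimes>\<^bsub>A\<^esub> e = inverse c0 \<odot>\<^bsub>A\<^esub> (k \<ominus>\<^bsub>A\<^esub> k [^]\<^bsub>A\<^esub> (N - 1))"

abbreviation "FA \<equiv> free_algebra :: ('k, gen list \<Rightarrow>\<^sub>0 'k) module"

sublocale FA: kalg FA by (rule kalg_free_algebra)

sublocale UI: kalg_ideal FA "Ubar_ideal q N"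
  by (intro kalg_ideal.intro FA.kalg_axioms) (simp add: Ubar_ideal_def FA.genideal_ideal)

abbreviation "U \<equiv> Ubar q N"
abbreviation "K \<equiv> Ubar_K q N"
abbreviation "E \<equiv> Ubar_E q N"
abbreviation "F \<equiv> Ubar_F q N"
abbreviation "Ft \<equiv> Ubar_Ftilde q N"

lemma U_eq: "U = quotient_algebra FA (Ubar_ideal q N)" by (simp add: Ubar_def)

sublocale U: kalg U unfolding U_eq by (rule UI.kalg_Q)

text \<open>Translates relators into equations once for two uses: the quotient map gives the
  relations in \<open>U\<close>, and an arbitrary target gives the universal property.\<close>

lemma hom_kills_relators_iff:
  assumes "kalg B" and h: "h \<in> algebra_hom FA B"
  shows "(\<forall>r\<in>Ubar_relators q N. h r = \<zero>\<^bsub>B\<^esub>) \<longleftrightarrow> Urel B (h (free_gen GK)) (h (free_gen GE)) (h (free_gen GF))"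
proof -
  interpret B: kalg B by fact
  note hs = algebra_homD[OF h] algebra_hom_pow[OF FA.kalg_axioms assms] algebra_hom_zero_minus[OF FA.kalg_axioms assms]
  have [simp]: "h x \<in> carrier B" for x using hs(1) by simp
  show ?thesis
    unfolding Ubar_relators_def Let_def Urel_def
    by (simp add: hs B.r_right_minus_eq c0_def conj_ac)
qed

lemma U_proj_hom: "(+>\<^bsub>FA\<^esub>) (Ubar_ideal q N) \<in> algebra_hom FA U"
  unfolding U_eq by (rule UI.proj_hom)

lemma U_gen_closed [simp]: "Ubar_gen q N x \<in> carrier U"
  unfolding Ubar_gen_def using algebra_homD(1)[OF U_proj_hom] by simp

lemma Urel_U: "Urel U K E F"
proof -
  have "Ubar_ideal q N +>\<^bsub>FA\<^esub> r = \<zero>\<^bsub>U\<^esub>" if "r \<in> Ubar_relators q N" for r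
  proof -
    have "r \<in> Ubar_ideal q N" using that FA.genideal_self[of "Ubar_relators q N"] by (auto simp: Ubar_ideal_def)
    then show ?thesis using UI.coset_zero by (simp add: U_eq UI.Q_fields)
  qed
  then show ?thesis using hom_kills_relators_iff[OF U.kalg_axioms U_proj_hom] by (simp add: Ubar_gen_def)
qed

lemma U_hom_exists:
  assumes "kalg B" "k \<in> carrier B" "e \<in> carrier B" "f \<in> carrier B" "Urel B k e f"
  shows "\<exists>h\<in>algebra_hom U B. h K = k \<and> h E = e \<and> h F = f"
proof -
  interpret B: kalg B by fact
  define \<phi> where "\<phi> x = (case x of GK \<Rightarrow> k | GE \<Rightarrow> e | GF \<Rightarrow> f)" for x
  have "range \<phi> \<subseteq> carrier B" using assms by (auto simp: \<phi>_def split: gen.split)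
  then obtain h where h: "h \<in> algebra_hom FA B" "\<And>x. h (free_gen x) = \<phi> x"
    using B.free_algebra_lift by metis
  have "h r = \<zero>\<^bsub>B\<^esub>" if "r \<in> Ubar_relators q N" for r
    using hom_kills_relators_iff[OF assms(1) h(1)] assms(5) that by (simp add: h(2) \<phi>_def)
  then have "h (u \<otimes>\<^bsub>FA\<^esub> r \<otimes>\<^bsub>FA\<^esub> v) = \<zero>\<^bsub>B\<^esub>" if "r \<in> Ubar_relators q N" for r u v
    using that algebra_homD[OF h(1)] by simp
  then have kill: "h x = \<zero>\<^bsub>B\<^esub>" if "x \<in> Ubar_ideal q N" for x
    using lin_map_genideal_zero[OF FA.kalg_axioms assms(1) algebra_hom_lin_map[OF h(1)], of "Ubar_relators q N"] that
    unfolding Ubar_ideal_def by auto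
  show ?thesis
  proof (rule bexI)
    show "descend h \<in> algebra_hom U B"
      unfolding U_eq by (rule UI.algebra_hom_descend[OF assms(1) h(1) kill])
    have "descend h (Ubar_gen q N x) = \<phi> x" for x
      unfolding Ubar_gen_def
      using UI.descend_coset[OF assms(1) algebra_hom_lin_map[OF h(1)] kill, of "free_gen x"] h(2) by simp
    then show "descend h K = k \<and> descend h E = e \<and> descend h F = f" by (simp add: \<phi>_def)
  qed
qed

lemma U_generated:
  assumes "unital_subalgebra U S" "K \<in> S" "E \<in> S" "F \<in> S"
  shows "S = carrier U"
proof -
  note D = unital_subalgebraD[OF U.kalg_axioms assms(1)]
  note hs = algebra_homD[OF U_proj_hom]
  let ?\<pi> = "(+>\<^bsub>FA\<^esub>) (Ubar_ideal q N)"
  have w: "?\<pi> (Poly_Mapping.single w 1) \<in> S" for w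
  proof (induction w)
    case Nil
    have "?\<pi> \<one>\<^bsub>FA\<^esub> \<in> S" using D hs by simp
    then show ?case by (simp add: free_algebra_def)
  next
    case (Cons x w)
    have "Poly_Mapping.single (x # w) 1 = free_gen x \<otimes>\<^bsub>FA\<^esub> Poly_Mapping.single w 1"
      by (simp add: free_gen_def free_algebra_def)
    moreover have "?\<pi> (free_gen x) \<in> S" using assms(2-4) by (cases x) (simp_all add: Ubar_gen_def)
    ultimately show ?case using Cons D hs by simp
  qed
  have "?\<pi> y \<in> S" for y
  proof -
    have "Poly_Mapping.keys y \<subseteq> UNIV" by simp
    then show ?thesis
    proof (induction y rule: poly_mapping_span_induct)
      case zero
      have "?\<pi> 0 = \<zero>\<^bsub>U\<^esub>" using algebra_hom_zero_minus(1)[OF FA.kalg_axioms U.kalg_axioms U_proj_hom]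
        by (simp add: free_algebra_def)
      then show ?case using D by simp
    next
      case (single w c)
      have "Poly_Mapping.single w c = c \<odot>\<^bsub>FA\<^esub> Poly_Mapping.single w 1" by (simp add: free_algebra_def)
      then show ?case using w hs D by simp
    next
      case (add x y)
      have "x + y = x \<oplus>\<^bsub>FA\<^esub> y" by (simp add: free_algebra_def)
      then show ?case using add hs D by simp
    qed
  qed
  then show ?thesis using D(1) by (auto simp: U_eq UI.Q_fields)
qed

lemma Ft_eq: "Ft = c0 \<odot>\<^bsub>U\<^esub> (K \<otimes>\<^bsub>U\<^esub> F)" by (simp add: Ubar_Ftilde_def c0_def)

sublocale tl: tilde_rel U q N K E Ft
proof -
  have r: "K [^]\<^bsub>U\<^esub> N = \<one>\<^bsub>U\<^esub>" "K \<otimes>\<^bsub>U\<^esub> E = q ^ 2 \<odot>\<^bsub>U\<^esub> (E \<otimes>\<^bsub>U\<^esub> K)"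
    "K \<otimes>\<^bsub>U\<^esub> F = inverse (q ^ 2) \<odot>\<^bsub>U\<^esub> (F \<otimes>\<^bsub>U\<^esub> K)"
    "E \<otimes>\<^bsub>U\<^esub> F \<ominus>\<^bsub>U\<^esub> F \<otimes>\<^bsub>U\<^esub> E = inverse c0 \<odot>\<^bsub>U\<^esub> (K \<ominus>\<^bsub>U\<^esub> K [^]\<^bsub>U\<^esub> (N - 1))"
    using Urel_U by (auto simp: Urel_def)
  have FtC: "Ft \<in> carrier U" by (simp add: Ft_eq)
  have kN: "K \<otimes>\<^bsub>U\<^esub> K [^]\<^bsub>U\<^esub> (N - 1) = \<one>\<^bsub>U\<^esub>"
    using N1 r(1) U.nat_pow_Suc2[of K "N - 1"] by simp
  show "tilde_rel U q N K E Ft"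
  proof (intro tilde_rel.intro tilde_rel_axioms.intro U.kalg_axioms odd_root_axioms)
    have "K \<otimes>\<^bsub>U\<^esub> Ft = c0 \<odot>\<^bsub>U\<^esub> (K \<otimes>\<^bsub>U\<^esub> (K \<otimes>\<^bsub>U\<^esub> F))" by (simp add: Ft_eq)
    also have "\<dots> = inverse (q ^ 2) \<odot>\<^bsub>U\<^esub> (Ft \<otimes>\<^bsub>U\<^esub> K)"
      by (subst r(3)) (simp add: Ft_eq U.m_assoc mult.commute)
    finally show "K \<otimes>\<^bsub>U\<^esub> Ft = inverse (q ^ 2) \<odot>\<^bsub>U\<^esub> (Ft \<otimes>\<^bsub>U\<^esub> K)" .
    have ef: "E \<otimes>\<^bsub>U\<^esub> F = F \<otimes>\<^bsub>U\<^esub> E \<oplus>\<^bsub>U\<^esub> inverse c0 \<odot>\<^bsub>U\<^esub> (K \<ominus>\<^bsub>U\<^esub> K [^]\<^bsub>U\<^esub> (N - 1))"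
      unfolding r(4)[symmetric] by (simp add: a_minus_def U.a_ac U.r_neg2 U.r_neg)
    \<comment> \<open>The factor \<open>q^2\<close> is spent on turning \<open>E K\<close> into
      \<open>K E\<close>, which brings \<open>E\<close> next to \<open>F\<close> so that the
      defining commutator applies.\<close>
    have "q ^ 2 \<odot>\<^bsub>U\<^esub> (E \<otimes>\<^bsub>U\<^esub> Ft) = c0 \<odot>\<^bsub>U\<^esub> ((q ^ 2 \<odot>\<^bsub>U\<^esub> (E \<otimes>\<^bsub>U\<^esub> K)) \<otimes>\<^bsub>U\<^esub> F)"
      by (simp add: Ft_eq U.m_assoc mult.commute)
    also have "\<dots> = c0 \<odot>\<^bsub>U\<^esub> (K \<otimes>\<^bsub>U\<^esub> (E \<otimes>\<^bsub>U\<^esub> F))" unfolding r(2)[symmetric] by (simp add: U.m_assoc)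
    also have "\<dots> = Ft \<otimes>\<^bsub>U\<^esub> E \<oplus>\<^bsub>U\<^esub> (K \<otimes>\<^bsub>U\<^esub> (K \<oplus>\<^bsub>U\<^esub> (- 1) \<odot>\<^bsub>U\<^esub> K [^]\<^bsub>U\<^esub> (N - 1)))"
      unfolding ef by (simp add: Ft_eq U.r_distr U.smult_add_r U.m_assoc U.diff_eq_smult)
    also have "\<dots> = Ft \<otimes>\<^bsub>U\<^esub> E \<oplus>\<^bsub>U\<^esub> (K \<otimes>\<^bsub>U\<^esub> K \<oplus>\<^bsub>U\<^esub> (- 1) \<odot>\<^bsub>U\<^esub> \<one>\<^bsub>U\<^esub>)"
      using kN by (simp add: U.r_distr)
    finally have "q ^ 2 \<odot>\<^bsub>U\<^esub> (E \<otimes>\<^bsub>U\<^esub> Ft) \<oplus>\<^bsub>U\<^esub> \<one>\<^bsub>U\<^esub> \<oplus>\<^bsub>U\<^esub> (- 1) \<odot>\<^bsub>U\<^esub> (K \<otimes>\<^bsub>U\<^esub> K) =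
       Ft \<otimes>\<^bsub>U\<^esub> E \<oplus>\<^bsub>U\<^esub> ((K \<otimes>\<^bsub>U\<^esub> K \<oplus>\<^bsub>U\<^esub> (- 1) \<odot>\<^bsub>U\<^esub> (K \<otimes>\<^bsub>U\<^esub> K)) \<oplus>\<^bsub>U\<^esub> (\<one>\<^bsub>U\<^esub> \<oplus>\<^bsub>U\<^esub> (- 1) \<odot>\<^bsub>U\<^esub> \<one>\<^bsub>U\<^esub>))"
      using FtC by (simp add: U.a_ac)
    also have "\<dots> = Ft \<otimes>\<^bsub>U\<^esub> E"
      using FtC by (simp add: U.minus_eq_smult[symmetric] U.r_neg)
    finally show "Ft \<otimes>\<^bsub>U\<^esub> E = q ^ 2 \<odot>\<^bsub>U\<^esub> (E \<otimes>\<^bsub>U\<^esub> Ft) \<oplus>\<^bsub>U\<^esub> \<one>\<^bsub>U\<^esub> \<oplus>\<^bsub>U\<^esub> (- 1) \<odot>\<^bsub>U\<^esub> (K \<otimes>\<^bsub>U\<^esub> K)" by simp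
  qed (use r FtC in auto)
qed

lemma F_eq: "F = tl.f"
proof -
  have "tl.f = inverse c0 \<odot>\<^bsub>U\<^esub> (K [^]\<^bsub>U\<^esub> (N - 1) \<otimes>\<^bsub>U\<^esub> (c0 \<odot>\<^bsub>U\<^esub> (K \<otimes>\<^bsub>U\<^esub> F)))"
    unfolding tl.f_def by (simp only: Ft_eq)
  then show ?thesis by (simp add: U.m_assoc[symmetric] tl.k_pow_diff)
qed

lemma U_generated':
  assumes "unital_subalgebra U S" "K \<in> S" "E \<in> S" "Ft \<in> S"
  shows "S = carrier U"
proof -
  note D = unital_subalgebraD[OF U.kalg_axioms assms(1)]
  have "F \<in> S" unfolding F_eq tl.f_def using assms D by auto
  then show ?thesis using U_generated assms by auto
qed

lemma E_pow_N: "E [^]\<^bsub>U\<^esub> N = \<zero>\<^bsub>U\<^esub>" using Urel_U by (simp add: Urel_def)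

text \<open>\<open>K\<close> and \<open>F\<close> commute up to a scalar, so \<open>(K F)^N\<close>
  is a multiple of \<open>K^N F^N\<close>.\<close>

lemma Ft_pow_N: "Ft [^]\<^bsub>U\<^esub> N = \<zero>\<^bsub>U\<^esub>"
proof -
  have 0: "F [^]\<^bsub>U\<^esub> N = \<zero>\<^bsub>U\<^esub>" using Urel_U by (simp add: Urel_def)
  have fk: "F \<otimes>\<^bsub>U\<^esub> K = q ^ 2 \<odot>\<^bsub>U\<^esub> (K \<otimes>\<^bsub>U\<^esub> F)" using Urel_U by (simp add: Urel_def)
  obtain c where "(K \<otimes>\<^bsub>U\<^esub> F) [^]\<^bsub>U\<^esub> N = c \<odot>\<^bsub>U\<^esub> (K [^]\<^bsub>U\<^esub> N \<otimes>\<^bsub>U\<^esub> F [^]\<^bsub>U\<^esub> N)"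
    using U.q_comm_prod_pow[OF _ _ fk, of N] by auto
  then show ?thesis by (simp add: Ft_eq U.smult_pow 0)
qed

text \<open>Lets the universal property be used with \<open>Ft\<close> in the role of
  \<open>F\<close>. Nilpotency passes from \<open>g\<close> to \<open>f\<close> because
  \<open>k [^] (N - 1)\<close> and \<open>g\<close> commute up to a scalar.\<close>

lemma Urel_tilde:
  assumes "tilde_rel B q N k e g" "e [^]\<^bsub>B\<^esub> N = \<zero>\<^bsub>B\<^esub>" "g [^]\<^bsub>B\<^esub> N = \<zero>\<^bsub>B\<^esub>"
  shows "Urel B k e (tilde_rel.f B q N k g)"
proof -
  interpret B: tilde_rel B q N k e g by fact
  have gk: "g \<otimes>\<^bsub>B\<^esub> k [^]\<^bsub>B\<^esub> (N - 1) = (q ^ 2) ^ (N - 1) \<odot>\<^bsub>B\<^esub> (k [^]\<^bsub>B\<^esub> (N - 1) \<otimes>\<^bsub>B\<^esub> g)"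
    using B.q_comm_pow[OF B.g_closed B.k_closed B.gk, of 1 "N - 1"] by simp
  obtain c where "(k [^]\<^bsub>B\<^esub> (N - 1) \<otimes>\<^bsub>B\<^esub> g) [^]\<^bsub>B\<^esub> N = c \<odot>\<^bsub>B\<^esub> ((k [^]\<^bsub>B\<^esub> (N - 1)) [^]\<^bsub>B\<^esub> N \<otimes>\<^bsub>B\<^esub> g [^]\<^bsub>B\<^esub> N)"
    using B.q_comm_prod_pow[OF _ _ gk, of N] by auto
  then have "B.f [^]\<^bsub>B\<^esub> N = \<zero>\<^bsub>B\<^esub>" using assms(3) by (simp add: B.f_def B.smult_pow)
  moreover have "e \<otimes>\<^bsub>B\<^esub> B.f \<ominus>\<^bsub>B\<^esub> B.f \<otimes>\<^bsub>B\<^esub> e = inverse c0 \<odot>\<^bsub>B\<^esub> (k \<ominus>\<^bsub>B\<^esub> k [^]\<^bsub>B\<^esub> (N - 1))"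
  proof -
    have "x \<oplus>\<^bsub>B\<^esub> y \<ominus>\<^bsub>B\<^esub> x = y" if "x \<in> carrier B" "y \<in> carrier B" for x y
      using that by (simp add: a_minus_def B.a_assoc B.a_comm[of x y] B.r_neg)
    then show ?thesis unfolding B.ef by (simp add: B.diff_eq_smult[of "k [^]\<^bsub>B\<^esub> (N - Suc 0)"])
  qed
  ultimately show ?thesis
    unfolding Urel_def using B.k_pow B.ke B.kf assms by simp
qed

lemma tilde_hom_exists:
  assumes "tilde_rel B q N k e g" "e [^]\<^bsub>B\<^esub> N = \<zero>\<^bsub>B\<^esub>" "g [^]\<^bsub>B\<^esub> N = \<zero>\<^bsub>B\<^esub>"
  shows "\<exists>h\<in>algebra_hom U B. h K = k \<and> h E = e \<and> h Ft = g \<and> h F = tilde_rel.f B q N k g"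
proof -
  interpret B: tilde_rel B q N k e g by fact
  obtain h where h: "h \<in> algebra_hom U B" "h K = k" "h E = e" "h F = B.f"
    using U_hom_exists[OF B.kalg_axioms B.k_closed B.e_closed B.f_closed Urel_tilde[OF assms]] by auto
  moreover have "h Ft = g" using algebra_homD[OF h(1)] h by (simp add: Ft_eq B.g_eq[symmetric])
  ultimately show ?thesis by auto
qed

lemma pbw_zero: "N \<le> a \<or> N \<le> b \<Longrightarrow> tl.pbw a b i = \<zero>\<^bsub>U\<^esub>"
proof -
  have "E [^]\<^bsub>U\<^esub> a = \<zero>\<^bsub>U\<^esub>" if "N \<le> a" for a
    using that U.nat_pow_mult[of E N "a - N"] E_pow_N by simp
  moreover have "Ft [^]\<^bsub>U\<^esub> b = \<zero>\<^bsub>U\<^esub>" if "N \<le> b" for b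
    using that U.nat_pow_mult[of Ft N "b - N"] Ft_pow_N by simp
  ultimately show "N \<le> a \<or> N \<le> b \<Longrightarrow> tl.pbw a b i = \<zero>\<^bsub>U\<^esub>" by (auto simp: tl.pbw_def)
qed

text \<open>Monomials with \<open>a\<close> or \<open>b\<close> at least \<open>N\<close> are zero,
  and zero is a scalar multiple, so the remaining monomials suffice. The exponent of
  \<open>K\<close> stays unrestricted to avoid reductions modulo \<open>N\<close>.\<close>

lemma U_induct [consumes 1, case_names pbw add smult]:
  assumes z: "z \<in> carrier U" and pbw: "\<And>a b i. \<lbrakk>a < N; b < N\<rbrakk> \<Longrightarrow> P (tl.pbw a b i)"
    and add: "\<And>x y. \<lbrakk>x \<in> carrier U; y \<in> carrier U; P x; P y\<rbrakk> \<Longrightarrow> P (x \<oplus>\<^bsub>U\<^esub> y)"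
    and smult: "\<And>c x. \<lbrakk>x \<in> carrier U; P x\<rbrakk> \<Longrightarrow> P (c \<odot>\<^bsub>U\<^esub> x)"
  shows "P z"
proof -
  let ?X = "range (\<lambda>(a, b, i). tl.pbw a b i)"
  have "subalgebra_generated U {K, E, Ft} = carrier U"
    by (rule U_generated') (use unital_subalgebra_generated[OF U.kalg_axioms, of "{K, E, Ft}"]
      subalgebra_generated_incl[of "{K, E, Ft}" U] in auto)
  then have zX: "z \<in> U.lspan ?X" using z tl.pbw_span by blast
  have P0: "P \<zero>\<^bsub>U\<^esub>" using smult[of "tl.pbw 0 0 0" 0] pbw[of 0 0 0] N1 by simp
  have Xc: "?X \<subseteq> carrier U" by auto
  from zX show "P z"
  proof induction
    case (base x)
    then obtain a b i where "x = tl.pbw a b i" by auto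
    then show ?case using pbw[of a b i] pbw_zero[of a b i] P0 by (cases "a < N \<and> b < N") auto
  qed (use add smult U.lspan_closed[OF Xc] in blast)+
qed

end

section \<open>The regular representation\<close>

definition End_alg :: "('k::field, ('i \<Rightarrow> 'k) \<Rightarrow> ('i \<Rightarrow> 'k)) module" where
  "End_alg = \<lparr>carrier = {T. (\<forall>u v. T (\<lambda>i. u i + v i) = (\<lambda>i. T u i + T v i)) \<and> (\<forall>c u. T (\<lambda>i. c * u i) = (\<lambda>i. c * T u i))},
     monoid.mult = (\<lambda>S T. S \<circ> T), one = id, ring.zero = (\<lambda>u i. 0), ring.add = (\<lambda>S T u i. S u i + T u i),
     module.smult = (\<lambda>c T u i. c * T u i)\<rparr>"

lemma End_alg_simps [simp]:
  "S \<otimes>\<^bsub>End_alg\<^esub> T = S \<circ> T" "\<one>\<^bsub>End_alg\<^esub> = id" "\<zero>\<^bsub>End_alg\<^esub> = (\<lambda>u i. 0)"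
  "S \<oplus>\<^bsub>End_alg\<^esub> T = (\<lambda>u i. S u i + T u i)" "c \<odot>\<^bsub>End_alg\<^esub> T = (\<lambda>u i. c * T u i)"
  by (simp_all add: End_alg_def)

lemma End_carrier: "T \<in> carrier End_alg \<longleftrightarrow>
    (\<forall>u v. T (\<lambda>i. u i + v i) = (\<lambda>i. T u i + T v i)) \<and> (\<forall>c u. T (\<lambda>i. c * u i) = (\<lambda>i. c * T u i))"
  by (simp add: End_alg_def)

lemma kalg_End: "kalg (End_alg :: ('k::field, ('i \<Rightarrow> 'k) \<Rightarrow> ('i \<Rightarrow> 'k)) module)"
proof -
  let ?A = "End_alg :: ('k, ('i \<Rightarrow> 'k) \<Rightarrow> ('i \<Rightarrow> 'k)) module"
  have ab: "abelian_group ?A"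
  proof (rule abelian_groupI)
    fix T assume "T \<in> carrier ?A"
    then show "\<exists>S\<in>carrier ?A. S \<oplus>\<^bsub>?A\<^esub> T = \<zero>\<^bsub>?A\<^esub>"
      by (intro bexI[of _ "\<lambda>u i. - T u i"]) (auto simp: End_carrier)
  qed (auto simp: End_carrier algebra_simps)
  have mon: "Group.monoid ?A"
    by (rule monoidI) (auto simp: End_carrier)
  have "ring ?A"
    by (rule ringI[OF ab mon]) (auto simp: End_carrier fun_eq_iff)
  then show ?thesis
  proof (rule kalg.intro)
    show "kalg_axioms ?A"
      by standard (auto simp: End_carrier fun_eq_iff algebra_simps)
  qed
qed

context odd_root
begin

abbreviation "EA \<equiv> End_alg :: ('k, (nat \<times> nat \<times> nat \<Rightarrow> 'k) \<Rightarrow> (nat \<times> nat \<times> nat \<Rightarrow> 'k)) module"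

definition \<kappa> :: "nat \<Rightarrow> nat \<Rightarrow> nat \<Rightarrow> 'k" where
  "\<kappa> a b j = (q ^ 2) ^ a * inverse (q ^ 2) ^ b * q ^ j"

text \<open>The index \<open>j\<close> is dual to the exponent of \<open>K\<close>: the function of \<open>E ^ a Ft ^ b K ^ i\<close> is
  \<open>j \<mapsto> q ^ (i j)\<close> at \<open>(a, b)\<close>. Blocks of length \<open>N\<close> in \<open>a\<close> and \<open>b\<close> do not interact, so no bound on
  the indices is needed.\<close>

definition repK :: "(nat \<times> nat \<times> nat \<Rightarrow> 'k) \<Rightarrow> (nat \<times> nat \<times> nat \<Rightarrow> 'k)" where
  "repK w = (\<lambda>(a, b, j). \<kappa> a b j * w (a, b, j))"

definition repE :: "(nat \<times> nat \<times> nat \<Rightarrow> 'k) \<Rightarrow> (nat \<times> nat \<times> nat \<Rightarrow> 'k)" where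
  "repE w = (\<lambda>(a, b, j). if a mod N = 0 then 0 else w (a - 1, b, j))"

text \<open>The straightening formula \<open>g_pbw_Suc\<close> read on coefficients: one
  contribution from \<open>(a, b - 1)\<close> and two from \<open>(Suc a, b)\<close>, where
  multiplication by \<open>K^2\<close> has become the factor \<open>(q ^ j) ^ 2\<close>.\<close>

definition repG :: "(nat \<times> nat \<times> nat \<Rightarrow> 'k) \<Rightarrow> (nat \<times> nat \<times> nat \<Rightarrow> 'k)" where
  "repG w = (\<lambda>(a, b, j). (if b mod N = 0 then 0 else (q ^ 2) ^ a * w (a, b - 1, j))
     + qnum (q ^ 2) (Suc a) * (1 - (q ^ 2) ^ a * (inverse (q ^ 2) ^ b) ^ 2 * (q ^ j) ^ 2) * w (Suc a, b, j))"

lemma EA_pow_Suc: "T [^]\<^bsub>EA\<^esub> Suc n = (T [^]\<^bsub>EA\<^esub> n) \<circ> T"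
  by (simp add: nat_pow_def)

lemma EA_pow_Suc2: "T \<in> carrier EA \<Longrightarrow> T [^]\<^bsub>EA\<^esub> Suc n = T \<circ> (T [^]\<^bsub>EA\<^esub> n)"
  using monoid.nat_pow_Suc2[OF ring.is_monoid[OF kalg.axioms(1)[OF kalg_End]], of T n] by simp

lemma repK_closed: "repK \<in> carrier EA" and repE_closed: "repE \<in> carrier EA" and repG_closed: "repG \<in> carrier EA"
  by (auto simp: End_carrier repK_def repE_def repG_def fun_eq_iff algebra_simps)

lemma repK_pow: "(repK [^]\<^bsub>EA\<^esub> n) w (a, b, j) = \<kappa> a b j ^ n * w (a, b, j)"
proof (induction n arbitrary: w)
  case (Suc n)
  have "(repK [^]\<^bsub>EA\<^esub> Suc n) w (a, b, j) = \<kappa> a b j ^ n * repK w (a, b, j)"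
    unfolding EA_pow_Suc by (simp add: Suc)
  also have "\<dots> = \<kappa> a b j ^ Suc n * w (a, b, j)" by (simp add: repK_def)
  finally show ?case .
qed simp

lemma kappa_N: "\<kappa> a b j ^ N = 1"
proof -
  have "((q ^ 2) ^ a) ^ N = 1" "((inverse (q ^ 2)) ^ b) ^ N = 1" "(q ^ j) ^ N = 1"
    by (simp_all only: power_mult[symmetric] mult.commute[of _ N] q_pow_iff q2_pow_iff q2_inv_pow_iff) simp_all
  then show ?thesis unfolding \<kappa>_def power_mult_distrib by simp
qed

lemma kappa_Suc: "\<kappa> (Suc a) b j = q ^ 2 * \<kappa> a b j" "\<kappa> a (Suc b) j = inverse (q ^ 2) * \<kappa> a b j"
  by (simp_all add: \<kappa>_def)

lemma rep_tilde: "tilde_rel EA q N repK repE repG"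
proof (intro tilde_rel.intro tilde_rel_axioms.intro kalg_End odd_root_axioms repK_closed repE_closed repG_closed)
  show "repK [^]\<^bsub>EA\<^esub> N = \<one>\<^bsub>EA\<^esub>"
    by (auto simp: fun_eq_iff repK_pow kappa_N)
  show "repK \<otimes>\<^bsub>EA\<^esub> repE = q ^ 2 \<odot>\<^bsub>EA\<^esub> (repE \<otimes>\<^bsub>EA\<^esub> repK)"
  proof (simp add: fun_eq_iff, intro allI)
    fix w a b j
    show "repK (repE w) (a, b, j) = q ^ 2 * repE (repK w) (a, b, j)"
      by (cases a) (auto simp: repK_def repE_def kappa_Suc)
  qed
  show "repK \<otimes>\<^bsub>EA\<^esub> repG = inverse (q ^ 2) \<odot>\<^bsub>EA\<^esub> (repG \<otimes>\<^bsub>EA\<^esub> repK)"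
  proof -
    have "repK (repG w) (a, b, j) = inverse (q ^ 2) * repG (repK w) (a, b, j)" for w a b j
    proof -
      define Y where "Y = qnum (q ^ 2) (Suc a) * (1 - (q ^ 2) ^ a * (inverse (q ^ 2) ^ b) ^ 2 * (q ^ j) ^ 2)"
      have L: "repK (repG w) (a, b, j) = \<kappa> a b j * ((if b mod N = 0 then 0 else (q ^ 2) ^ a * w (a, b - 1, j)) + Y * w (Suc a, b, j))"
        by (simp add: repK_def repG_def Y_def)
      have R: "repG (repK w) (a, b, j) = (if b mod N = 0 then 0 else (q ^ 2) ^ a * (\<kappa> a (b - 1) j * w (a, b - 1, j)))
          + Y * (q ^ 2 * \<kappa> a b j * w (Suc a, b, j))"
        by (simp add: repK_def repG_def Y_def kappa_Suc(1))
      show ?thesis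
      proof (cases "b mod N = 0")
        case True
        then show ?thesis unfolding L R by simp
      next
        case False
        then obtain b' where "b = Suc b'" by (cases b) auto
        then have "\<kappa> a b j = inverse (q ^ 2) * \<kappa> a (b - 1) j" by (simp add: kappa_Suc(2))
        moreover have "q ^ 2 * inverse (q ^ 2) = 1" by simp
        ultimately show ?thesis using False unfolding L R by (simp add: distrib_left mult_ac)
      qed
    qed
    then show ?thesis by (simp add: fun_eq_iff)
  qed
  show "repG \<otimes>\<^bsub>EA\<^esub> repE = q ^ 2 \<odot>\<^bsub>EA\<^esub> (repE \<otimes>\<^bsub>EA\<^esub> repG) \<oplus>\<^bsub>EA\<^esub> \<one>\<^bsub>EA\<^esub> \<oplus>\<^bsub>EA\<^esub> (- 1) \<odot>\<^bsub>EA\<^esub> (repK \<otimes>\<^bsub>EA\<^esub> repK)"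
  proof (simp add: fun_eq_iff, intro allI)
    fix w a b j
    \<comment> \<open>With \<open>P = 1 + (q^2 - 1) A\<close> and \<open>[a + 1] = 1 + q^2 A\<close>
      the relation becomes a polynomial identity. The facts \<open>z\<close> and \<open>zA\<close>
      treat the block boundaries, where \<open>repE\<close> suppresses a term whose coefficient is
      zero anyway.\<close>
    define P where "P = (q ^ 2) ^ a"
    define R where "R = (inverse (q ^ 2) ^ b) ^ 2 * (q ^ j) ^ 2"
    define A where "A = qnum (q ^ 2) a"
    define t where "t = (if b mod N = 0 \<or> a mod N = 0 then 0 else P * w (a - 1, b - 1, j))"
    have PA: "P = 1 + (q ^ 2 - 1) * A" using qnum_geometric[of "q ^ 2" a] by (simp add: P_def A_def)
    have qS: "qnum (q ^ 2) (Suc a) = 1 + q ^ 2 * A" by (simp add: A_def qnum_Suc)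
    have z: "Suc a mod N = 0 \<Longrightarrow> 1 + q ^ 2 * A = 0" using qnum_eq_0_iff[OF good_q2, of "Suc a"] qS by auto
    have zA: "a mod N = 0 \<Longrightarrow> A = 0" using qnum_eq_0_iff[OF good_q2, of a] by (auto simp: A_def)
    have GE: "repG (repE w) (a, b, j) = t + (1 + q ^ 2 * A) * (1 - P * R) * w (a, b, j)"
      using z by (auto simp: repG_def repE_def t_def qS P_def R_def mult.assoc)
    have EG: "q ^ 2 * repE (repG w) (a, b, j) = t + A * (q ^ 2 - P * R) * w (a, b, j)"
    proof (cases "a mod N = 0")
      case True
      then show ?thesis using zA by (simp add: repE_def t_def)
    next
      case False
      then obtain a' where a: "a = Suc a'" by (cases a) auto
      have P: "P = q ^ 2 * (q ^ 2) ^ a'" by (simp add: P_def a)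
      show ?thesis using False
        by (simp add: repE_def repG_def t_def P R_def A_def a) (simp add: algebra_simps)
    qed
    have KK: "repK (repK w) (a, b, j) = P * P * R * w (a, b, j)"
      by (simp add: repK_def \<kappa>_def P_def R_def power2_eq_square)
    show "repG (repE w) (a, b, j) = q ^ 2 * repE (repG w) (a, b, j) + w (a, b, j) - repK (repK w) (a, b, j)"
      unfolding GE EG KK PA by (simp add: algebra_simps)
  qed
qed

lemma repE_pow: "n \<le> N \<Longrightarrow> (repE [^]\<^bsub>EA\<^esub> n) w (a, b, j) = (if a mod N < n then 0 else w (a - n, b, j))"
proof (induction n arbitrary: a)
  case (Suc n)
  have "(repE [^]\<^bsub>EA\<^esub> Suc n) w (a, b, j) = (if a mod N = 0 then 0 else (repE [^]\<^bsub>EA\<^esub> n) w (a - 1, b, j))"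
    unfolding EA_pow_Suc2[OF repE_closed] by (simp add: repE_def)
  also have "\<dots> = (if a mod N < Suc n then 0 else w (a - Suc n, b, j))"
  proof (cases "a mod N = 0")
    case False
    then obtain a' where a: "a = Suc a'" by (cases a) auto
    have "Suc a' mod N = Suc (a' mod N)" using False a by (auto simp: mod_Suc split: if_splits)
    then show ?thesis using Suc a by simp
  qed simp
  finally show ?case .
qed simp

lemma repE_N: "repE [^]\<^bsub>EA\<^esub> N = \<zero>\<^bsub>EA\<^esub>"
  using N1 by (auto simp: fun_eq_iff repE_pow)

lemma repG_pow_top:
  assumes "n \<le> N" "N dvd Suc a"
  shows "(repG [^]\<^bsub>EA\<^esub> n) w (a, b, j) = (if b mod N < n then 0 else ((q ^ 2) ^ a) ^ n * w (a, b - n, j))"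
  using assms(1)
proof (induction n arbitrary: b)
  case (Suc n)
  have "qnum (q ^ 2) (Suc a) = 0" using qnum_eq_0_iff[OF good_q2] assms(2) by simp
  then have "(repG [^]\<^bsub>EA\<^esub> Suc n) w (a, b, j) = (if b mod N = 0 then 0 else (q ^ 2) ^ a * (repG [^]\<^bsub>EA\<^esub> n) w (a, b - 1, j))"
    unfolding EA_pow_Suc2[OF repG_closed] by (simp add: repG_def)
  also have "\<dots> = (if b mod N < Suc n then 0 else ((q ^ 2) ^ a) ^ Suc n * w (a, b - Suc n, j))"
  proof (cases "b mod N = 0")
    case False
    then obtain b' where b: "b = Suc b'" by (cases b) auto
    have "Suc b' mod N = Suc (b' mod N)" using False b by (auto simp: mod_Suc split: if_splits)
    then show ?thesis using Suc b by simp
  qed simp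
  finally show ?case .
qed simp

text \<open>At the top of a block \<open>repG\<close> only lowers \<open>b\<close>; the other rows follow since \<open>repG ^ N\<close> commutes with
  \<open>repE\<close>.\<close>

lemma repG_N: "repG [^]\<^bsub>EA\<^esub> N = \<zero>\<^bsub>EA\<^esub>"
proof -
  interpret R: tilde_rel EA q N repK repE repG by (rule rep_tilde)
  have "(repG [^]\<^bsub>EA\<^esub> N) w (a, b, j) = 0" for w a b j
  proof (induction "N - Suc (a mod N)" arbitrary: a w)
    case 0
    then have "a mod N = N - 1" using N1 mod_less_divisor[of N a] by linarith
    then have "N dvd Suc a" using N1 by (simp add: dvd_eq_mod_eq_0 mod_Suc)
    then show ?case using N1 by (simp add: repG_pow_top)
  next
    case (Suc m)
    \<comment> \<open>Row \<open>Suc a\<close> of \<open>repE x\<close> is row \<open>a\<close> of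
      \<open>x\<close>, as \<open>Suc a\<close> is not a multiple of \<open>N\<close>.\<close>
    have "(repE \<otimes>\<^bsub>EA\<^esub> repG [^]\<^bsub>EA\<^esub> N) w (Suc a, b, j) = (repG [^]\<^bsub>EA\<^esub> N \<otimes>\<^bsub>EA\<^esub> repE) w (Suc a, b, j)"
      using R.g_pow_N_e by simp
    moreover have s: "Suc a mod N = Suc (a mod N)" using Suc.hyps(2) by (auto simp: mod_Suc)
    ultimately have "(repG [^]\<^bsub>EA\<^esub> N) w (a, b, j) = (repG [^]\<^bsub>EA\<^esub> N) (repE w) (Suc a, b, j)"
      by (simp add: repE_def)
    also have "\<dots> = 0" by (rule Suc.hyps(1)) (use Suc.hyps(2) s in simp)
    finally show ?case .
  qed
  then show ?thesis by (auto simp: fun_eq_iff)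
qed

end

section \<open>Coordinates in the PBW basis\<close>

locale odd_root0 = odd_root q N for q :: "'k::field_char_0" and N
begin

definition "rho = (SOME h. h \<in> algebra_hom U EA \<and> h K = repK \<and> h E = repE \<and> h Ft = repG)"

lemma rho: "rho \<in> algebra_hom U EA" "rho K = repK" "rho E = repE" "rho Ft = repG"
proof -
  have "\<exists>h. h \<in> algebra_hom U EA \<and> h K = repK \<and> h E = repE \<and> h Ft = repG"
    using tilde_hom_exists[OF rep_tilde repE_N repG_N] by blast
  then have "rho \<in> algebra_hom U EA \<and> rho K = repK \<and> rho E = repE \<and> rho Ft = repG"
    unfolding rho_def by (rule someI_ex)
  then show "rho \<in> algebra_hom U EA" "rho K = repK" "rho E = repE" "rho Ft = repG" by auto
qed

text \<open>The test vector represents the unit element, since \<open>K^0\<close> has constant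
  Fourier transform 1. Hence \<open>\<psi> z\<close> lists the coordinates of \<open>z\<close>, with
  the exponent of \<open>K\<close> in Fourier-dual form.\<close>

definition "\<psi> z = rho z (\<lambda>(a, b, j). if a = 0 \<and> b = 0 then 1 else 0)"

lemma psi_add: "\<lbrakk>x \<in> carrier U; y \<in> carrier U\<rbrakk> \<Longrightarrow> \<psi> (x \<oplus>\<^bsub>U\<^esub> y) p = \<psi> x p + \<psi> y p"
  and psi_smult: "x \<in> carrier U \<Longrightarrow> \<psi> (c \<odot>\<^bsub>U\<^esub> x) p = c * \<psi> x p"
  by (simp_all add: \<psi>_def algebra_homD[OF rho(1)])

lemma psi_mult: "z \<in> carrier U \<Longrightarrow> \<psi> (K \<otimes>\<^bsub>U\<^esub> z) = repK (\<psi> z)"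
  "z \<in> carrier U \<Longrightarrow> \<psi> (E \<otimes>\<^bsub>U\<^esub> z) = repE (\<psi> z)"
  "z \<in> carrier U \<Longrightarrow> \<psi> (Ft \<otimes>\<^bsub>U\<^esub> z) = repG (\<psi> z)"
  by (simp_all add: \<psi>_def algebra_homD[OF rho(1)] rho)

text \<open>The monomial is built from the right: powers of \<open>K\<close>, then \<open>Ft\<close>
  in row 0, where the coupling term of \<open>repG\<close> meets only zeros, then \<open>E\<close>.
  The bounds keep the shifts inside one block.\<close>

lemma psi_pbw:
  assumes "a < N" "b < N"
  shows "\<psi> (tl.pbw a b i) = (\<lambda>(a', b', j). if a' = a \<and> b' = b then q ^ (i * j) else 0)"
proof -
  have 0: "\<psi> (tl.pbw 0 0 i) = (\<lambda>(a', b', j). if a' = 0 \<and> b' = 0 then q ^ (i * j) else 0)"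
  proof -
    have "tl.pbw 0 0 i = K [^]\<^bsub>U\<^esub> i" by (simp add: tl.pbw_def)
    moreover have "rho (K [^]\<^bsub>U\<^esub> i) = repK [^]\<^bsub>EA\<^esub> i"
      using algebra_hom_pow[OF U.kalg_axioms kalg_End rho(1), of K i] rho(2) by simp
    moreover have "\<kappa> 0 0 j ^ i = q ^ (i * j)" for j by (simp add: \<kappa>_def power_mult[symmetric] mult.commute)
    ultimately show ?thesis by (auto simp: \<psi>_def fun_eq_iff repK_pow)
  qed
  have 1: "\<psi> (tl.pbw 0 b i) = (\<lambda>(a', b', j). if a' = 0 \<and> b' = b then q ^ (i * j) else 0)"
    using assms(2)
  proof (induction b)
    case (Suc b)
    then have "\<psi> (tl.pbw 0 (Suc b) i) = repG (\<lambda>(a', b', j). if a' = 0 \<and> b' = b then q ^ (i * j) else 0)"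
      by (simp add: tl.g_pbw_0[symmetric] psi_mult)
    also have "\<dots> = (\<lambda>(a', b', j). if a' = 0 \<and> b' = Suc b then q ^ (i * j) else 0)"
    proof (rule ext)
      fix p :: "nat \<times> nat \<times> nat"
      obtain a' b' j where p: "p = (a', b', j)" by (cases p)
      show "repG (\<lambda>(a', b', j). if a' = 0 \<and> b' = b then q ^ (i * j) else 0) p =
          (case p of (a', b', j) \<Rightarrow> if a' = 0 \<and> b' = Suc b then q ^ (i * j) else 0)"
        using Suc.prems unfolding p repG_def by (cases b') auto
    qed
    finally show ?case .
  qed (rule 0)
  show ?thesis using assms(1)
  proof (induction a)
    case (Suc a)
    then have "\<psi> (tl.pbw (Suc a) b i) = repE (\<lambda>(a', b', j). if a' = a \<and> b' = b then q ^ (i * j) else 0)"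
      by (simp add: tl.e_pbw[symmetric] psi_mult)
    also have "\<dots> = (\<lambda>(a', b', j). if a' = Suc a \<and> b' = b then q ^ (i * j) else 0)"
    proof (rule ext)
      fix p :: "nat \<times> nat \<times> nat"
      obtain a' b' j where p: "p = (a', b', j)" by (cases p)
      show "repE (\<lambda>(a', b', j). if a' = a \<and> b' = b then q ^ (i * j) else 0) p =
          (case p of (a', b', j) \<Rightarrow> if a' = Suc a \<and> b' = b then q ^ (i * j) else 0)"
        using Suc.prems unfolding p repE_def by (cases a') auto
    qed
    finally show ?case .
  qed (rule 1)
qed

lemma q_powi_iff: "q powi m = 1 \<longleftrightarrow> int N dvd m"
proof (cases "m \<ge> 0")
  case True
  then obtain n where "m = int n" using nonneg_int_cases by blast
  then show ?thesis by (simp add: q_pow_iff)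
next
  case False
  then obtain n where "m = - int n" by (metis int_cases2 of_nat_0_le_iff)
  then show ?thesis by (simp add: q_pow_iff power_int_minus)
qed

text \<open>Orthogonality of characters: the geometric sum over an \<open>N\<close>-th root of unity
  vanishes unless the root is 1.\<close>

lemma dft_sum: "(\<Sum>j<N. (q powi m) ^ j) = (if int N dvd m then of_nat N else 0)"
proof -
  have "(q powi m) ^ N = (q ^ N) powi m" by (simp only: power_int_power power_int_power' mult.commute)
  then have "(q powi m - 1) * (\<Sum>j<N. (q powi m) ^ j) = 0"
    using qnum_geometric[of "q powi m" N] by (simp add: qnum_def)
  then show ?thesis using q_powi_iff[of m] by (cases "q powi m = 1") auto
qed

text \<open>The Fourier inversion in the last index, so this is the coefficient of
  \<open>E^a Ft^b K^i\<close>. Taking \<open>i\<close> as an integer allows exponents to be shifted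
  downwards freely.\<close>

definition "\<chi> a b i z = inverse (of_nat N) * (\<Sum>j<N. q powi (- (i * int j)) * \<psi> z (a, b, j))"
  for a b :: nat and i :: int

lemma chi_add: "\<lbrakk>x \<in> carrier U; y \<in> carrier U\<rbrakk> \<Longrightarrow> \<chi> a b i (x \<oplus>\<^bsub>U\<^esub> y) = \<chi> a b i x + \<chi> a b i y"
  by (simp add: \<chi>_def psi_add sum.distrib algebra_simps)

lemma chi_smult: "x \<in> carrier U \<Longrightarrow> \<chi> a b i (c \<odot>\<^bsub>U\<^esub> x) = c * \<chi> a b i x"
  by (simp add: \<chi>_def psi_smult sum_distrib_left mult.left_commute)

lemma chi_functional: "functional U (\<chi> a b i)"
  by (simp add: functional_def chi_add chi_smult)

lemma chi_diff: "\<lbrakk>x \<in> carrier U; y \<in> carrier U\<rbrakk> \<Longrightarrow> \<chi> a b i (x \<ominus>\<^bsub>U\<^esub> y) = \<chi> a b i x - \<chi> a b i y"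
  by (simp add: U.diff_eq_smult chi_add chi_smult)

lemma chi_pbw:
  assumes "a' < N" "b' < N"
  shows "\<chi> a b i (tl.pbw a' b' i') = (if a = a' \<and> b = b' \<and> int N dvd (int i' - i) then 1 else 0)"
proof -
  have *: "q powi (- (i * int j)) * q ^ (i' * j) = (q powi (int i' - i)) ^ j" for j
  proof -
    have "(q powi (int i' - i)) ^ j = q powi ((int i' - i) * int j)" by (rule power_int_power')
    also have "(int i' - i) * int j = - (i * int j) + int (i' * j)" by (simp add: algebra_simps)
    also have "q powi \<dots> = q powi (- (i * int j)) * q powi (int (i' * j))" by (rule power_int_add) simp
    finally show ?thesis by (simp only: power_int_of_nat)
  qed
  have "N \<noteq> 0" using N1 by simp
  then show ?thesis
    using dft_sum[of "int i' - i"]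
    by (cases "a = a' \<and> b = b'") (auto simp: \<chi>_def psi_pbw[OF assms] *)
qed

lemma chi_periodic: "int N dvd (i - i') \<Longrightarrow> \<chi> a b i z = \<chi> a b i' z"
proof -
  assume d: "int N dvd (i - i')"
  have "q powi (- (i * int j)) = q powi (- (i' * int j))" for j
  proof -
    have "- (i' * int j) = - (i * int j) + (i - i') * int j" by (simp add: algebra_simps)
    then have "q powi (- (i' * int j)) = q powi (- (i * int j)) * q powi ((i - i') * int j)"
      by (metis power_int_add q_nz)
    moreover have "q powi ((i - i') * int j) = 1" using d q_powi_iff by auto
    ultimately show ?thesis by simp
  qed
  then show ?thesis by (simp only: \<chi>_def)
qed

lemma chi_E: "z \<in> carrier U \<Longrightarrow> \<chi> a b i (E \<otimes>\<^bsub>U\<^esub> z) = (if a mod N = 0 then 0 else \<chi> (a - 1) b i z)"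
  by (simp add: \<chi>_def psi_mult repE_def)

text \<open>A factor \<open>q^(j m)\<close> on the Fourier side is a shift of the exponent of
  \<open>K\<close> by \<open>m\<close>; this turns \<open>repK\<close> and \<open>repG\<close> into
  recursions for coordinates.\<close>

lemma q_powi_shift: "q powi (- (i * int j)) * (q ^ j) ^ m = q powi (- ((i - int m) * int j))"
proof -
  have "- ((i - int m) * int j) = - (i * int j) + int (j * m)" by (simp add: algebra_simps)
  also have "q powi \<dots> = q powi (- (i * int j)) * q powi (int (j * m))" by (rule power_int_add) simp
  finally show ?thesis by (simp only: power_int_of_nat power_mult)
qed

lemma chi_K: "z \<in> carrier U \<Longrightarrow> \<chi> a b i (K \<otimes>\<^bsub>U\<^esub> z) = (q ^ 2) ^ a * inverse (q ^ 2) ^ b * \<chi> a b (i - 1) z"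
proof -
  assume z: "z \<in> carrier U"
  have "q powi (- (i * int j)) * \<psi> (K \<otimes>\<^bsub>U\<^esub> z) (a, b, j)
      = ((q ^ 2) ^ a * inverse (q ^ 2) ^ b) * (q powi (- ((i - 1) * int j)) * \<psi> z (a, b, j))" for j
    using q_powi_shift[of i j 1] z by (simp add: psi_mult repK_def \<kappa>_def)
  then show ?thesis by (simp only: \<chi>_def sum_distrib_left mult_ac)
qed

lemma chi_Ft: "z \<in> carrier U \<Longrightarrow> \<chi> a b i (Ft \<otimes>\<^bsub>U\<^esub> z) = (if b mod N = 0 then 0 else (q ^ 2) ^ a * \<chi> a (b - 1) i z)
   + qnum (q ^ 2) (Suc a) * \<chi> (Suc a) b i z
   - qnum (q ^ 2) (Suc a) * (q ^ 2) ^ a * (inverse (q ^ 2) ^ b) ^ 2 * \<chi> (Suc a) b (i - 2) z"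
proof -
  assume z: "z \<in> carrier U"
  have "q powi (- (i * int j)) * \<psi> (Ft \<otimes>\<^bsub>U\<^esub> z) (a, b, j)
      = (if b mod N = 0 then 0 else (q ^ 2) ^ a * (q powi (- (i * int j)) * \<psi> z (a, b - 1, j)))
       + qnum (q ^ 2) (Suc a) * (q powi (- (i * int j)) * \<psi> z (Suc a, b, j))
       - qnum (q ^ 2) (Suc a) * (q ^ 2) ^ a * (inverse (q ^ 2) ^ b) ^ 2 *
         (q powi (- ((i - 2) * int j)) * \<psi> z (Suc a, b, j))" for j
    using q_powi_shift[of i j 2] z by (simp add: psi_mult repG_def algebra_simps)
  then show ?thesis
    by (simp add: \<chi>_def sum.distrib sum_subtractf sum_distrib_left mult_ac distrib_left right_diff_distrib)
qed

lemma chi_support: "z \<in> carrier U \<Longrightarrow> N \<le> a \<or> N \<le> b \<Longrightarrow> \<chi> a b i z = 0"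
  by (induction z rule: U_induct) (auto simp: chi_pbw chi_add chi_smult)

lemma chi_K_right: "z \<in> carrier U \<Longrightarrow> \<chi> a b i (z \<otimes>\<^bsub>U\<^esub> K [^]\<^bsub>U\<^esub> m) = \<chi> a b (i - int m) z"
  by (induction z rule: U_induct)
    (auto simp: chi_pbw chi_add chi_smult tl.pbw_k U.l_distr algebra_simps)

lemma K_pow_mod: "K [^]\<^bsub>U\<^esub> (i mod N) = K [^]\<^bsub>U\<^esub> i"
proof -
  have "K [^]\<^bsub>U\<^esub> i = K [^]\<^bsub>U\<^esub> (N * (i div N) + i mod N)" by simp
  also have "\<dots> = (K [^]\<^bsub>U\<^esub> N) [^]\<^bsub>U\<^esub> (i div N) \<otimes>\<^bsub>U\<^esub> K [^]\<^bsub>U\<^esub> (i mod N)"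
    by (simp only: U.nat_pow_mult[symmetric] U.nat_pow_pow[symmetric] U_gen_closed)
  finally show ?thesis by (simp add: tl.k_pow)
qed

lemma pbw_mod: "tl.pbw a b (i mod N) = tl.pbw a b i"
  by (simp add: tl.pbw_def K_pow_mod)

lemma U_expansion:
  assumes "z \<in> carrier U"
  shows "z = (\<Oplus>\<^bsub>U\<^esub>p\<in>{..<N} \<times> {..<N} \<times> {..<N}. case p of (a, b, i) \<Rightarrow> \<chi> a b (int i) z \<odot>\<^bsub>U\<^esub> tl.pbw a b i)"
  using assms
proof (induction z rule: U_induct)
  case (pbw a b i)
  let ?p = "(a, b, i mod N)" and ?I = "{..<N} \<times> {..<N} \<times> {..<N}"
  have p: "?p \<in> ?I" using pbw N1 by simp
  have "int N dvd int i - int j \<longleftrightarrow> j = i mod N" if "j < N" for j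
  proof -
    have "int N dvd int i - int j \<longleftrightarrow> int i mod int N = int j mod int N" by (simp add: mod_eq_dvd_iff)
    also have "\<dots> \<longleftrightarrow> i mod N = j mod N" by (simp only: of_nat_mod[symmetric] of_nat_eq_iff)
    finally show ?thesis using that by auto
  qed
  then have "(\<Oplus>\<^bsub>U\<^esub>p\<in>?I. case p of (a', b', i') \<Rightarrow> \<chi> a' b' (int i') (tl.pbw a b i) \<odot>\<^bsub>U\<^esub> tl.pbw a' b' i')
      = (\<Oplus>\<^bsub>U\<^esub>x\<in>?I. if ?p = x then (case x of (a', b', i') \<Rightarrow> tl.pbw a' b' i') else \<zero>\<^bsub>U\<^esub>)"
    by (intro U.finsum_cong') (simp_all add: chi_pbw[OF pbw] split_beta prod_eq_iff mem_Times_iff Pi_iff)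
  also have "\<dots> = tl.pbw a b (i mod N)"
    by (subst U.add.finprod_singleton[OF p]) (simp_all add: split_beta Pi_iff)
  finally show ?case by (simp add: pbw_mod)
next
  case (add x y)
  let ?I = "{..<N} \<times> {..<N} \<times> {..<N}"
  have "(\<Oplus>\<^bsub>U\<^esub>p\<in>?I. case p of (a, b, i) \<Rightarrow> \<chi> a b (int i) (x \<oplus>\<^bsub>U\<^esub> y) \<odot>\<^bsub>U\<^esub> tl.pbw a b i) =
    (\<Oplus>\<^bsub>U\<^esub>p\<in>?I. (case p of (a, b, i) \<Rightarrow> \<chi> a b (int i) x \<odot>\<^bsub>U\<^esub> tl.pbw a b i) \<oplus>\<^bsub>U\<^esub>
       (case p of (a, b, i) \<Rightarrow> \<chi> a b (int i) y \<odot>\<^bsub>U\<^esub> tl.pbw a b i))"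
    by (intro U.finsum_cong') (simp_all add: chi_add[OF add.hyps] U.smult_add_l split_beta Pi_iff)
  also have "\<dots> = x \<oplus>\<^bsub>U\<^esub> y"
    by (subst U.finsum_addf) (simp_all add: add.IH[symmetric] split_beta Pi_iff)
  finally show ?case by simp
next
  case (smult c x)
  let ?I = "{..<N} \<times> {..<N} \<times> {..<N}"
  have "(\<Oplus>\<^bsub>U\<^esub>p\<in>?I. case p of (a, b, i) \<Rightarrow> \<chi> a b (int i) (c \<odot>\<^bsub>U\<^esub> x) \<odot>\<^bsub>U\<^esub> tl.pbw a b i) =
    (\<Oplus>\<^bsub>U\<^esub>p\<in>?I. c \<odot>\<^bsub>U\<^esub> (case p of (a, b, i) \<Rightarrow> \<chi> a b (int i) x \<odot>\<^bsub>U\<^esub> tl.pbw a b i))"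
    by (intro U.finsum_cong') (simp_all add: chi_smult[OF smult.hyps] split_beta Pi_iff)
  also have "\<dots> = c \<odot>\<^bsub>U\<^esub> x"
    by (subst U.smult_finsum[symmetric]) (simp_all add: smult.IH[symmetric] split_beta Pi_iff)
  finally show ?case by simp
qed

text \<open>From here on many equations in \<open>U\<close> are proved by comparing
  coordinates.\<close>

lemma chi_eqI:
  assumes "x \<in> carrier U" "y \<in> carrier U" "\<And>a b i. \<chi> a b i x = \<chi> a b i y"
  shows "x = y"
  using U_expansion[OF assms(1)] U_expansion[OF assms(2)] assms(3) by simp

section \<open>The comultiplication\<close>

sublocale TU: kalg_pair U U by (intro kalg_pair.intro U.kalg_axioms)

abbreviation "TU \<equiv> tensor_algebra U U"
abbreviation "tens \<equiv> pure_tensor U U"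

text \<open>The intended coproducts of \<open>E\<close> and \<open>Ft\<close>. Their common shape is
  the reason for the factor \<open>K\<close> in \<open>Ft\<close>.\<close>

definition "dE = tens E K \<oplus>\<^bsub>TU\<^esub> tens \<one>\<^bsub>U\<^esub> E"
definition "dG = tens Ft K \<oplus>\<^bsub>TU\<^esub> tens \<one>\<^bsub>U\<^esub> Ft"

lemma dE_closed [simp]: "dE \<in> carrier TU" and dG_closed [simp]: "dG \<in> carrier TU"
  by (simp_all add: dE_def dG_def)

lemma dE_comm: "tens \<one>\<^bsub>U\<^esub> E \<otimes>\<^bsub>TU\<^esub> tens E K = inverse (q ^ 2) \<odot>\<^bsub>TU\<^esub> (tens E K \<otimes>\<^bsub>TU\<^esub> tens \<one>\<^bsub>U\<^esub> E)"
  by (simp add: TU.tens_mult tl.ke TU.tens_smult_r)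

lemma dG_comm: "tens \<one>\<^bsub>U\<^esub> Ft \<otimes>\<^bsub>TU\<^esub> tens Ft K = q ^ 2 \<odot>\<^bsub>TU\<^esub> (tens Ft K \<otimes>\<^bsub>TU\<^esub> tens \<one>\<^bsub>U\<^esub> Ft)"
  by (simp add: TU.tens_mult tl.gk TU.tens_smult_r)

lemma dE_pow_N: "dE [^]\<^bsub>TU\<^esub> N = \<zero>\<^bsub>TU\<^esub>"
  unfolding dE_def
  by (rule q_binomial_N[OF TU.T.kalg_axioms _ _ dE_comm good_q2_inv])
    (simp_all add: TU.tens_pow E_pow_N TU.tens_zero)

lemma dG_pow_N: "dG [^]\<^bsub>TU\<^esub> N = \<zero>\<^bsub>TU\<^esub>"
  unfolding dG_def
  by (rule q_binomial_N[OF TU.T.kalg_axioms _ _ dG_comm good_q2])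
    (simp_all add: TU.tens_pow Ft_pow_N TU.tens_zero)

lemma comult_tilde: "tilde_rel TU q N (tens K K) dE dG"
proof (intro tilde_rel.intro tilde_rel_axioms.intro TU.T.kalg_axioms odd_root_axioms dE_closed dG_closed)
  show "tens K K [^]\<^bsub>TU\<^esub> N = \<one>\<^bsub>TU\<^esub>" by (simp add: TU.tens_pow tl.k_pow TU.tens_one)
  show "tens K K \<otimes>\<^bsub>TU\<^esub> dE = q ^ 2 \<odot>\<^bsub>TU\<^esub> (dE \<otimes>\<^bsub>TU\<^esub> tens K K)"
    by (simp add: dE_def TU.T.r_distr TU.T.l_distr TU.tens_mult tl.ke TU.tens_smult_l TU.tens_smult_r TU.T.smult_add_r)
  show "tens K K \<otimes>\<^bsub>TU\<^esub> dG = inverse (q ^ 2) \<odot>\<^bsub>TU\<^esub> (dG \<otimes>\<^bsub>TU\<^esub> tens K K)"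
    by (simp add: dG_def TU.T.r_distr TU.T.l_distr TU.tens_mult tl.kg TU.tens_smult_l TU.tens_smult_r TU.T.smult_add_r)
  let ?GE = "tens (E \<otimes>\<^bsub>U\<^esub> Ft) (K \<otimes>\<^bsub>U\<^esub> K)" and ?O = "tens \<one>\<^bsub>U\<^esub> (E \<otimes>\<^bsub>U\<^esub> Ft)"
    and ?KK = "tens (K \<otimes>\<^bsub>U\<^esub> K) (K \<otimes>\<^bsub>U\<^esub> K)" and ?I = "tens \<one>\<^bsub>U\<^esub> (K \<otimes>\<^bsub>U\<^esub> K)"
    and ?a = "tens Ft (E \<otimes>\<^bsub>U\<^esub> K)" and ?b = "tens E (K \<otimes>\<^bsub>U\<^esub> Ft)"
  have L: "dG \<otimes>\<^bsub>TU\<^esub> dE = tens (Ft \<otimes>\<^bsub>U\<^esub> E) (K \<otimes>\<^bsub>U\<^esub> K) \<oplus>\<^bsub>TU\<^esub> tens Ft (K \<otimes>\<^bsub>U\<^esub> E)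
     \<oplus>\<^bsub>TU\<^esub> (tens E (Ft \<otimes>\<^bsub>U\<^esub> K) \<oplus>\<^bsub>TU\<^esub> tens \<one>\<^bsub>U\<^esub> (Ft \<otimes>\<^bsub>U\<^esub> E))"
    by (simp add: dE_def dG_def TU.T.r_distr TU.T.l_distr TU.tens_mult TU.T.a_ac)
  have R: "dE \<otimes>\<^bsub>TU\<^esub> dG = ?GE \<oplus>\<^bsub>TU\<^esub> ?b \<oplus>\<^bsub>TU\<^esub> (?a \<oplus>\<^bsub>TU\<^esub> ?O)"
    by (simp add: dE_def dG_def TU.T.r_distr TU.T.l_distr TU.tens_mult TU.T.a_ac)
  have 1: "tens (Ft \<otimes>\<^bsub>U\<^esub> E) (K \<otimes>\<^bsub>U\<^esub> K) = q ^ 2 \<odot>\<^bsub>TU\<^esub> ?GE \<oplus>\<^bsub>TU\<^esub> ?I \<oplus>\<^bsub>TU\<^esub> (- 1) \<odot>\<^bsub>TU\<^esub> ?KK"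
    unfolding tl.ge by (simp add: TU.tens_add_l TU.tens_smult_l)
  have 2: "tens \<one>\<^bsub>U\<^esub> (Ft \<otimes>\<^bsub>U\<^esub> E) = q ^ 2 \<odot>\<^bsub>TU\<^esub> ?O \<oplus>\<^bsub>TU\<^esub> \<one>\<^bsub>TU\<^esub> \<oplus>\<^bsub>TU\<^esub> (- 1) \<odot>\<^bsub>TU\<^esub> ?I"
    unfolding tl.ge by (simp add: TU.tens_add_r TU.tens_smult_r TU.tens_one)
  have 3: "tens Ft (K \<otimes>\<^bsub>U\<^esub> E) = q ^ 2 \<odot>\<^bsub>TU\<^esub> ?a" by (simp add: tl.ke TU.tens_smult_r)
  have 4: "tens E (Ft \<otimes>\<^bsub>U\<^esub> K) = q ^ 2 \<odot>\<^bsub>TU\<^esub> ?b" by (simp add: tl.gk TU.tens_smult_r)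
  \<comment> \<open>The commutators in the two tensor factors contribute
    \<open>1 \<otimes> K^2\<close> with opposite signs, so what remains is
    \<open>1 \<otimes> 1 - K^2 \<otimes> K^2\<close>.\<close>
  have "dG \<otimes>\<^bsub>TU\<^esub> dE = (q ^ 2 \<odot>\<^bsub>TU\<^esub> ?GE \<oplus>\<^bsub>TU\<^esub> q ^ 2 \<odot>\<^bsub>TU\<^esub> ?b \<oplus>\<^bsub>TU\<^esub> (q ^ 2 \<odot>\<^bsub>TU\<^esub> ?a \<oplus>\<^bsub>TU\<^esub> q ^ 2 \<odot>\<^bsub>TU\<^esub> ?O))
     \<oplus>\<^bsub>TU\<^esub> \<one>\<^bsub>TU\<^esub> \<oplus>\<^bsub>TU\<^esub> (- 1) \<odot>\<^bsub>TU\<^esub> ?KK \<oplus>\<^bsub>TU\<^esub> (?I \<oplus>\<^bsub>TU\<^esub> (- 1) \<odot>\<^bsub>TU\<^esub> ?I)"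
    unfolding L 1 2 3 4 by (simp add: TU.T.a_ac)
  also have "?I \<oplus>\<^bsub>TU\<^esub> (- 1) \<odot>\<^bsub>TU\<^esub> ?I = \<zero>\<^bsub>TU\<^esub>"
    by (simp add: TU.T.minus_eq_smult[symmetric] TU.T.r_neg)
  finally show "dG \<otimes>\<^bsub>TU\<^esub> dE = q ^ 2 \<odot>\<^bsub>TU\<^esub> (dE \<otimes>\<^bsub>TU\<^esub> dG) \<oplus>\<^bsub>TU\<^esub> \<one>\<^bsub>TU\<^esub> \<oplus>\<^bsub>TU\<^esub> (- 1) \<odot>\<^bsub>TU\<^esub> (tens K K \<otimes>\<^bsub>TU\<^esub> tens K K)"
    unfolding R by (simp add: TU.T.smult_add_r TU.tens_mult)
qed simp

lemma inv_K: "inv\<^bsub>U\<^esub> K = K [^]\<^bsub>U\<^esub> (N - 1)"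
  by (rule U.inv_char) (simp_all add: tl.k_pow_diff)

abbreviation "\<Delta> \<equiv> Ubar_comult q N"

text \<open>\<open>Ubar_comult\<close> is a definite description, so existence and uniqueness must
  precede every computation. Existence is the universal property in its \<open>Ft\<close> form; two
  candidates agree on a subalgebra that contains the generators.\<close>

lemma comult: "\<Delta> \<in> algebra_hom U TU" "\<Delta> K = tens K K" "\<Delta> E = dE" "\<Delta> Ft = dG"
proof -
  obtain h where h: "h \<in> algebra_hom U TU" "h K = tens K K" "h E = dE" "h Ft = dG"
      "h F = tilde_rel.f TU q N (tens K K) dG"
    using tilde_hom_exists[OF comult_tilde dE_pow_N dG_pow_N] by blast
  interpret TT: tilde_rel TU q N "tens K K" dE dG by (rule comult_tilde)
  have hF: "h F = tens F \<one>\<^bsub>U\<^esub> \<oplus>\<^bsub>TU\<^esub> tens (inv\<^bsub>U\<^esub> K) F"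
  proof -
    have Fe: "F = inverse c0 \<odot>\<^bsub>U\<^esub> (K [^]\<^bsub>U\<^esub> (N - 1) \<otimes>\<^bsub>U\<^esub> Ft)" unfolding F_eq tl.f_def ..
    \<comment> \<open>Multiplying \<open>Ft \<otimes> K + 1 \<otimes> Ft\<close> by
      \<open>K^(-1) \<otimes> K^(-1)\<close> and dividing by \<open>c0\<close> gives the prescribed
      value on \<open>F\<close>.\<close>
    have "h F = inverse c0 \<odot>\<^bsub>TU\<^esub> (tens (K [^]\<^bsub>U\<^esub> (N - 1)) (K [^]\<^bsub>U\<^esub> (N - 1)) \<otimes>\<^bsub>TU\<^esub> dG)"
      unfolding h(5) TT.f_def by (simp add: TU.tens_pow)
    also have "\<dots> = tens (inverse c0 \<odot>\<^bsub>U\<^esub> (K [^]\<^bsub>U\<^esub> (N - 1) \<otimes>\<^bsub>U\<^esub> Ft)) \<one>\<^bsub>U\<^esub>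
        \<oplus>\<^bsub>TU\<^esub> tens (K [^]\<^bsub>U\<^esub> (N - 1)) (inverse c0 \<odot>\<^bsub>U\<^esub> (K [^]\<^bsub>U\<^esub> (N - 1) \<otimes>\<^bsub>U\<^esub> Ft))"
      by (simp add: dG_def TU.T.r_distr TU.tens_mult tl.k_pow_diff TU.T.smult_add_r TU.tens_smult_l TU.tens_smult_r)
    finally show ?thesis unfolding Fe[symmetric] inv_K .
  qed
  let ?P = "\<lambda>\<Delta>. \<Delta> \<in> algebra_hom U TU \<and> \<Delta> \<in> extensional (carrier U) \<and> \<Delta> K = tens K K \<and>
      \<Delta> E = tens E K \<oplus>\<^bsub>TU\<^esub> tens \<one>\<^bsub>U\<^esub> E \<and> \<Delta> F = tens F \<one>\<^bsub>U\<^esub> \<oplus>\<^bsub>TU\<^esub> tens (inv\<^bsub>U\<^esub> K) F"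
  let ?h = "restrict h (carrier U)"
  have P: "?P ?h"
    using h hF algebra_homD[OF h(1)] by (auto simp: algebra_hom_def ring_hom_def dE_def)
  have "g = ?h" if g: "?P g" for g
  proof -
    let ?S = "{z \<in> carrier U. g z = ?h z}"
    have gh: "g \<in> algebra_hom U TU" "?h \<in> algebra_hom U TU" using g P by auto
    have "unital_subalgebra U ?S"
      by (rule unital_subalgebraI[OF U.kalg_axioms])
        (use algebra_homD[OF gh(1)] algebra_homD[OF gh(2)] in auto)
    moreover have "K \<in> ?S" "E \<in> ?S" "F \<in> ?S" using g P by auto
    ultimately have "?S = carrier U" by (rule U_generated)
    then have "g z = ?h z" if "z \<in> carrier U" for z using that by blast
    then show ?thesis using g P by (intro extensionalityI[of g "carrier U" ?h]) auto
  qed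
  then have "\<Delta> = ?h"
    unfolding Ubar_comult_def Let_def using P by (intro the_equality) blast+
  then show "\<Delta> \<in> algebra_hom U TU" "\<Delta> K = tens K K" "\<Delta> E = dE" "\<Delta> Ft = dG"
    using P h by auto
qed

end

section \<open>The subspace S tensor B and its contractions\<close>

context kalg_pair
begin

text \<open>Scalars and signs can be absorbed into the first factor, so additive generation already
  produces a subalgebra. The coideal condition then only has to be tested on generators.\<close>

lemma left_subtensor_closed:
  assumes S: "unital_subalgebra A S"
  defines "L \<equiv> left_subtensor A B S"
  shows "L \<subseteq> carrier T"
    and "\<lbrakk>s \<in> S; b \<in> carrier B\<rbrakk> \<Longrightarrow> tens s b \<in> L"
    and "\<lbrakk>x \<in> L; y \<in> L\<rbrakk> \<Longrightarrow> x \<oplus>\<^bsub>T\<^esub> y \<in> L"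
    and "\<lbrakk>x \<in> L; y \<in> L\<rbrakk> \<Longrightarrow> x \<otimes>\<^bsub>T\<^esub> y \<in> L"
    and "x \<in> L \<Longrightarrow> c \<odot>\<^bsub>T\<^esub> x \<in> L"
    and "\<one>\<^bsub>T\<^esub> \<in> L"
proof -
  note D = unital_subalgebraD[OF A.kalg_axioms S]
  have sc: "s \<in> carrier A" if "s \<in> S" for s using D(1) that by blast
  let ?P = "{tens s b |s b. s \<in> S \<and> b \<in> carrier B}"
  have L: "L = generate (add_monoid T) ?P" by (simp add: L_def left_subtensor_def)
  have P: "?P \<subseteq> carrier T" using sc by auto
  have inv: "m_inv (add_monoid T) x = \<ominus>\<^bsub>T\<^esub> x" for x by (simp add: a_inv_def)
  show Lc: "L \<subseteq> carrier T"
    unfolding L using T.add.generate_in_carrier[of ?P] P by auto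
  show p: "tens s b \<in> L" if "s \<in> S" "b \<in> carrier B" for s b
    unfolding L using that by (intro generate.incl) blast
  show add_L: "x \<oplus>\<^bsub>T\<^esub> y \<in> L" if "x \<in> L" "y \<in> L" for x y
    using that generate.eng[of x "add_monoid T" ?P y] unfolding L by simp
  have zero: "\<zero>\<^bsub>T\<^esub> \<in> L" using generate.one[of "add_monoid T" ?P] unfolding L by simp
  have induct [consumes 1, case_names zero tens add]: "Q x" if "x \<in> L" "Q \<zero>\<^bsub>T\<^esub>" "\<And>s b. \<lbrakk>s \<in> S; b \<in> carrier B\<rbrakk> \<Longrightarrow> Q (tens s b)"
      "\<And>x y. \<lbrakk>x \<in> L; y \<in> L; Q x; Q y\<rbrakk> \<Longrightarrow> Q (x \<oplus>\<^bsub>T\<^esub> y)" for Q x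
    using that(1) unfolding L
  proof (induction rule: generate.induct)
    case (inv h)
    then obtain s b where h: "h = tens s b" "s \<in> S" "b \<in> carrier B" by auto
    then have "\<ominus>\<^bsub>T\<^esub> h = tens ((- 1) \<odot>\<^bsub>A\<^esub> s) b" using sc by (simp add: T.minus_eq_smult tens_smult_l)
    then show ?case using that(3) h D(7) by (simp add: \<open>\<And>x. m_inv (add_monoid T) x = _\<close>)
  qed (use that L in auto)
  show smult: "c \<odot>\<^bsub>T\<^esub> x \<in> L" if "x \<in> L" for c x
    using that
  proof (induction x rule: induct)
    case (tens s b)
    then show ?case using p[of "c \<odot>\<^bsub>A\<^esub> s" b] D(7) sc by (simp add: tens_smult_l)
  next
    case (add x y)
    have "x \<in> carrier T" "y \<in> carrier T" using add Lc by auto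
    then show ?case using add add_L by (simp add: T.smult_add_r)
  qed (use zero in simp)
  show "x \<otimes>\<^bsub>T\<^esub> y \<in> L" if x: "x \<in> L" and y: "y \<in> L" for x y
    using x
  proof (induction x rule: induct)
    case (tens s b)
    show ?case using y
    proof (induction y rule: induct)
      case (tens s' b')
      then show ?case using \<open>s \<in> S\<close> \<open>b \<in> carrier B\<close> p D(5) sc by (simp add: tens_mult)
    next
      case (add x y)
      have "x \<in> carrier T" "y \<in> carrier T" using add Lc by auto
      then show ?case using add add_L \<open>s \<in> S\<close> \<open>b \<in> carrier B\<close> sc by (simp add: T.r_distr)
    qed (use zero \<open>s \<in> S\<close> \<open>b \<in> carrier B\<close> sc in simp)
  next
    case (add x' y')
    have "x' \<in> carrier T" "y' \<in> carrier T" "y \<in> carrier T" using add y Lc by auto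
    then show ?case using add add_L by (simp add: T.l_distr)
  qed (use zero y Lc in auto)
  show "\<one>\<^bsub>T\<^esub> \<in> L" using p[of "\<one>\<^bsub>A\<^esub>" "\<one>\<^bsub>B\<^esub>"] D(2) by (simp add: tens_one)
qed

text \<open>Contracting the second factor of \<open>s \<otimes> b\<close> leaves a multiple of
  \<open>s\<close>; this is how the coideal condition yields new elements of
  \<open>S\<close>.\<close>

lemma left_subtensor_slice:
  assumes S: "unital_subalgebra A S" and g: "lin_map T A g"
    and gt: "\<And>a b. \<lbrakk>a \<in> carrier A; b \<in> carrier B\<rbrakk> \<Longrightarrow> g (tens a b) = f b \<odot>\<^bsub>A\<^esub> a"
    and x: "x \<in> left_subtensor A B S"
  shows "g x \<in> S"
proof -
  note D = unital_subalgebraD[OF A.kalg_axioms S]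
  have sc: "s \<in> carrier A" if "s \<in> S" for s using D(1) that by blast
  let ?P = "{tens s b |s b. s \<in> S \<and> b \<in> carrier B}"
  have P: "?P \<subseteq> carrier T" using sc by auto
  have "x \<in> generate (add_monoid T) ?P" using x by (simp add: left_subtensor_def)
  then show ?thesis
  proof induction
    case one
    then show ?case using lin_map_zero[OF T.kalg_axioms A.kalg_axioms g] D(3) by simp
  next
    case (incl h)
    then show ?case using gt sc D(7) by auto
  next
    case (inv h)
    then obtain s b where h: "h = tens s b" "s \<in> S" "b \<in> carrier B" by auto
    have "g (\<ominus>\<^bsub>T\<^esub> h) = (- 1) \<odot>\<^bsub>A\<^esub> g h"
      using g h sc by (simp add: T.minus_eq_smult lin_map_def)
    moreover have "m_inv (add_monoid T) h = \<ominus>\<^bsub>T\<^esub> h" by (simp add: a_inv_def)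
    ultimately show ?case using h gt sc D(7) by simp
  next
    case (eng h1 h2)
    then have "h1 \<in> carrier T" "h2 \<in> carrier T" using T.add.generate_in_carrier[of ?P] P by auto
    then show ?case using eng g D(4) by (simp add: lin_map_def)
  qed
qed

end

text \<open>Serves the coproduct of a PBW monomial, which is a product of two
  \<open>q\<close>-binomial sums and a power of \<open>K \<otimes> K\<close>.\<close>

lemma functional_mult_finsum:
  assumes "kalg A" "functional A f" and x: "x \<in> I \<rightarrow> carrier A" and y: "y \<in> J \<rightarrow> carrier A" and w: "w \<in> carrier A"
  shows "f ((\<Oplus>\<^bsub>A\<^esub>i\<in>I. x i) \<otimes>\<^bsub>A\<^esub> ((\<Oplus>\<^bsub>A\<^esub>j\<in>J. y j) \<otimes>\<^bsub>A\<^esub> w)) = (\<Sum>i\<in>I. \<Sum>j\<in>J. f (x i \<otimes>\<^bsub>A\<^esub> (y j \<otimes>\<^bsub>A\<^esub> w)))"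
proof -
  interpret A: kalg A by fact
  have left: "functional A (\<lambda>z. f (z \<otimes>\<^bsub>A\<^esub> v))" if "v \<in> carrier A" for v
    using assms(2) that by (auto simp: functional_def A.l_distr)
  have mid: "functional A (\<lambda>z. f (v \<otimes>\<^bsub>A\<^esub> (z \<otimes>\<^bsub>A\<^esub> w)))" if "v \<in> carrier A" for v
    using assms(2) that w by (auto simp: functional_def A.l_distr A.r_distr)
  have Y: "(\<Oplus>\<^bsub>A\<^esub>j\<in>J. y j) \<in> carrier A" using y by (rule A.finsum_closed)
  have "f ((\<Oplus>\<^bsub>A\<^esub>i\<in>I. x i) \<otimes>\<^bsub>A\<^esub> ((\<Oplus>\<^bsub>A\<^esub>j\<in>J. y j) \<otimes>\<^bsub>A\<^esub> w)) = (\<Sum>i\<in>I. f (x i \<otimes>\<^bsub>A\<^esub> ((\<Oplus>\<^bsub>A\<^esub>j\<in>J. y j) \<otimes>\<^bsub>A\<^esub> w)))"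
    using functional_finsum[OF assms(1) left x, of "(\<Oplus>\<^bsub>A\<^esub>j\<in>J. y j) \<otimes>\<^bsub>A\<^esub> w"] Y w by simp
  also have "\<dots> = (\<Sum>i\<in>I. \<Sum>j\<in>J. f (x i \<otimes>\<^bsub>A\<^esub> (y j \<otimes>\<^bsub>A\<^esub> w)))"
    by (intro sum.cong refl functional_finsum[OF assms(1) mid y]) (use x in auto)
  finally show ?thesis .
qed

context odd_root0
begin

text \<open>The coefficient of \<open>pbw s t i \<otimes> pbw u v (i + s + t)\<close> in the coproduct of
  \<open>pbw (s + u) (t + v) i\<close>. Only the fact that it does not vanish matters.\<close>

definition "C s t u v = qbin (inverse (q ^ 2)) (s + u) s * qbin (q ^ 2) (t + v) t
   * (q ^ 2) ^ (s * u) * inverse (q ^ 2) ^ ((s + t) * v)"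

lemma C_nz: "s + u < N \<Longrightarrow> t + v < N \<Longrightarrow> C s t u v \<noteq> 0"
  by (simp add: C_def qbin_nz good_q2 good_q2_inv)

lemma C_00 [simp]: "C s t 0 0 = 1" by (simp add: C_def)

lemma dE_pow: "dE [^]\<^bsub>TU\<^esub> a = (\<Oplus>\<^bsub>TU\<^esub>s\<in>{..a}. qbin (inverse (q ^ 2)) a s \<odot>\<^bsub>TU\<^esub> tens (E [^]\<^bsub>U\<^esub> s) (K [^]\<^bsub>U\<^esub> s \<otimes>\<^bsub>U\<^esub> E [^]\<^bsub>U\<^esub> (a - s)))"
  unfolding dE_def by (subst TU.T.q_binomial[OF _ _ dE_comm]) (simp_all add: TU.tens_pow TU.tens_mult)

lemma dG_pow: "dG [^]\<^bsub>TU\<^esub> b = (\<Oplus>\<^bsub>TU\<^esub>t\<in>{..b}. qbin (q ^ 2) b t \<odot>\<^bsub>TU\<^esub> tens (Ft [^]\<^bsub>U\<^esub> t) (K [^]\<^bsub>U\<^esub> t \<otimes>\<^bsub>U\<^esub> Ft [^]\<^bsub>U\<^esub> (b - t)))"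
  unfolding dG_def by (subst TU.T.q_binomial[OF _ _ dG_comm]) (simp_all add: TU.tens_pow TU.tens_mult)

lemma comult_pbw: "\<Delta> (tl.pbw a b m) = dE [^]\<^bsub>TU\<^esub> a \<otimes>\<^bsub>TU\<^esub> (dG [^]\<^bsub>TU\<^esub> b \<otimes>\<^bsub>TU\<^esub> tens (K [^]\<^bsub>U\<^esub> m) (K [^]\<^bsub>U\<^esub> m))"
  by (simp add: tl.pbw_def algebra_homD[OF comult(1)] comult algebra_hom_pow[OF U.kalg_axioms TU.T.kalg_axioms comult(1)]
      TU.tens_pow TU.T.m_assoc)

lemma second_factor:
  "(K [^]\<^bsub>U\<^esub> s \<otimes>\<^bsub>U\<^esub> E [^]\<^bsub>U\<^esub> x) \<otimes>\<^bsub>U\<^esub> ((K [^]\<^bsub>U\<^esub> t \<otimes>\<^bsub>U\<^esub> Ft [^]\<^bsub>U\<^esub> y) \<otimes>\<^bsub>U\<^esub> K [^]\<^bsub>U\<^esub> m)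
    = ((q ^ 2) ^ (s * x) * inverse (q ^ 2) ^ ((s + t) * y)) \<odot>\<^bsub>U\<^esub> tl.pbw x y (s + t + m)"
  for s t x y m :: nat
proof -
  have 1: "K [^]\<^bsub>U\<^esub> s \<otimes>\<^bsub>U\<^esub> E [^]\<^bsub>U\<^esub> x = (q ^ 2) ^ (s * x) \<odot>\<^bsub>U\<^esub> (E [^]\<^bsub>U\<^esub> x \<otimes>\<^bsub>U\<^esub> K [^]\<^bsub>U\<^esub> s)"
    by (rule U.q_comm_pow[OF _ _ tl.ke]) auto
  have 2: "K [^]\<^bsub>U\<^esub> (s + t) \<otimes>\<^bsub>U\<^esub> Ft [^]\<^bsub>U\<^esub> y = inverse (q ^ 2) ^ ((s + t) * y) \<odot>\<^bsub>U\<^esub> (Ft [^]\<^bsub>U\<^esub> y \<otimes>\<^bsub>U\<^esub> K [^]\<^bsub>U\<^esub> (s + t))"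
    by (rule U.q_comm_pow[OF _ _ tl.kg]) auto
  have "(K [^]\<^bsub>U\<^esub> s \<otimes>\<^bsub>U\<^esub> E [^]\<^bsub>U\<^esub> x) \<otimes>\<^bsub>U\<^esub> ((K [^]\<^bsub>U\<^esub> t \<otimes>\<^bsub>U\<^esub> Ft [^]\<^bsub>U\<^esub> y) \<otimes>\<^bsub>U\<^esub> K [^]\<^bsub>U\<^esub> m)
    = (q ^ 2) ^ (s * x) \<odot>\<^bsub>U\<^esub> (E [^]\<^bsub>U\<^esub> x \<otimes>\<^bsub>U\<^esub> ((K [^]\<^bsub>U\<^esub> s \<otimes>\<^bsub>U\<^esub> K [^]\<^bsub>U\<^esub> t) \<otimes>\<^bsub>U\<^esub> Ft [^]\<^bsub>U\<^esub> y \<otimes>\<^bsub>U\<^esub> K [^]\<^bsub>U\<^esub> m))"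
    unfolding 1 by (simp add: U.m_assoc)
  also have "\<dots> = ((q ^ 2) ^ (s * x) * inverse (q ^ 2) ^ ((s + t) * y)) \<odot>\<^bsub>U\<^esub>
      (E [^]\<^bsub>U\<^esub> x \<otimes>\<^bsub>U\<^esub> (Ft [^]\<^bsub>U\<^esub> y \<otimes>\<^bsub>U\<^esub> (K [^]\<^bsub>U\<^esub> (s + t) \<otimes>\<^bsub>U\<^esub> K [^]\<^bsub>U\<^esub> m)))"
    by (simp only: U.nat_pow_mult U_gen_closed 2) (simp add: U.m_assoc U.nat_pow_mult)
  also have "K [^]\<^bsub>U\<^esub> (s + t) \<otimes>\<^bsub>U\<^esub> K [^]\<^bsub>U\<^esub> m = K [^]\<^bsub>U\<^esub> (s + t + m)"
    by (rule U.nat_pow_mult) simp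
  finally show ?thesis by (simp add: tl.pbw_def U.m_assoc)
qed

text \<open>\<open>G\<close> contracts with the coordinate \<open>\<chi> u v j\<close>. A term
  \<open>pbw s t i \<otimes> pbw u v (i + s + t)\<close> survives exactly when \<open>j\<close> and
  \<open>i + s + t\<close> agree modulo \<open>N\<close>, so one slice lowers the exponents by
  \<open>(u, v)\<close> and selects a weight at the same time.\<close>

lemma slice_comult:
  obtains G where "lin_map TU U G" "\<And>a b. \<lbrakk>a \<in> carrier U; b \<in> carrier U\<rbrakk> \<Longrightarrow> G (tens a b) = \<chi> u v j b \<odot>\<^bsub>U\<^esub> a"
    "\<And>z s t i. z \<in> carrier U \<Longrightarrow> \<chi> s t i (G (\<Delta> z)) =
       (if int N dvd (i + int s + int t - j) then C s t u v * \<chi> (s + u) (t + v) i z else 0)"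
proof -
  obtain G where G: "lin_map TU U G" "\<And>a b. \<lbrakk>a \<in> carrier U; b \<in> carrier U\<rbrakk> \<Longrightarrow> G (tens a b) = \<chi> u v j b \<odot>\<^bsub>U\<^esub> a"
    using TU.tensor_lift_functional[OF chi_functional] by metis
  have Gc: "G x \<in> carrier U" if "x \<in> carrier TU" for x using G(1) that by (auto simp: lin_map_def)
  have Gs: "G (c \<odot>\<^bsub>TU\<^esub> x) = c \<odot>\<^bsub>U\<^esub> G x" if "x \<in> carrier TU" for c x
    using G(1) that by (auto simp: lin_map_def)
  note \<Delta>D = algebra_homD[OF comult(1)]
  have "\<chi> s t i (G (\<Delta> z)) = (if int N dvd (i + int s + int t - j) then C s t u v * \<chi> (s + u) (t + v) i z else 0)"
    if "z \<in> carrier U" for z s t i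
    using that
  proof (induction z rule: U_induct)
    case (pbw a b m)
    have w: "functional TU (\<lambda>x. \<chi> s t i (G x))"
      using G(1) Gc by (auto simp: functional_def lin_map_def chi_add chi_smult)
    \<comment> \<open>Only \<open>s' = s\<close> and \<open>t' = t\<close> can contribute; the
      nested conditionals prepare the collapse of the double sum.\<close>
    have tm: "\<chi> s t i (G ((qbin (inverse (q ^ 2)) a s' \<odot>\<^bsub>TU\<^esub> tens (E [^]\<^bsub>U\<^esub> s') (K [^]\<^bsub>U\<^esub> s' \<otimes>\<^bsub>U\<^esub> E [^]\<^bsub>U\<^esub> (a - s'))) \<otimes>\<^bsub>TU\<^esub>
        ((qbin (q ^ 2) b t' \<odot>\<^bsub>TU\<^esub> tens (Ft [^]\<^bsub>U\<^esub> t') (K [^]\<^bsub>U\<^esub> t' \<otimes>\<^bsub>U\<^esub> Ft [^]\<^bsub>U\<^esub> (b - t'))) \<otimes>\<^bsub>TU\<^esub> tens (K [^]\<^bsub>U\<^esub> m) (K [^]\<^bsub>U\<^esub> m))))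
        = (if s' = s then if t' = t then
             (if int N dvd (i + int s + int t - j) \<and> s + u = a \<and> t + v = b \<and> int N dvd (int m - i) then C s t u v else 0) else 0 else 0)"
      if st: "s' \<le> a" "t' \<le> b" for s' t'
    proof -
      let ?c = "qbin (inverse (q ^ 2)) a s' * qbin (q ^ 2) b t'" and ?d = "(q ^ 2) ^ (s' * (a - s')) * inverse (q ^ 2) ^ ((s' + t') * (b - t'))"
      have e0: "(qbin (inverse (q ^ 2)) a s' \<odot>\<^bsub>TU\<^esub> tens (E [^]\<^bsub>U\<^esub> s') (K [^]\<^bsub>U\<^esub> s' \<otimes>\<^bsub>U\<^esub> E [^]\<^bsub>U\<^esub> (a - s'))) \<otimes>\<^bsub>TU\<^esub>
        ((qbin (q ^ 2) b t' \<odot>\<^bsub>TU\<^esub> tens (Ft [^]\<^bsub>U\<^esub> t') (K [^]\<^bsub>U\<^esub> t' \<otimes>\<^bsub>U\<^esub> Ft [^]\<^bsub>U\<^esub> (b - t'))) \<otimes>\<^bsub>TU\<^esub> tens (K [^]\<^bsub>U\<^esub> m) (K [^]\<^bsub>U\<^esub> m))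
        = ?c \<odot>\<^bsub>TU\<^esub> tens (tl.pbw s' t' m) (?d \<odot>\<^bsub>U\<^esub> tl.pbw (a - s') (b - t') (s' + t' + m))"
        unfolding second_factor[symmetric] by (simp add: TU.tens_mult tl.pbw_def U.m_assoc mult.commute)
      have "\<chi> s t i (G (?c \<odot>\<^bsub>TU\<^esub> tens (tl.pbw s' t' m) (?d \<odot>\<^bsub>U\<^esub> tl.pbw (a - s') (b - t') (s' + t' + m)))) = ?c * (?d * \<chi> u v j (tl.pbw (a - s') (b - t') (s' + t' + m))) * \<chi> s t i (tl.pbw s' t' m)"
        by (subst Gs) (simp_all add: G(2) chi_smult)
      also have "\<dots> = (if s' = s then if t' = t then
             (if int N dvd (i + int s + int t - j) \<and> s + u = a \<and> t + v = b \<and> int N dvd (int m - i) then C s t u v else 0) else 0 else 0)"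
      proof -
        \<comment> \<open>As \<open>m\<close> and \<open>i\<close> agree modulo \<open>N\<close>,
          the condition on \<open>j\<close> can be expressed by \<open>i\<close>, as the final
          formula demands.\<close>
        have "int N dvd (int (s + t + m) - j) \<longleftrightarrow> int N dvd (i + int s + int t - j)" if "int N dvd (int m - i)"
        proof -
          have "int (s + t + m) - j = (i + int s + int t - j) + (int m - i)" by simp
          then show ?thesis using that by (simp only: dvd_add_left_iff)
        qed
        moreover have "\<chi> u v j (tl.pbw (a - s') (b - t') (s' + t' + m)) =
            (if u = a - s' \<and> v = b - t' \<and> int N dvd (int (s' + t' + m) - j) then 1 else 0)"
          by (rule chi_pbw) (use pbw in auto)
        moreover have "\<chi> s t i (tl.pbw s' t' m) = (if s = s' \<and> t = t' \<and> int N dvd (int m - i) then 1 else 0)"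
          by (rule chi_pbw) (use pbw st in auto)
        moreover have "u = a - s' \<longleftrightarrow> s' + u = a" "v = b - t' \<longleftrightarrow> t' + v = b" using st by auto
        moreover have "?c * ?d = C s' t' u v" if "s' + u = a" "t' + v = b"
          unfolding that[symmetric] by (simp add: C_def)
        ultimately show ?thesis
          by (cases "s' = s \<and> t' = t \<and> int N dvd (int m - i)") (simp_all only: mult_1_right mult_zero_right simp_thms if_True if_False split: if_splits, auto)
      qed
      finally show ?thesis unfolding e0 .
    qed
    have "\<chi> s t i (G (\<Delta> (tl.pbw a b m))) = (\<Sum>s'\<in>{..a}. \<Sum>t'\<in>{..b}.
        (if s' = s then if t' = t then
             (if int N dvd (i + int s + int t - j) \<and> s + u = a \<and> t + v = b \<and> int N dvd (int m - i) then C s t u v else 0) else 0 else 0))"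
      unfolding comult_pbw dE_pow dG_pow
    proof (subst functional_mult_finsum[OF TU.T.kalg_axioms w], goal_cases)
      case 4
      show ?case by (intro sum.cong refl tm) auto
    qed auto
    also have "\<dots> = (\<Sum>s'\<in>{..a}. if s' = s then \<Sum>t'\<in>{..b}. (if t' = t then
             (if int N dvd (i + int s + int t - j) \<and> s + u = a \<and> t + v = b \<and> int N dvd (int m - i) then C s t u v else 0) else 0) else 0)"
      by (intro sum.cong refl) simp
    also have "\<dots> = (if int N dvd (i + int s + int t - j) \<and> s + u = a \<and> t + v = b \<and> int N dvd (int m - i) then C s t u v else 0)"
      by (auto simp: sum.delta)
    also have "\<dots> = (if int N dvd (i + int s + int t - j) then C s t u v * \<chi> (s + u) (t + v) i (tl.pbw a b m) else 0)"
      by (auto simp: chi_pbw[OF pbw])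
    finally show ?case .
  next
    case (add x y)
    then show ?case using G(1) Gc by (auto simp: \<Delta>D lin_map_def chi_add distrib_left)
  next
    case (smult c x)
    then show ?case using G(1) Gc by (auto simp: \<Delta>D lin_map_def chi_smult)
  qed
  then show ?thesis using that G by blast
qed

section \<open>Right coideal subalgebras: slices and generators\<close>

abbreviation "rcs S \<equiv> right_coideal_subalgebra U \<Delta> S"

lemma rcs_sub: "rcs S \<Longrightarrow> unital_subalgebra U S"
  by (simp add: right_coideal_subalgebra_def)

lemma rcs_slice:
  assumes "rcs S" "z \<in> S"
  obtains z' where "z' \<in> S" "\<And>s t i. \<chi> s t i z' =
       (if int N dvd (i + int s + int t - j) then C s t u v * \<chi> (s + u) (t + v) i z else 0)"
proof -
  obtain G where G: "lin_map TU U G" "\<And>a b. \<lbrakk>a \<in> carrier U; b \<in> carrier U\<rbrakk> \<Longrightarrow> G (tens a b) = \<chi> u v j b \<odot>\<^bsub>U\<^esub> a"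
    "\<And>z s t i. z \<in> carrier U \<Longrightarrow> \<chi> s t i (G (\<Delta> z)) =
       (if int N dvd (i + int s + int t - j) then C s t u v * \<chi> (s + u) (t + v) i z else 0)"
    using slice_comult by metis
  have "\<Delta> z \<in> left_subtensor U U S" using assms by (auto simp: right_coideal_subalgebra_def)
  then have "G (\<Delta> z) \<in> S" using TU.left_subtensor_slice[OF rcs_sub[OF assms(1)] G(1,2)] by blast
  moreover have "z \<in> carrier U" using unital_subalgebraD(1)[OF U.kalg_axioms rcs_sub[OF assms(1)]] assms(2) by blast
  ultimately show ?thesis using that G(3) by blast
qed

lemma rcs_generated:
  assumes G: "G \<subseteq> carrier U" and d: "\<And>g. g \<in> G \<Longrightarrow> \<Delta> g \<in> left_subtensor U U (subalgebra_generated U G)"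
  shows "rcs (subalgebra_generated U G)"
proof -
  let ?S = "subalgebra_generated U G"
  have S: "unital_subalgebra U ?S" by (rule unital_subalgebra_generated[OF U.kalg_axioms G])
  note L = TU.left_subtensor_closed[OF S] and \<Delta>D = algebra_homD[OF comult(1)]
  let ?M = "{z \<in> carrier U. \<Delta> z \<in> left_subtensor U U ?S}"
  have "unital_subalgebra U ?M"
    by (rule unital_subalgebraI[OF U.kalg_axioms]) (use L \<Delta>D in auto)
  moreover have "G \<subseteq> ?M" using G d by auto
  ultimately have "?S \<subseteq> ?M" by (rule subalgebra_generated_minimal)
  then show ?thesis using S by (auto simp: right_coideal_subalgebra_def)
qed

text \<open>\<open>E\<close> and \<open>Ft\<close> are skew primitive for the same group-like
  \<open>K\<close>. Hence every combination, even with a multiple of \<open>K\<close> added, has its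
  first tensor legs in the span of itself and 1.\<close>

lemma comult_degree_one:
  "\<Delta> (x \<odot>\<^bsub>U\<^esub> E \<oplus>\<^bsub>U\<^esub> y \<odot>\<^bsub>U\<^esub> Ft \<oplus>\<^bsub>U\<^esub> z \<odot>\<^bsub>U\<^esub> K) =
     tens (x \<odot>\<^bsub>U\<^esub> E \<oplus>\<^bsub>U\<^esub> y \<odot>\<^bsub>U\<^esub> Ft \<oplus>\<^bsub>U\<^esub> z \<odot>\<^bsub>U\<^esub> K) K \<oplus>\<^bsub>TU\<^esub> tens \<one>\<^bsub>U\<^esub> (x \<odot>\<^bsub>U\<^esub> E \<oplus>\<^bsub>U\<^esub> y \<odot>\<^bsub>U\<^esub> Ft)"
  by (simp add: algebra_homD[OF comult(1)] comult dE_def dG_def TU.tens_add_l TU.tens_add_r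
      TU.tens_smult_l TU.tens_smult_r TU.T.smult_add_r TU.T.a_ac)

lemma rcs_generated_degree_one:
  assumes "\<And>g. g \<in> G \<Longrightarrow> (\<exists>r::nat. g = K [^]\<^bsub>U\<^esub> r) \<or> (\<exists>x y z. g = x \<odot>\<^bsub>U\<^esub> E \<oplus>\<^bsub>U\<^esub> y \<odot>\<^bsub>U\<^esub> Ft \<oplus>\<^bsub>U\<^esub> z \<odot>\<^bsub>U\<^esub> K)"
  shows "rcs (subalgebra_generated U G)"
proof (rule rcs_generated)
  have "g \<in> carrier U" if "g \<in> G" for g
    using assms[OF that]
  proof
    assume "\<exists>r::nat. g = K [^]\<^bsub>U\<^esub> r"
    then obtain r :: nat where "g = K [^]\<^bsub>U\<^esub> r" by blast
    then show ?thesis by simp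
  next
    assume "\<exists>x y z. g = x \<odot>\<^bsub>U\<^esub> E \<oplus>\<^bsub>U\<^esub> y \<odot>\<^bsub>U\<^esub> Ft \<oplus>\<^bsub>U\<^esub> z \<odot>\<^bsub>U\<^esub> K"
    then obtain x y z where "g = x \<odot>\<^bsub>U\<^esub> E \<oplus>\<^bsub>U\<^esub> y \<odot>\<^bsub>U\<^esub> Ft \<oplus>\<^bsub>U\<^esub> z \<odot>\<^bsub>U\<^esub> K" by blast
    then show ?thesis by simp
  qed
  then show G: "G \<subseteq> carrier U" by blast
  fix g assume g: "g \<in> G"
  let ?S = "subalgebra_generated U G"
  have S: "unital_subalgebra U ?S" by (rule unital_subalgebra_generated[OF U.kalg_axioms G])
  note L = TU.left_subtensor_closed[OF S]
  have gS: "g \<in> ?S" "\<one>\<^bsub>U\<^esub> \<in> ?S"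
    using subsetD[OF subalgebra_generated_incl g] unital_subalgebraD(2)[OF U.kalg_axioms S] by auto
  have gc: "g \<in> carrier U" using G g by (rule subsetD)
  from assms[OF g] show "\<Delta> g \<in> left_subtensor U U ?S"
  proof
    assume "\<exists>r::nat. g = K [^]\<^bsub>U\<^esub> r"
    then obtain r :: nat where r: "g = K [^]\<^bsub>U\<^esub> r" by blast
    have "\<Delta> g = tens g g"
      unfolding r by (simp add: algebra_hom_pow[OF U.kalg_axioms TU.T.kalg_axioms comult(1)] comult TU.tens_pow)
    then show ?thesis using L(2)[OF gS(1) gc] by simp
  next
    assume "\<exists>x y z. g = x \<odot>\<^bsub>U\<^esub> E \<oplus>\<^bsub>U\<^esub> y \<odot>\<^bsub>U\<^esub> Ft \<oplus>\<^bsub>U\<^esub> z \<odot>\<^bsub>U\<^esub> K"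
    then obtain x y z where e: "g = x \<odot>\<^bsub>U\<^esub> E \<oplus>\<^bsub>U\<^esub> y \<odot>\<^bsub>U\<^esub> Ft \<oplus>\<^bsub>U\<^esub> z \<odot>\<^bsub>U\<^esub> K" by blast
    have "\<Delta> g = tens g K \<oplus>\<^bsub>TU\<^esub> tens \<one>\<^bsub>U\<^esub> (x \<odot>\<^bsub>U\<^esub> E \<oplus>\<^bsub>U\<^esub> y \<odot>\<^bsub>U\<^esub> Ft)"
      unfolding e by (rule comult_degree_one)
    then show ?thesis using L(2)[OF gS(1), of K] L(2)[OF gS(2), of "x \<odot>\<^bsub>U\<^esub> E \<oplus>\<^bsub>U\<^esub> y \<odot>\<^bsub>U\<^esub> Ft"] L(3) by simp
  qed
qed

end

section \<open>Weights and leading forms\<close>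

text \<open>An abstract form of the statement that a form whose derivatives are multiples of powers of a fixed
  linear form is itself such a multiple: only the supports of the forms are recorded.\<close>

lemma support_pivot:
  fixes P :: "nat \<Rightarrow> (nat \<Rightarrow> nat \<Rightarrow> bool) set"
  assumes E: "\<And>d p. p \<in> P (Suc d) \<Longrightarrow> (\<lambda>a b. p (Suc a) b) \<in> P d"
    and F: "\<And>d p. p \<in> P (Suc d) \<Longrightarrow> (\<lambda>a b. p a (Suc b)) \<in> P d"
    and supp: "\<And>d p a b. p \<in> P d \<Longrightarrow> p a b \<Longrightarrow> a + b = d"
    and one: "\<And>p. p \<in> P 1 \<Longrightarrow> \<not> p 1 0 \<Longrightarrow> \<not> p 0 1"
    and "p \<in> P (Suc d)" "\<not> p (Suc d) 0"
  shows "\<not> p a b"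
  using assms(5,6)
proof (induction d arbitrary: p a b)
  case 0
  show ?case
  proof
    assume "p a b"
    then have "a + b = 1" using supp[OF 0(1)] by simp
    then have "a = 1 \<and> b = 0 \<or> a = 0 \<and> b = 1" by arith
    then show False using one[of p] 0 \<open>p a b\<close> by auto
  qed
next
  case (Suc d)
  \<comment> \<open>Lowering the first exponent sends pivot to pivot, so that derivative vanishes.
    The other derivative has the pivot entry \<open>p (Suc d) 1\<close>, which is among the entries
    just excluded.\<close>
  have 1: "\<not> p (Suc a) b" for a b
    using Suc.IH[OF E[OF Suc.prems(1)]] Suc.prems(2) by simp
  have 2: "\<not> p a (Suc b)" for a b
    using Suc.IH[OF F[OF Suc.prems(1)]] 1 by simp
  show ?case using supp[OF Suc.prems(1), of a b] 1 2 by (cases a; cases b) auto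
qed

context odd_root0
begin

text \<open>Integer exponents are reduced modulo \<open>N\<close> before the natural power is taken,
  so inverses of \<open>K\<close> need no separate notation.\<close>

definition "Kp i = K [^]\<^bsub>U\<^esub> nat (i mod int N)"

lemma Kp_closed [simp]: "Kp i \<in> carrier U" by (simp add: Kp_def)

lemma int_N_pos: "int N > 0" using N1 by simp

lemma chi_mult_Kp: "z \<in> carrier U \<Longrightarrow> \<chi> a b j (z \<otimes>\<^bsub>U\<^esub> Kp i) = \<chi> a b (j - i) z"
proof -
  assume z: "z \<in> carrier U"
  have "int N dvd (j - int (nat (i mod int N)) - (j - i))"
    using int_N_pos by (simp add: algebra_simps minus_mod_eq_mult_div)
  then show ?thesis unfolding Kp_def chi_K_right[OF z] by (rule chi_periodic)
qed

lemma chi_one: "\<chi> a b j \<one>\<^bsub>U\<^esub> = (if a = 0 \<and> b = 0 \<and> int N dvd j then 1 else 0)"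
  using chi_pbw[of 0 0 a b j 0] N1 by (simp add: tl.pbw_def)

lemma chi_Kp: "\<chi> a b j (Kp i) = (if a = 0 \<and> b = 0 \<and> int N dvd (j - i) then 1 else 0)"
  using chi_mult_Kp[of "\<one>\<^bsub>U\<^esub>" a b j i] by (simp add: chi_one)

lemma Kp_periodic: "int N dvd (i - j) \<Longrightarrow> Kp i = Kp j"
  by (simp add: Kp_def mod_eq_dvd_iff[symmetric])

lemma Kp_add: "Kp i \<otimes>\<^bsub>U\<^esub> Kp j = Kp (i + j)"
  by (rule chi_eqI) (simp_all add: chi_mult_Kp chi_Kp algebra_simps)

lemma Kp_0: "Kp 0 = \<one>\<^bsub>U\<^esub>" by (simp add: Kp_def)

lemma Kp_nat: "Kp (int n) = K [^]\<^bsub>U\<^esub> n"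
  by (simp add: Kp_def of_nat_mod[symmetric] K_pow_mod)

lemma Kp_pow: "Kp i [^]\<^bsub>U\<^esub> (n::nat) = Kp (i * int n)"
  by (induction n) (simp_all add: Kp_0 Kp_add algebra_simps)

text \<open>Negative multiples are included, because modulo \<open>N\<close> every integer has a
  natural representative; the powers of \<open>K\<close> in \<open>S\<close> thus form a
  group.\<close>

lemma Kp_multiple:
  assumes "unital_subalgebra U S" "Kp i \<in> S"
  shows "Kp (i * m) \<in> S"
proof -
  have "Kp (i * m) = Kp (i * int (nat (m mod int N)))"
  proof (rule Kp_periodic)
    have "int (nat (m mod int N)) = m mod int N" using int_N_pos by simp
    then show "int N dvd i * m - i * int (nat (m mod int N))"
      by (simp add: right_diff_distrib[symmetric] minus_mod_eq_mult_div)
  qed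
  then show ?thesis
    unfolding Kp_pow[symmetric] using unital_subalgebraD(8)[OF U.kalg_axioms assms] by simp
qed

lemma chi_K1: "\<chi> a b j K = (if a = 0 \<and> b = 0 \<and> int N dvd (j - 1) then 1 else 0)"
  using chi_Kp[of a b j 1] Kp_nat[of 1] by simp

lemma chi_E1: "\<chi> a b j E = (if a = 1 \<and> b = 0 \<and> int N dvd j then 1 else 0)"
  using chi_pbw[of 1 0 a b j 0] N1 by (simp add: tl.pbw_def)

lemma chi_Ft1: "\<chi> a b j Ft = (if a = 0 \<and> b = 1 \<and> int N dvd j then 1 else 0)"
  using chi_pbw[of 0 1 a b j 0] N1 by (simp add: tl.pbw_def)

text \<open>The weight of \<open>E ^ a Ft ^ b K ^ i\<close> is \<open>i + a + b\<close> modulo \<open>N\<close>: this is the right coaction of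
  the group-like elements. Right coideals are graded by weight, but the multiplication is not.\<close>

definition "hw w z \<longleftrightarrow> (\<forall>a b i. \<chi> a b i z \<noteq> 0 \<longrightarrow> int N dvd (i + int a + int b - w))"
definition "dle d z \<longleftrightarrow> (\<forall>a b i. d < a + b \<longrightarrow> \<chi> a b i z = 0)"

lemma rcs_carrier: "rcs S \<Longrightarrow> z \<in> S \<Longrightarrow> z \<in> carrier U"
  using unital_subalgebraD(1)[OF U.kalg_axioms rcs_sub] by blast

text \<open>The slice with \<open>(u, v) = (0, 0)\<close> lowers nothing; it contracts with a power
  of \<open>K\<close> and so keeps one weight only.\<close>

lemma rcs_proj:
  assumes "rcs S" "z \<in> S"
  obtains z' where "z' \<in> S" "\<And>a b i. \<chi> a b i z' = (if int N dvd (i + int a + int b - w) then \<chi> a b i z else 0)"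
proof -
  obtain z' where "z' \<in> S" "\<And>s t i. \<chi> s t i z' =
       (if int N dvd (i + int s + int t - w) then C s t 0 0 * \<chi> (s + 0) (t + 0) i z else 0)"
    using rcs_slice[OF assms, of w 0 0] by blast
  then show ?thesis using that by simp
qed

text \<open>After contraction with the coordinate of a leading monomial only one power of
  \<open>K\<close> remains, as no monomial of larger degree occurs. Its coefficient is nonzero by
  \<open>C_nz\<close>, whose bounds hold because the monomial occurs in \<open>z\<close>.\<close>

lemma rcs_top_K:
  assumes "rcs S" "z \<in> S" "hw w z" "dle d z" "\<chi> a b i z \<noteq> 0" "a + b = d"
  shows "Kp (w - int d) \<in> S"
proof -
  note D = unital_subalgebraD[OF U.kalg_axioms rcs_sub[OF assms(1)]]
  obtain z' where z': "z' \<in> S" "\<And>s t i'. \<chi> s t i' z' =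
       (if int N dvd (i' + int s + int t - i) then C s t a b * \<chi> (s + a) (t + b) i' z else 0)"
    using rcs_slice[OF assms(1,2), of i a b] by blast
  have zc: "z \<in> carrier U" using rcs_carrier assms by blast
  have ab: "a < N" "b < N" using chi_support[OF zc, of a b i] assms(5) by (auto simp: linorder_not_le[symmetric])
  let ?c = "C 0 0 a b * \<chi> a b i z"
  have c: "?c \<noteq> 0" using C_nz[of 0 a 0 b] ab assms(5) by simp
  have "z' = ?c \<odot>\<^bsub>U\<^esub> Kp i"
  proof (rule chi_eqI)
    fix s t i'
    show "\<chi> s t i' z' = \<chi> s t i' (?c \<odot>\<^bsub>U\<^esub> Kp i)"
    proof (cases "s = 0 \<and> t = 0")
      case True
      then show ?thesis using chi_periodic[of i' i a b z] by (auto simp: z' chi_smult chi_Kp)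
    next
      case False
      then have "\<chi> (s + a) (t + b) i' z = 0" using assms(4,6) by (auto simp: dle_def)
      then show ?thesis using False by (auto simp: z' chi_smult chi_Kp)
    qed
  qed (use rcs_carrier[OF assms(1) z'(1)] in auto)
  then have "Kp i = inverse ?c \<odot>\<^bsub>U\<^esub> z'"
    using left_inverse[OF c] by (simp only: U.smult_smult U.smult_1 Kp_closed)
  then have "Kp i \<in> S" using D(7) z'(1) by simp
  moreover have "Kp i = Kp (w - int d)"
  proof (rule Kp_periodic)
    have "int N dvd (i + int a + int b - w)" using assms(3,5) by (auto simp: hw_def)
    moreover have "i - (w - int d) = i + int a + int b - w" using assms(6) by simp
    ultimately show "int N dvd (i - (w - int d))" by metis
  qed
  ultimately show ?thesis by simp
qed

lemma sum_projections:
  assumes "z \<in> carrier U" and f: "\<And>w. w < N \<Longrightarrow> f w \<in> carrier U"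
    and chi: "\<And>w a b i. w < N \<Longrightarrow> \<chi> a b i (f w) = (if int N dvd (i + int a + int b - int w) then \<chi> a b i z else 0)"
  shows "z = (\<Oplus>\<^bsub>U\<^esub>w\<in>{..<N}. f w)"
proof (rule chi_eqI)
  show "(\<Oplus>\<^bsub>U\<^esub>w\<in>{..<N}. f w) \<in> carrier U" using f by auto
  fix a b i
  let ?w = "nat ((i + int a + int b) mod int N)"
  have w: "?w < N" using int_N_pos by (simp add: nat_less_iff)
  have eq: "int N dvd (i + int a + int b - int w) \<longleftrightarrow> w = ?w" if "w < N" for w
  proof -
    have "int N dvd (i + int a + int b - int w) \<longleftrightarrow> (i + int a + int b) mod int N = int w mod int N"
      by (simp add: mod_eq_dvd_iff)
    then show ?thesis using that int_N_pos by auto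
  qed
  have "\<chi> a b i (\<Oplus>\<^bsub>U\<^esub>w\<in>{..<N}. f w) = (\<Sum>w<N. \<chi> a b i (f w))"
    by (rule functional_finsum[OF U.kalg_axioms chi_functional]) (use f in auto)
  also have "\<dots> = (\<Sum>w<N. if w = ?w then \<chi> a b i z else 0)"
    by (intro sum.cong refl) (use chi eq in auto)
  also have "\<dots> = \<chi> a b i z" using w by (simp add: sum.delta')
  finally show "\<chi> a b i z = \<chi> a b i (\<Oplus>\<^bsub>U\<^esub>w\<in>{..<N}. f w)" by simp
qed (rule assms(1))

text \<open>A right coideal subalgebra is recovered from its powers of \<open>K\<close> and the leading forms of its
  elements of weight equal to their degree.\<close>

lemma rcs_subset:
  assumes S: "rcs S" and B: "rcs B" and BS: "B \<subseteq> S" and Kp: "\<And>i. Kp i \<in> S \<Longrightarrow> Kp i \<in> B"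
    and red: "\<And>d z. \<lbrakk>z \<in> S; hw (int (Suc d)) z; dle (Suc d) z\<rbrakk> \<Longrightarrow>
       \<exists>y\<in>B. dle (Suc d) y \<and> (\<forall>a b. a + b = Suc d \<longrightarrow> \<chi> a b 0 y = \<chi> a b 0 z)"
  shows "S \<subseteq> B"
proof -
  note DS = unital_subalgebraD[OF U.kalg_axioms rcs_sub[OF S]]
  note DB = unital_subalgebraD[OF U.kalg_axioms rcs_sub[OF B]]
  have main: "z \<in> B" if "z \<in> S" "hw w z" "dle d z" for z w d
    using that
  proof (induction d arbitrary: z w)
    case 0
    have zc: "z \<in> carrier U" using rcs_carrier[OF S] 0 by blast
    have "z = \<chi> 0 0 w z \<odot>\<^bsub>U\<^esub> Kp w"
    proof (rule chi_eqI[OF zc])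
      fix a b i
      show "\<chi> a b i z = \<chi> a b i (\<chi> 0 0 w z \<odot>\<^bsub>U\<^esub> Kp w)"
      proof (cases "a = 0 \<and> b = 0")
        case True
        have "\<chi> 0 0 i z = 0" if "\<not> int N dvd (i - w)"
          using 0(2) that unfolding hw_def by (metis add.right_neutral of_nat_0)
        then show ?thesis using True chi_periodic[of i w 0 0 z]
          by (auto simp: chi_smult chi_Kp)
      next
        case False
        then show ?thesis using 0(3) by (auto simp: chi_smult chi_Kp dle_def)
      qed
    qed simp
    moreover have "\<chi> 0 0 w z \<odot>\<^bsub>U\<^esub> Kp w \<in> B"
    proof (cases "\<chi> 0 0 w z = 0")
      case True
      then show ?thesis using DB(3) by simp
    next
      case False
      then have "Kp w \<in> S" using rcs_top_K[OF S 0(1-3) False] by simp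
      then show ?thesis using Kp DB(7) by blast
    qed
    ultimately show ?case by simp
  next
    case (Suc d)
    have zc: "z \<in> carrier U" using rcs_carrier[OF S] Suc by blast
    show ?case
    proof (cases "dle d z")
      case True
      then show ?thesis using Suc by blast
    next
      case False
      then obtain a b i where ab: "d < a + b" "\<chi> a b i z \<noteq> 0" by (auto simp: dle_def)
      then have "a + b = Suc d" using Suc.prems(3) unfolding dle_def by (metis Suc_lessI)
      then have K1: "Kp (w - int (Suc d)) \<in> S" using rcs_top_K[OF S Suc.prems ab(2)] by simp
      have K2: "Kp (int (Suc d) - w) \<in> S"
        using Kp_multiple[OF rcs_sub[OF S] K1, of "- 1"] by simp
      \<comment> \<open>This shifts \<open>z\<close> to weight equal to the degree, where
        \<open>red\<close> applies; the shift is undone at the end by a power of \<open>K\<close>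
        that lies in \<open>B\<close> as well.\<close>
      define z' where "z' = z \<otimes>\<^bsub>U\<^esub> Kp (int (Suc d) - w)"
      have z'c: "z' \<in> carrier U" using zc by (simp add: z'_def)
      have chi': "\<chi> a b j z' = \<chi> a b (j - (int (Suc d) - w)) z" for a b j
        unfolding z'_def by (rule chi_mult_Kp[OF zc])
      have z': "z' \<in> S" using DS(5) Suc.prems(1) K2 by (simp add: z'_def)
      have h': "hw (int (Suc d)) z'"
        unfolding hw_def
      proof (intro allI impI)
        fix a b j assume "\<chi> a b j z' \<noteq> 0"
        then have "int N dvd (j - (int (Suc d) - w) + int a + int b - w)"
          using Suc.prems(2) unfolding hw_def chi' by blast
        then show "int N dvd (j + int a + int b - int (Suc d))" by (simp add: algebra_simps)
      qed
      have d': "dle (Suc d) z'" using Suc.prems(3) by (simp add: dle_def chi')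
      obtain y where y: "y \<in> B" "dle (Suc d) y" "\<And>a b. a + b = Suc d \<Longrightarrow> \<chi> a b 0 y = \<chi> a b 0 z'"
        using red[OF z' h' d'] by blast
      \<comment> \<open>\<open>y\<close> need not be homogeneous; its component of weight
        \<open>Suc d\<close> stays in \<open>B\<close> and has the same relevant leading
        form.\<close>
      obtain y' where y': "y' \<in> B" "\<And>a b i. \<chi> a b i y' = (if int N dvd (i + int a + int b - int (Suc d)) then \<chi> a b i y else 0)"
        using rcs_proj[OF B y(1)] by blast
      have y'c: "y' \<in> carrier U" using rcs_carrier[OF B y'(1)] .
      have chid: "\<chi> a b i (z' \<ominus>\<^bsub>U\<^esub> y') = \<chi> a b i z' - \<chi> a b i y'" for a b i
        by (rule chi_diff[OF z'c y'c])
      have "z' \<ominus>\<^bsub>U\<^esub> y' \<in> B"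
      \<comment> \<open>The difference keeps the weight \<open>Suc d\<close> while its degree drops,
        which is why the induction ranges over all weights.\<close>
      proof (rule Suc.IH)
        show "z' \<ominus>\<^bsub>U\<^esub> y' \<in> S" using DS(6) z' y' BS by blast
        show "hw (int (Suc d)) (z' \<ominus>\<^bsub>U\<^esub> y')" using h' by (auto simp: hw_def chid y'(2))
        show "dle d (z' \<ominus>\<^bsub>U\<^esub> y')"
          unfolding dle_def
        proof (intro allI impI)
          fix a b i assume ab: "d < a + b"
          show "\<chi> a b i (z' \<ominus>\<^bsub>U\<^esub> y') = 0"
          proof (cases "a + b = Suc d")
            case True
            then have e: "i + int a + int b - int (Suc d) = i" by simp
            show ?thesis
            proof (cases "int N dvd i")
              case True
              then have "\<chi> a b i z' = \<chi> a b 0 z'" "\<chi> a b i y = \<chi> a b 0 y"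
                by (simp_all add: chi_periodic)
              then show ?thesis using y(3) \<open>a + b = Suc d\<close> True unfolding chid y'(2) e by simp
            next
              case False
              then have "\<chi> a b i z' = 0" using h' e unfolding hw_def by metis
              then show ?thesis using False unfolding chid y'(2) e by simp
            qed
          next
            case False
            then have "Suc d < a + b" using ab by simp
            then show ?thesis using d' y(2) by (simp add: chid y'(2) dle_def)
          qed
        qed
      qed
      then have "(z' \<ominus>\<^bsub>U\<^esub> y') \<oplus>\<^bsub>U\<^esub> y' \<in> B" using DB(4) y' by blast
      moreover have "(z' \<ominus>\<^bsub>U\<^esub> y') \<oplus>\<^bsub>U\<^esub> y' = z'"
        using z'c y'c by (simp add: a_minus_def U.a_assoc U.l_neg)
      ultimately have "z' \<otimes>\<^bsub>U\<^esub> Kp (w - int (Suc d)) \<in> B" using DB(5) Kp[OF K1] by simp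
      moreover have "z' \<otimes>\<^bsub>U\<^esub> Kp (w - int (Suc d)) = z"
        using zc by (simp add: z'_def U.m_assoc Kp_add Kp_0)
      ultimately show ?thesis by simp
    qed
  qed
  show ?thesis
  proof
    fix z assume z: "z \<in> S"
    have zc: "z \<in> carrier U" using rcs_carrier[OF S z] .
    have "\<exists>z'. z' \<in> S \<and> (\<forall>a b i. \<chi> a b i z' = (if int N dvd (i + int a + int b - int w) then \<chi> a b i z else 0))" for w
      using rcs_proj[OF S z, of "int w"] by metis
    then obtain f where f: "\<And>w. f w \<in> S" "\<And>w a b i. \<chi> a b i (f w) = (if int N dvd (i + int a + int b - int w) then \<chi> a b i z else 0)"
      by metis
    have "f w \<in> B" for w
    proof (rule main[OF f(1)])
      show "hw (int w) (f w)" by (auto simp: hw_def f(2))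
      \<comment> \<open>A crude bound that starts the induction: beyond it one of the two exponents
        is at least \<open>N\<close>.\<close>
      show "dle (2 * N) (f w)"
        unfolding dle_def
      proof (intro allI impI)
        fix a b i assume "2 * N < a + b"
        then have "N \<le> a \<or> N \<le> b" by linarith
        then show "\<chi> a b i (f w) = 0" by (rule chi_support[OF rcs_carrier[OF S f(1)]])
      qed
    qed
    then have "(\<Oplus>\<^bsub>U\<^esub>w\<in>{..<N}. f w) \<in> B" by (rule DB(9))
    moreover have "z = (\<Oplus>\<^bsub>U\<^esub>w\<in>{..<N}. f w)"
      by (rule sum_projections[OF zc]) (simp_all add: f(2) rcs_carrier[OF S f(1)])
    ultimately show "z \<in> B" by metis
  qed
qed

text \<open>Only the support is kept, because lowering rescales the coefficients by the nonzero
  constants \<open>C\<close>. Weight equal to degree forces the exponent of \<open>K\<close> to be 0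
  modulo \<open>N\<close>, so \<open>\<chi> a b 0\<close> sees the whole leading form.\<close>

definition "topsupp d z a b \<longleftrightarrow> a + b = d \<and> \<chi> a b 0 z \<noteq> 0" for d a b :: nat
definition "forms S d = topsupp d ` {z \<in> S. hw (int d) z \<and> dle d z}" for d :: nat

text \<open>Slicing at \<open>j = d\<close> with a unit vector \<open>(u, v)\<close> keeps weight
  equal to degree, and \<open>C_nz\<close> ensures that no support point is lost.\<close>

lemma forms_lower:
  assumes S: "rcs S" and p: "p \<in> forms S (Suc d)"
  shows "(\<lambda>a b. p (Suc a) b) \<in> forms S d" "(\<lambda>a b. p a (Suc b)) \<in> forms S d"
proof -
  obtain z where z: "z \<in> S" "hw (int (Suc d)) z" "dle (Suc d) z" "p = topsupp (Suc d) z"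
    using p by (auto simp: forms_def)
  note zc = rcs_carrier[OF S z(1)]
  have lower: "(\<lambda>a b. p (a + u) (b + v)) \<in> forms S d" if uv: "u + v = 1" for u v
  proof -
    obtain z' where z': "z' \<in> S" "\<And>s t i. \<chi> s t i z' =
       (if int N dvd (i + int s + int t - int d) then C s t u v * \<chi> (s + u) (t + v) i z else 0)"
      using rcs_slice[OF S z(1), of "int d" u v] by blast
    have "hw (int d) z'" by (auto simp: hw_def z'(2))
    moreover have "dle d z'" using z(3) uv by (auto simp: dle_def z'(2))
    moreover have "topsupp d z' = (\<lambda>a b. p (a + u) (b + v))"
    proof (intro ext)
      fix a b
      have "\<chi> a b 0 z' \<noteq> 0 \<longleftrightarrow> \<chi> (a + u) (b + v) 0 z \<noteq> 0" if "a + b = d"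
      proof -
        have "int N dvd (0 + int a + int b - int d)" using that by (simp flip: of_nat_add)
        then have "\<chi> a b 0 z' = C a b u v * \<chi> (a + u) (b + v) 0 z" using z'(2) by simp
        moreover have "C a b u v \<noteq> 0" if "\<chi> (a + u) (b + v) 0 z \<noteq> 0"
          using chi_support[OF zc, of "a + u" "b + v" 0] that by (intro C_nz) (auto simp: linorder_not_le[symmetric])
        ultimately show ?thesis by auto
      qed
      then show "topsupp d z' a b = p (a + u) (b + v)"
        using uv by (auto simp: topsupp_def z(4))
    qed
    ultimately show ?thesis using z'(1) unfolding forms_def by (metis (mono_tags, lifting) image_eqI mem_Collect_eq)
  qed
  show "(\<lambda>a b. p (Suc a) b) \<in> forms S d" "(\<lambda>a b. p a (Suc b)) \<in> forms S d"
    using lower[of 1 0] lower[of 0 1] by simp_all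
qed

lemma forms_supp: "p \<in> forms S d \<Longrightarrow> p a b \<Longrightarrow> a + b = d"
  by (auto simp: forms_def topsupp_def)

lemma pivot_E:
  assumes "rcs S" "\<And>p. p \<in> forms S 1 \<Longrightarrow> \<not> p 1 0 \<Longrightarrow> \<not> p 0 1" "p \<in> forms S (Suc d)" "\<not> p (Suc d) 0"
  shows "\<not> p a b"
  by (rule support_pivot[of "forms S"]) (use assms forms_lower forms_supp in auto)

text \<open>The argument for \<open>E\<close> with the two exponents exchanged.\<close>

lemma pivot_Ft:
  assumes "rcs S" "\<And>p. p \<in> forms S 1 \<Longrightarrow> \<not> p 0 1 \<Longrightarrow> \<not> p 1 0" "p \<in> forms S (Suc d)" "\<not> p 0 (Suc d)"
  shows "\<not> p a b"
proof -
  let ?P = "\<lambda>d. (\<lambda>p a b. p b a) ` forms S d"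
  have p': "(\<lambda>a b. p b a) \<in> ?P (Suc d)" using assms(3) by (rule imageI)
  show ?thesis
  proof (rule support_pivot[where P = ?P and p = "\<lambda>a b. p b a" and a = b and b = a and d = d, OF _ _ _ _ p'])
    fix d p assume "p \<in> ?P (Suc d)"
    then obtain p' where p': "p' \<in> forms S (Suc d)" "p = (\<lambda>a b. p' b a)" by auto
    show "(\<lambda>a b. p (Suc a) b) \<in> ?P d" "(\<lambda>a b. p a (Suc b)) \<in> ?P d"
      using forms_lower[OF assms(1) p'(1)] p'(2) by (auto intro!: image_eqI)
  next
    show "a + b = d" if "p \<in> ?P d" "p a b" for d p a b
      using that forms_supp[of _ S d b a] by (auto simp: add.commute)
  next
    show "\<not> p 0 1" if "p \<in> ?P 1" "\<not> p 1 0" for p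
      using that assms(2) by auto
  qed (use assms(4) in simp)
qed

section \<open>Elements of degree one and leading forms of their products\<close>

definition "el x y c = x \<odot>\<^bsub>U\<^esub> E \<oplus>\<^bsub>U\<^esub> y \<odot>\<^bsub>U\<^esub> Ft \<oplus>\<^bsub>U\<^esub> c \<odot>\<^bsub>U\<^esub> K" for x y c

lemma el_closed [simp]: "el x y c \<in> carrier U" by (simp add: el_def)

lemma chi_el: "\<chi> a b j (el x y c) = (if a = 1 \<and> b = 0 \<and> int N dvd j then x else 0)
    + (if a = 0 \<and> b = 1 \<and> int N dvd j then y else 0) + (if a = 0 \<and> b = 0 \<and> int N dvd (j - 1) then c else 0)"
  by (simp add: el_def chi_add chi_smult chi_E1 chi_Ft1 chi_K1)

lemma el_add: "el x y c \<oplus>\<^bsub>U\<^esub> el x' y' c' = el (x + x') (y + y') (c + c')"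
  by (rule chi_eqI) (auto simp: chi_add chi_el)

lemma el_smult: "t \<odot>\<^bsub>U\<^esub> el x y c = el (t * x) (t * y) (t * c)"
  by (rule chi_eqI) (auto simp: chi_smult chi_el)

lemma el_gens: "el 1 0 0 = E" "el 0 1 0 = Ft" "el 0 0 1 = K"
  by (simp_all add: el_def)

lemma el_forms: "E \<oplus>\<^bsub>U\<^esub> y \<odot>\<^bsub>U\<^esub> Ft \<oplus>\<^bsub>U\<^esub> c \<odot>\<^bsub>U\<^esub> K = el 1 y c" "Ft \<oplus>\<^bsub>U\<^esub> c \<odot>\<^bsub>U\<^esub> K = el 0 1 c"
  "E \<oplus>\<^bsub>U\<^esub> c \<odot>\<^bsub>U\<^esub> K = el 1 0 c"
  by (simp_all add: el_def)

text \<open>Modulo \<open>N\<close>, weight 1 allows only \<open>K^0\<close> next to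
  \<open>E\<close> or \<open>Ft\<close>, and only \<open>K^1\<close> in degree zero.\<close>

lemma degree_one_el:
  assumes "z \<in> carrier U" "hw 1 z" "dle 1 z"
  shows "z = el (\<chi> 1 0 0 z) (\<chi> 0 1 0 z) (\<chi> 0 0 1 z)"
proof (rule chi_eqI[OF assms(1)])
  fix a b i
  show "\<chi> a b i z = \<chi> a b i (el (\<chi> 1 0 0 z) (\<chi> 0 1 0 z) (\<chi> 0 0 1 z))"
  proof (cases "1 < a + b")
    case True
    then show ?thesis using assms(3) by (auto simp: dle_def chi_el)
  next
    case False
    then consider "a = 1" "b = 0" | "a = 0" "b = 1" | "a = 0" "b = 0" by linarith
    then show ?thesis
    proof cases
      case 1
      have "\<chi> 1 0 i z = 0" if "\<not> int N dvd i"
        using assms(2) that unfolding hw_def by (metis add.right_neutral add_diff_cancel_right' of_nat_0 of_nat_1)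
      then show ?thesis using 1 chi_periodic[of i 0 1 0 z] by (auto simp: chi_el)
    next
      case 2
      have "\<chi> 0 1 i z = 0" if "\<not> int N dvd i"
        using assms(2) that unfolding hw_def by (metis add.right_neutral add_diff_cancel_right' of_nat_0 of_nat_1)
      then show ?thesis using 2 chi_periodic[of i 0 0 1 z] by (auto simp: chi_el)
    next
      case 3
      have "\<chi> 0 0 i z = 0" if "\<not> int N dvd (i - 1)"
        using assms(2) that unfolding hw_def by (metis add.right_neutral of_nat_0)
      then show ?thesis using 3 chi_periodic[of i 1 0 0 z] by (auto simp: chi_el)
    qed
  qed
qed simp

lemma forms_one:
  assumes "rcs S" "p \<in> forms S 1"
  obtains x y c where "el x y c \<in> S" "p 1 0 \<longleftrightarrow> x \<noteq> 0" "p 0 1 \<longleftrightarrow> y \<noteq> 0"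
proof -
  obtain z where z: "z \<in> S" "hw 1 z" "dle 1 z" "p = topsupp 1 z" using assms by (auto simp: forms_def)
  then have e: "z = el (\<chi> 1 0 0 z) (\<chi> 0 1 0 z) (\<chi> 0 0 1 z)"
    using degree_one_el rcs_carrier[OF assms(1)] by blast
  show ?thesis
  proof (rule that)
    show "el (\<chi> 1 0 0 z) (\<chi> 0 1 0 z) (\<chi> 0 0 1 z) \<in> S" using z(1) e by metis
  qed (auto simp: z(4) topsupp_def)
qed

lemma chi_el_mult:
  assumes "z \<in> carrier U"
  shows "\<chi> a b i (el x y c \<otimes>\<^bsub>U\<^esub> z) = x * \<chi> a b i (E \<otimes>\<^bsub>U\<^esub> z) + y * \<chi> a b i (Ft \<otimes>\<^bsub>U\<^esub> z) + c * \<chi> a b i (K \<otimes>\<^bsub>U\<^esub> z)"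
  using assms by (simp add: el_def U.l_distr chi_add chi_smult)

lemma dle_mult:
  assumes "z \<in> carrier U" "dle n z"
  shows "dle (Suc n) (el x y c \<otimes>\<^bsub>U\<^esub> z)"
  unfolding dle_def
proof (intro allI impI)
  fix a b i assume ab: "Suc n < a + b"
  have 0: "\<chi> a' b' i' z = 0" if "n < a' + b'" for a' b' i' using assms(2) that by (simp add: dle_def)
  have "n < a - 1 + b" "n < a + (b - 1)" "n < Suc a + b" "n < a + b" using ab by auto
  then show "\<chi> a b i (el x y c \<otimes>\<^bsub>U\<^esub> z) = 0"
    by (simp add: chi_el_mult[OF assms(1)] chi_E[OF assms(1)] chi_Ft[OF assms(1)] chi_K[OF assms(1)] 0)
qed

text \<open>Neither the \<open>K\<close> summand nor the terms from \<open>1 - K^2\<close> reach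
  degree \<open>Suc n\<close>. Leading forms therefore multiply as in a truncated quantum plane,
  with \<open>(q ^ 2) ^ a\<close> for moving \<open>Ft\<close> past \<open>E^a\<close>.\<close>

lemma top_mult:
  assumes "z \<in> carrier U" "dle n z" "a + b = Suc n"
  shows "\<chi> a b 0 (el x y c \<otimes>\<^bsub>U\<^esub> z) = x * (if a mod N = 0 then 0 else \<chi> (a - 1) b 0 z)
     + y * (if b mod N = 0 then 0 else (q ^ 2) ^ a * \<chi> a (b - 1) 0 z)"
proof -
  have 0: "\<chi> a' b' i' z = 0" if "n < a' + b'" for a' b' i' using assms(2) that by (simp add: dle_def)
  have "n < Suc a + b" "n < a + b" using assms(3) by auto
  then show ?thesis
    by (simp add: chi_el_mult[OF assms(1)] chi_E[OF assms(1)] chi_Ft[OF assms(1)] chi_K[OF assms(1)] 0)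
qed

lemma dle_one: "dle 0 \<one>\<^bsub>U\<^esub>"
  by (auto simp: dle_def chi_one)

lemma dle_pow_mult:
  assumes "z \<in> carrier U" "dle n z"
  shows "dle (m + n) (el x y c [^]\<^bsub>U\<^esub> m \<otimes>\<^bsub>U\<^esub> z)"
proof (induction m)
  case (Suc m)
  have "el x y c [^]\<^bsub>U\<^esub> Suc m \<otimes>\<^bsub>U\<^esub> z = el x y c \<otimes>\<^bsub>U\<^esub> (el x y c [^]\<^bsub>U\<^esub> m \<otimes>\<^bsub>U\<^esub> z)"
    unfolding U.nat_pow_Suc2[OF el_closed] using assms(1) by (simp add: U.m_assoc)
  then show ?case using dle_mult[OF _ Suc] assms(1) by simp
qed (use assms in simp)

lemma dle_pow: "dle m (el x y c [^]\<^bsub>U\<^esub> m)"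
  using dle_pow_mult[OF _ dle_one, of m x y c] by simp

text \<open>For \<open>b = 0\<close> the \<open>Ft\<close> summand of \<open>top_mult\<close> is
  absent, so the coefficient passes unchanged from one power to the next.\<close>

lemma top_pow_E: "d < N \<Longrightarrow> \<chi> d 0 0 (el 1 y c [^]\<^bsub>U\<^esub> d) = 1"
proof (induction d)
  case (Suc d)
  then show ?case
    unfolding U.nat_pow_Suc2[OF el_closed] by (subst top_mult[OF _ dle_pow]) auto
qed (simp add: chi_one)

lemma top_pow_Ft: "a + b = d \<Longrightarrow> d < N \<Longrightarrow> \<chi> a b 0 (el 0 1 c [^]\<^bsub>U\<^esub> d) = (if a = 0 then 1 else 0)"
proof (induction d arbitrary: b)
  case (Suc d)
  have "\<chi> a b 0 (el 0 1 c [^]\<^bsub>U\<^esub> Suc d) = (if b mod N = 0 then 0 else (q ^ 2) ^ a * \<chi> a (b - 1) 0 (el 0 1 c [^]\<^bsub>U\<^esub> d))"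
    unfolding U.nat_pow_Suc2[OF el_closed] by (subst top_mult[OF _ dle_pow]) (use Suc in auto)
  also have "\<dots> = (if a = 0 then 1 else 0)"
  proof (cases b)
    case 0
    then show ?thesis using Suc.prems by simp
  next
    case (Suc b')
    then show ?thesis using Suc.IH[of b'] Suc.prems by simp
  qed
  finally show ?case .
qed (simp add: chi_one)

text \<open>Stand-ins for \<open>E^a Ft^b\<close> inside the two-generator subalgebras: for
  exponents below \<open>N\<close> the leading form is exactly that monomial.\<close>

definition "elmono l m a b = el 1 0 l [^]\<^bsub>U\<^esub> a \<otimes>\<^bsub>U\<^esub> el 0 1 m [^]\<^bsub>U\<^esub> b" for a b :: nat

lemma elmono_closed [simp]: "elmono l m a b \<in> carrier U" by (simp add: elmono_def)

lemma dle_elmono: "dle (a + b) (elmono l m a b)"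
  unfolding elmono_def by (rule dle_pow_mult[OF _ dle_pow]) simp

lemma top_elmono:
  "\<lbrakk>a < N; b < N; a' + b' = a + b\<rbrakk> \<Longrightarrow> \<chi> a' b' 0 (elmono l m a b) = (if a' = a then 1 else 0)"
proof (induction a arbitrary: a')
  case 0
  then show ?case using top_pow_Ft[of a' b' b m] by (simp add: elmono_def)
next
  case (Suc a)
  have e: "elmono l m (Suc a) b = el 1 0 l \<otimes>\<^bsub>U\<^esub> elmono l m a b"
    unfolding elmono_def U.nat_pow_Suc2[OF el_closed] by (simp add: U.m_assoc)
  have "\<chi> a' b' 0 (elmono l m (Suc a) b) = (if a' mod N = 0 then 0 else \<chi> (a' - 1) b' 0 (elmono l m a b))"
    unfolding e by (subst top_mult[OF _ dle_elmono]) (use Suc in auto)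
  also have "\<dots> = (if a' = Suc a then 1 else 0)"
  proof (cases a')
    case (Suc a'')
    have "\<chi> a'' b' 0 (elmono l m a b) = (if a'' = a then 1 else 0)"
      by (rule Suc.IH) (use Suc Suc.prems in auto)
    then show ?thesis using Suc Suc.prems by auto
  qed simp
  finally show ?case .
qed

section \<open>Classification\<close>

text \<open>A leading form is controlled by its coefficient at the pivot
  \<open>(pa d, pb d)\<close>: subtracting the multiple of the model element that matches this
  coefficient leaves a form without pivot, which vanishes by \<open>pivot\<close>.\<close>

lemma rcs_subset_pivot:
  assumes S: "rcs S" and B: "rcs B" and BS: "B \<subseteq> S" and Kp: "\<And>i. Kp i \<in> S \<Longrightarrow> Kp i \<in> B"
    and pa: "\<And>d. pa d + pb d = d"
    and pivot: "\<And>d p a b. p \<in> forms S (Suc d) \<Longrightarrow> \<not> p (pa (Suc d)) (pb (Suc d)) \<Longrightarrow> \<not> p a b"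
    and y: "\<And>d. \<exists>y\<in>B. dle d y \<and> (pa d < N \<longrightarrow> pb d < N \<longrightarrow> \<chi> (pa d) (pb d) 0 y = 1)"
  shows "S \<subseteq> B"
proof (rule rcs_subset[OF S B BS Kp])
  note DS = unital_subalgebraD[OF U.kalg_axioms rcs_sub[OF S]]
  note DB = unital_subalgebraD[OF U.kalg_axioms rcs_sub[OF B]]
  fix d z assume z: "z \<in> S" "hw (int (Suc d)) z" "dle (Suc d) z"
  let ?d = "Suc d"
  note zc = rcs_carrier[OF S z(1)]
  obtain y0 where y0: "y0 \<in> B" "dle ?d y0" "pa ?d < N \<longrightarrow> pb ?d < N \<longrightarrow> \<chi> (pa ?d) (pb ?d) 0 y0 = 1"
    using y[of ?d] by blast
  define y where "y = \<chi> (pa ?d) (pb ?d) 0 z \<odot>\<^bsub>U\<^esub> y0"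
  have y0c: "y0 \<in> carrier U" using rcs_carrier[OF B y0(1)] .
  have yB: "y \<in> B" using DB(7) y0(1) by (simp add: y_def)
  have chiy: "\<chi> a b i y = \<chi> (pa ?d) (pb ?d) 0 z * \<chi> a b i y0" for a b i
    unfolding y_def by (rule chi_smult[OF y0c])
  have dy: "dle ?d y" using y0(2) by (simp add: dle_def chiy)
  \<comment> \<open>If the pivot leaves the range below \<open>N\<close>, its coefficient in
    \<open>z\<close> is zero, hence \<open>y\<close> is zero as well.\<close>
  have piv: "\<chi> (pa ?d) (pb ?d) 0 y = \<chi> (pa ?d) (pb ?d) 0 z"
    using y0(3) chi_support[OF zc, of "pa ?d" "pb ?d" 0] by (cases "pa ?d < N \<and> pb ?d < N") (auto simp: chiy not_less)
  have yc: "y \<in> carrier U" using rcs_carrier[OF B yB] .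
  have "z \<ominus>\<^bsub>U\<^esub> y \<in> S" using DS(6) z(1) yB BS by blast
  \<comment> \<open>\<open>forms\<close> consists of supports of homogeneous elements, so the
    difference is first projected to weight \<open>Suc d\<close>.\<close>
  then obtain z' where z': "z' \<in> S" "\<And>a b i. \<chi> a b i z' = (if int N dvd (i + int a + int b - int ?d) then \<chi> a b i (z \<ominus>\<^bsub>U\<^esub> y) else 0)"
    using rcs_proj[OF S, of _ "int ?d"] by metis
  have chi0: "\<chi> a b 0 z' = \<chi> a b 0 z - \<chi> a b 0 y" if "a + b = ?d" for a b
  proof -
    have "0 + int a + int b - int ?d = 0" using that by linarith
    then show ?thesis using z'(2)[of a b 0] chi_diff[OF zc yc, of a b 0] by (metis dvd_0_right)
  qed
  have "hw (int ?d) z'" by (auto simp: hw_def z'(2))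
  moreover have "dle ?d z'" using z(3) dy by (auto simp: dle_def z'(2) chi_diff[OF zc yc])
  ultimately have p: "topsupp ?d z' \<in> forms S ?d" using z'(1) unfolding forms_def by blast
  have "\<not> topsupp ?d z' (pa ?d) (pb ?d)" using chi0[OF pa] piv by (simp add: topsupp_def)
  then have "\<not> topsupp ?d z' a b" for a b using pivot[OF p] by blast
  then have "\<chi> a b 0 y = \<chi> a b 0 z" if "a + b = ?d" for a b
    using chi0[OF that] that by (auto simp: topsupp_def)
  then show "\<exists>y\<in>B. dle ?d y \<and> (\<forall>a b. a + b = ?d \<longrightarrow> \<chi> a b 0 y = \<chi> a b 0 z)"
    using yB dy by blast
qed

text \<open>The exponents form a subgroup of the integers that contains \<open>N\<close>, and
  \<open>r\<close> is its least positive element.\<close>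

lemma K_exponents:
  assumes S: "rcs S"
  obtains r where "r > 0" "r dvd N" "\<And>i. Kp i \<in> S \<longleftrightarrow> int r dvd i"
proof -
  note sub = rcs_sub[OF S]
  note D = unital_subalgebraD[OF U.kalg_axioms sub]
  define r where "r = (LEAST n. n > 0 \<and> Kp (int n) \<in> S)"
  have N: "N > 0 \<and> Kp (int N) \<in> S" using N1 D(2) by (simp add: Kp_nat tl.k_pow)
  have r: "r > 0" "Kp (int r) \<in> S" unfolding r_def using LeastI[of "\<lambda>n. n > 0 \<and> Kp (int n) \<in> S", OF N] by auto
  have min: "\<not> (n > 0 \<and> Kp (int n) \<in> S)" if "n < r" for n
    using that unfolding r_def by (rule not_less_Least)
  have iff: "Kp i \<in> S \<longleftrightarrow> int r dvd i" for i
  proof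
    assume "int r dvd i"
    then obtain m where "i = int r * m" ..
    then show "Kp i \<in> S" using Kp_multiple[OF sub r(2), of m] by simp
  next
    assume i: "Kp i \<in> S"
    have "Kp (i + int r * (- (i div int r))) \<in> S"
      unfolding Kp_add[symmetric] by (rule D(5)[OF i Kp_multiple[OF sub r(2)]])
    moreover have "i + int r * (- (i div int r)) = i mod int r" by (simp add: minus_mult_div_eq_mod)
    moreover have m: "i mod int r = int (nat (i mod int r))" using r(1) by simp
    ultimately have "Kp (int (nat (i mod int r))) \<in> S" by metis
    moreover have "nat (i mod int r) < r" using r(1) by (simp add: nat_less_iff)
    ultimately have "nat (i mod int r) = 0"
      using min[of "nat (i mod int r)"] neq0_conv by metis
    then have "i mod int r = 0" using m by linarith
    then show "int r dvd i" by (simp add: dvd_eq_mod_eq_0)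
  qed
  have "r dvd N" using iff[of "int N"] N by simp
  then show ?thesis using that r(1) iff by blast
qed

lemma el_conj:
  "K [^]\<^bsub>U\<^esub> r \<otimes>\<^bsub>U\<^esub> el x y c = el ((q ^ 2) ^ r * x) (inverse (q ^ 2) ^ r * y) c \<otimes>\<^bsub>U\<^esub> K [^]\<^bsub>U\<^esub> r" for r :: nat
proof -
  have 1: "K [^]\<^bsub>U\<^esub> r \<otimes>\<^bsub>U\<^esub> E = (q ^ 2) ^ r \<odot>\<^bsub>U\<^esub> (E \<otimes>\<^bsub>U\<^esub> K [^]\<^bsub>U\<^esub> r)"
    using U.q_comm_pow[OF _ _ tl.ke, of r 1] by simp
  have 2: "K [^]\<^bsub>U\<^esub> r \<otimes>\<^bsub>U\<^esub> Ft = inverse (q ^ 2) ^ r \<odot>\<^bsub>U\<^esub> (Ft \<otimes>\<^bsub>U\<^esub> K [^]\<^bsub>U\<^esub> r)"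
    using U.q_comm_pow[OF _ _ tl.kg, of r 1] by simp
  have 3: "K [^]\<^bsub>U\<^esub> r \<otimes>\<^bsub>U\<^esub> K = K \<otimes>\<^bsub>U\<^esub> K [^]\<^bsub>U\<^esub> r" using U.nat_pow_Suc2[of K r] by simp
  show ?thesis by (simp add: el_def U.r_distr U.l_distr 1 2 3 mult.commute)
qed

text \<open>\<open>E\<close>, \<open>Ft\<close> and \<open>K\<close> are eigenvectors of conjugation
  by \<open>K^r\<close>, with eigenvalues \<open>p\<close>, \<open>p^(-1)\<close> and 1. These are
  distinct because \<open>N\<close> is odd and does not divide \<open>r\<close>, so combinations
  with conjugates isolate the components.\<close>

lemma el_separate:
  assumes S: "unital_subalgebra U S" and K: "Kp (int r) \<in> S" and r: "\<not> N dvd r" and L: "el x y c \<in> S"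
  shows "el x 0 0 \<in> S" "el 0 y 0 \<in> S" "el 0 0 c \<in> S"
proof -
  note D = unital_subalgebraD[OF U.kalg_axioms S]
  define p where "p = (q ^ 2) ^ r"
  have p0: "p \<noteq> 0" by (simp add: p_def)
  have p1: "p \<noteq> 1" using r q2_pow_iff by (simp add: p_def)
  have pi: "inverse (q ^ 2) ^ r = inverse p" by (simp add: p_def power_inverse)
  have p2: "p \<noteq> inverse p"
  proof
    assume "p = inverse p"
    then have "p * p = 1" using p0 by (metis right_inverse)
    then have "(q ^ 2) ^ (2 * r) = 1" by (simp add: p_def power_add[symmetric] mult_2)
    then have "N dvd 2 * r" using q2_pow_iff by blast
    moreover have "coprime N 2" using oddN by (simp add: coprime_commute)
    ultimately show False using r by (simp add: coprime_dvd_mult_right_iff)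
  qed
  have conj: "el (p * x) (inverse p * y) c \<in> S" if "el x y c \<in> S" for x y c
  proof -
    have "Kp (int r) \<otimes>\<^bsub>U\<^esub> el x y c \<otimes>\<^bsub>U\<^esub> Kp (- int r) \<in> S"
      using D(5) K that Kp_multiple[OF S K, of "- 1"] by simp
    also have "Kp (int r) \<otimes>\<^bsub>U\<^esub> el x y c \<otimes>\<^bsub>U\<^esub> Kp (- int r) = el (p * x) (inverse p * y) c \<otimes>\<^bsub>U\<^esub> (Kp (int r) \<otimes>\<^bsub>U\<^esub> Kp (- int r))"
      unfolding Kp_nat el_conj pi by (simp add: p_def U.m_assoc)
    finally show ?thesis by (simp add: Kp_add Kp_0)
  qed
  have comb: "el (a * x + b * x') (a * y + b * y') (a * c + b * c') \<in> S"
    if "el x y c \<in> S" "el x' y' c' \<in> S" for a b x y c x' y' c'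
    unfolding el_add[symmetric] el_smult[symmetric] using D(4,7) that by blast
  have cancel: "inverse t * (t * u) = u" if "t \<noteq> 0" for t u :: 'k
    using that by (simp add: mult.assoc[symmetric])
  have W: "el ((p - 1) * x) ((inverse p - 1) * y) 0 \<in> S"
    using comb[OF conj[OF L] L, of 1 "- 1"] by (simp add: algebra_simps)
  \<comment> \<open>Subtracting \<open>p^(-1)\<close> times \<open>W\<close> from its conjugate
    removes the \<open>Ft\<close> component and multiplies \<open>x\<close> by a second eigenvalue
    difference.\<close>
  have "el ((p - inverse p) * (p - 1) * x) 0 0 \<in> S"
    using comb[OF conj[OF W] W, of 1 "- inverse p"] by (simp add: algebra_simps)
  then have "inverse ((p - inverse p) * (p - 1)) \<odot>\<^bsub>U\<^esub> el ((p - inverse p) * (p - 1) * x) 0 0 \<in> S"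
    by (rule D(7))
  moreover have "(p - inverse p) * (p - 1) \<noteq> 0" using p1 p2 by simp
  ultimately show X: "el x 0 0 \<in> S"
    by (simp only: el_smult cancel mult_zero_right not_False_eq_True)
  have Y': "el 0 y c \<in> S" using comb[OF L X, of 1 "- 1"] by simp
  have "el 0 ((inverse p - 1) * y) 0 \<in> S"
    using comb[OF conj[OF Y'] Y', of 1 "- 1"] by (simp add: algebra_simps)
  then have "inverse (inverse p - 1) \<odot>\<^bsub>U\<^esub> el 0 ((inverse p - 1) * y) 0 \<in> S" by (rule D(7))
  moreover have "inverse p - 1 \<noteq> 0" using p1 p0 by (simp add: field_simps)
  ultimately show Y: "el 0 y 0 \<in> S"
    by (simp only: el_smult cancel mult_zero_right not_False_eq_True)
  show "el 0 0 c \<in> S" using comb[OF Y' Y, of 1 "- 1"] by simp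
qed

abbreviation "gen \<equiv> subalgebra_generated U"

text \<open>\<open>K\<close> is the power of \<open>K^2\<close> with exponent
  \<open>(N + 1) / 2\<close>, an integer since \<open>N\<close> is odd.\<close>

lemma K_of_square:
  assumes S: "unital_subalgebra U S" and KK: "K \<otimes>\<^bsub>U\<^esub> K \<in> S"
  shows "K \<in> S"
proof -
  have "Kp 2 \<in> S" using KK Kp_nat[of 2] by (simp add: numeral_2_eq_2)
  then have "Kp (2 * int ((N + 1) div 2)) \<in> S" by (rule Kp_multiple[OF S])
  moreover have "2 * int ((N + 1) div 2) = int (N + 1)" using oddN by presburger
  moreover have "Kp (int (N + 1)) = K" using Kp_nat[of "N + 1"] by (simp add: tl.k_pow)
  ultimately show ?thesis by simp
qed

lemma two_generator_relation:
  "el 0 1 m \<otimes>\<^bsub>U\<^esub> el 1 0 l = q ^ 2 \<odot>\<^bsub>U\<^esub> (el 1 0 l \<otimes>\<^bsub>U\<^esub> el 0 1 m) \<oplus>\<^bsub>U\<^esub> \<one>\<^bsub>U\<^esub>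
     \<oplus>\<^bsub>U\<^esub> ((1 - q ^ 2) * l * m - 1) \<odot>\<^bsub>U\<^esub> (K \<otimes>\<^bsub>U\<^esub> K)"
proof -
  let ?KK = "K \<otimes>\<^bsub>U\<^esub> K" and ?EF = "E \<otimes>\<^bsub>U\<^esub> Ft" and ?EK = "E \<otimes>\<^bsub>U\<^esub> K" and ?KF = "K \<otimes>\<^bsub>U\<^esub> Ft"
  have "el 0 1 m \<otimes>\<^bsub>U\<^esub> el 1 0 l = (q ^ 2 \<odot>\<^bsub>U\<^esub> ?EF \<oplus>\<^bsub>U\<^esub> \<one>\<^bsub>U\<^esub> \<oplus>\<^bsub>U\<^esub> (l * q ^ 2) \<odot>\<^bsub>U\<^esub> ?KF \<oplus>\<^bsub>U\<^esub> (m * q ^ 2) \<odot>\<^bsub>U\<^esub> ?EK)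
      \<oplus>\<^bsub>U\<^esub> ((- 1) \<odot>\<^bsub>U\<^esub> ?KK \<oplus>\<^bsub>U\<^esub> (m * l) \<odot>\<^bsub>U\<^esub> ?KK)"
    by (simp add: el_def U.l_distr U.r_distr tl.ge tl.gk tl.ke U.smult_add_r U.a_ac mult.commute)
  \<comment> \<open>The \<open>K^2\<close> term is split so that one part completes the product
    \<open>q^2 (E + l K) (Ft + m K)\<close>.\<close>
  also have "(- 1) \<odot>\<^bsub>U\<^esub> ?KK \<oplus>\<^bsub>U\<^esub> (m * l) \<odot>\<^bsub>U\<^esub> ?KK = (q ^ 2 * l * m) \<odot>\<^bsub>U\<^esub> ?KK \<oplus>\<^bsub>U\<^esub> ((1 - q ^ 2) * l * m - 1) \<odot>\<^bsub>U\<^esub> ?KK"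
    by (subst (1 2) U.smult_add_l[symmetric]) (simp_all add: algebra_simps)
  also have "(q ^ 2 \<odot>\<^bsub>U\<^esub> ?EF \<oplus>\<^bsub>U\<^esub> \<one>\<^bsub>U\<^esub> \<oplus>\<^bsub>U\<^esub> (l * q ^ 2) \<odot>\<^bsub>U\<^esub> ?KF \<oplus>\<^bsub>U\<^esub> (m * q ^ 2) \<odot>\<^bsub>U\<^esub> ?EK)
      \<oplus>\<^bsub>U\<^esub> ((q ^ 2 * l * m) \<odot>\<^bsub>U\<^esub> ?KK \<oplus>\<^bsub>U\<^esub> ((1 - q ^ 2) * l * m - 1) \<odot>\<^bsub>U\<^esub> ?KK)
     = q ^ 2 \<odot>\<^bsub>U\<^esub> (el 1 0 l \<otimes>\<^bsub>U\<^esub> el 0 1 m) \<oplus>\<^bsub>U\<^esub> \<one>\<^bsub>U\<^esub>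
     \<oplus>\<^bsub>U\<^esub> ((1 - q ^ 2) * l * m - 1) \<odot>\<^bsub>U\<^esub> (K \<otimes>\<^bsub>U\<^esub> K)"
    by (simp add: el_def U.l_distr U.r_distr U.smult_add_r U.a_ac mult.assoc mult.commute mult.left_commute)
  finally show ?thesis .
qed

lemma two_generators_full:
  assumes S: "unital_subalgebra U S" and "el 1 0 l \<in> S" "el 0 1 m \<in> S" and "(1 - q ^ 2) * l * m \<noteq> 1"
  shows "S = carrier U"
proof -
  note D = unital_subalgebraD[OF U.kalg_axioms S]
  let ?c = "(1 - q ^ 2) * l * m - 1"
  let ?X = "el 1 0 l" and ?Y = "el 0 1 m"
  have e: "?Y \<otimes>\<^bsub>U\<^esub> ?X = q ^ 2 \<odot>\<^bsub>U\<^esub> (?X \<otimes>\<^bsub>U\<^esub> ?Y) \<oplus>\<^bsub>U\<^esub> \<one>\<^bsub>U\<^esub> \<oplus>\<^bsub>U\<^esub> ?c \<odot>\<^bsub>U\<^esub> (K \<otimes>\<^bsub>U\<^esub> K)"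
    by (rule two_generator_relation)
  have "?Y \<otimes>\<^bsub>U\<^esub> ?X \<ominus>\<^bsub>U\<^esub> (q ^ 2 \<odot>\<^bsub>U\<^esub> (?X \<otimes>\<^bsub>U\<^esub> ?Y) \<oplus>\<^bsub>U\<^esub> \<one>\<^bsub>U\<^esub>) \<in> S"
    by (intro D(2,4-7) assms)
  moreover have "u \<oplus>\<^bsub>U\<^esub> v \<ominus>\<^bsub>U\<^esub> u = v" if "u \<in> carrier U" "v \<in> carrier U" for u v
    using that by (simp add: a_minus_def U.a_assoc U.a_comm[of u v] U.r_neg)
  ultimately have "?c \<odot>\<^bsub>U\<^esub> (K \<otimes>\<^bsub>U\<^esub> K) \<in> S" unfolding e by simp
  then have "inverse ?c \<odot>\<^bsub>U\<^esub> (?c \<odot>\<^bsub>U\<^esub> (K \<otimes>\<^bsub>U\<^esub> K)) \<in> S" by (rule D(7))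
  moreover have "inverse ?c \<odot>\<^bsub>U\<^esub> (?c \<odot>\<^bsub>U\<^esub> (K \<otimes>\<^bsub>U\<^esub> K)) = K \<otimes>\<^bsub>U\<^esub> K"
    using assms(4) by (subst U.smult_smult) simp_all
  ultimately have K: "K \<in> S" using K_of_square[OF S] by metis
  then have K1: "el 0 0 1 \<in> S" by (simp only: el_gens)
  have "el 1 0 l \<oplus>\<^bsub>U\<^esub> (- l) \<odot>\<^bsub>U\<^esub> el 0 0 1 \<in> S" "el 0 1 m \<oplus>\<^bsub>U\<^esub> (- m) \<odot>\<^bsub>U\<^esub> el 0 0 1 \<in> S"
    by (intro D(4,7) assms K1)+
  then have "el 1 0 0 \<in> S" "el 0 1 0 \<in> S" unfolding el_add el_smult by simp_all
  then have "E \<in> S" "Ft \<in> S" by (simp_all only: el_gens)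
  then show ?thesis using U_generated'[OF S K] by simp
qed

lemma gen_sub: "G \<subseteq> carrier U \<Longrightarrow> unital_subalgebra U (gen G)"
  by (rule unital_subalgebra_generated[OF U.kalg_axioms])

lemma Kp_in_gen:
  assumes "G \<subseteq> carrier U" "K [^]\<^bsub>U\<^esub> r \<in> gen G" "int r dvd i"
  shows "Kp i \<in> gen G"
proof -
  obtain m where "i = int r * m" using assms(3) ..
  then show ?thesis using Kp_multiple[OF gen_sub[OF assms(1)], of "int r" m] assms(2) by (simp add: Kp_nat)
qed

lemma gen_one: "G \<subseteq> carrier U \<Longrightarrow> K [^]\<^bsub>U\<^esub> N \<in> gen G"
  using unital_subalgebraD(2)[OF U.kalg_axioms gen_sub] by (simp add: tl.k_pow)

text \<open>By \<open>no\<close>, a form of degree one with vanishing \<open>E\<close> coefficient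
  is zero, which is the pivot condition; the powers of \<open>el 1 y c\<close> are the model
  elements in all degrees.\<close>

lemma classify_pivot_E:
  assumes S: "rcs S" and r: "\<And>i. Kp i \<in> S \<Longrightarrow> int r dvd i"
    and no: "\<And>y c. el 0 y c \<in> S \<Longrightarrow> y = 0" and G: "G \<subseteq> S" "rcs (gen G)" "K [^]\<^bsub>U\<^esub> r \<in> gen G" "el 1 y c \<in> gen G"
  shows "S = gen G"
proof
  have Gc: "G \<subseteq> carrier U" using G(1) rcs_carrier[OF S] by blast
  show sub: "gen G \<subseteq> S" by (rule subalgebra_generated_minimal[OF rcs_sub[OF S] G(1)])
  show "S \<subseteq> gen G"
  proof (rule rcs_subset_pivot[OF S G(2) sub, where pa = "\<lambda>d. d" and pb = "\<lambda>d. 0"])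
    show "Kp i \<in> gen G" if "Kp i \<in> S" for i using Kp_in_gen[OF Gc G(3) r[OF that]] .
    show "\<not> p a b" if p: "p \<in> forms S (Suc d)" "\<not> p (Suc d) 0" for d p a b
    proof (rule pivot_E[OF S _ p])
      fix p assume "p \<in> forms S 1" "\<not> p 1 0"
      then show "\<not> p 0 1" using forms_one[OF S, of p] no by metis
    qed
    show "\<exists>y\<in>gen G. dle d y \<and> (d < N \<longrightarrow> 0 < N \<longrightarrow> \<chi> d 0 0 y = 1)" for d
      using unital_subalgebraD(8)[OF U.kalg_axioms gen_sub[OF Gc] G(4), of d] dle_pow top_pow_E by blast
  qed simp
qed

lemma classify_pivot_Ft:
  assumes S: "rcs S" and r: "\<And>i. Kp i \<in> S \<Longrightarrow> int r dvd i"
    and no: "\<And>x y c. el x y c \<in> S \<Longrightarrow> x = 0" and G: "G \<subseteq> S" "rcs (gen G)" "K [^]\<^bsub>U\<^esub> r \<in> gen G" "el 0 1 c \<in> gen G"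
  shows "S = gen G"
proof
  have Gc: "G \<subseteq> carrier U" using G(1) rcs_carrier[OF S] by blast
  show sub: "gen G \<subseteq> S" by (rule subalgebra_generated_minimal[OF rcs_sub[OF S] G(1)])
  show "S \<subseteq> gen G"
  proof (rule rcs_subset_pivot[OF S G(2) sub, where pa = "\<lambda>d. 0" and pb = "\<lambda>d. d"])
    show "Kp i \<in> gen G" if "Kp i \<in> S" for i using Kp_in_gen[OF Gc G(3) r[OF that]] .
    show "\<not> p a b" if p: "p \<in> forms S (Suc d)" "\<not> p 0 (Suc d)" for d p a b
    proof (rule pivot_Ft[OF S _ p])
      fix p assume "p \<in> forms S 1"
      then show "\<not> p 1 0" using forms_one[OF S, of p] no by metis
    qed
    show "\<exists>y\<in>gen G. dle d y \<and> (0 < N \<longrightarrow> d < N \<longrightarrow> \<chi> 0 d 0 y = 1)" for d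
      using unital_subalgebraD(8)[OF U.kalg_axioms gen_sub[OF Gc] G(4), of d] dle_pow[of d 0 1 c] top_pow_Ft[of 0 d d c] by auto
  qed simp
qed

text \<open>A nonzero form of degree at least two has a nonzero lowering, so it would lead down to a
  nonzero form of degree one.\<close>

lemma forms_empty:
  assumes S: "rcs S" and no: "\<And>x y c. el x y c \<in> S \<Longrightarrow> x = 0 \<and> y = 0"
  shows "p \<in> forms S (Suc d) \<Longrightarrow> \<not> p a b"
proof (induction d arbitrary: p a b)
  case 0
  then have "\<not> p 1 0" "\<not> p 0 1" using forms_one[OF S, of p] no by (metis One_nat_def)+
  moreover have "a + b = 1" if "p a b" using forms_supp[OF 0 that] by simp
  then have "a = 1 \<and> b = 0 \<or> a = 0 \<and> b = 1" if "p a b" using that by fastforce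
  ultimately show ?case by blast
next
  case (Suc d)
  have "a \<noteq> 0 \<or> b \<noteq> 0" if "p a b" using forms_supp[OF Suc.prems that] by auto
  moreover have "\<not> p (Suc a) b" "\<not> p a (Suc b)" for a b
    using Suc.IH[OF forms_lower(1)[OF S Suc.prems]] Suc.IH[OF forms_lower(2)[OF S Suc.prems]] by simp_all
  ultimately show ?case by (metis not0_implies_Suc)
qed

lemma classify_none:
  assumes S: "rcs S" and r: "\<And>i. Kp i \<in> S \<Longrightarrow> int r dvd i"
    and no: "\<And>x y c. el x y c \<in> S \<Longrightarrow> x = 0 \<and> y = 0" and G: "K [^]\<^bsub>U\<^esub> r \<in> S" "rcs (gen {K [^]\<^bsub>U\<^esub> r})"
  shows "S = gen {K [^]\<^bsub>U\<^esub> r}"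
proof
  let ?G = "{K [^]\<^bsub>U\<^esub> r}"
  show sub: "gen ?G \<subseteq> S" by (rule subalgebra_generated_minimal[OF rcs_sub[OF S]]) (use G in simp)
  show "S \<subseteq> gen ?G"
  proof (rule rcs_subset[OF S G(2) sub])
    show "Kp i \<in> gen ?G" if "Kp i \<in> S" for i
      by (rule Kp_in_gen[OF _ _ r[OF that]]) (use subalgebra_generated_incl[of ?G U] in auto)
    fix d z assume z: "z \<in> S" "hw (int (Suc d)) z" "dle (Suc d) z"
    then have "topsupp (Suc d) z \<in> forms S (Suc d)" by (auto simp: forms_def)
    then have "\<chi> a b 0 z = 0" if "a + b = Suc d" for a b
      using forms_empty[OF S, of "topsupp (Suc d) z" d a b] no that by (auto simp: topsupp_def)
    moreover have "\<zero>\<^bsub>U\<^esub> \<in> gen ?G" using unital_subalgebraD(3)[OF U.kalg_axioms rcs_sub[OF G(2)]] .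
    moreover have "\<chi> a b i \<zero>\<^bsub>U\<^esub> = 0" for a b i by (rule functional_zero[OF U.kalg_axioms chi_functional])
    ultimately show "\<exists>y\<in>gen ?G. dle (Suc d) y \<and> (\<forall>a b. a + b = Suc d \<longrightarrow> \<chi> a b 0 y = \<chi> a b 0 z)"
      by (intro bexI[of _ "\<zero>\<^bsub>U\<^esub>"]) (auto simp: dle_def)
  qed
qed

text \<open>Every possible leading form is a combination of the leading forms of the
  \<open>elmono\<close>, so the reduction is direct and only the powers of \<open>K\<close> have to
  be controlled.\<close>

lemma classify_two_generators:
  assumes S: "rcs S" and r: "\<And>i. Kp i \<in> S \<Longrightarrow> int N dvd i"
    and XY: "el 1 0 l \<in> S" "el 0 1 m \<in> S" and G: "rcs (gen {el 1 0 l, el 0 1 m})"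
  shows "S = gen {el 1 0 l, el 0 1 m}"
proof
  let ?G = "{el 1 0 l, el 0 1 m}"
  have Gc: "?G \<subseteq> carrier U" by simp
  show sub: "gen ?G \<subseteq> S" by (rule subalgebra_generated_minimal[OF rcs_sub[OF S]]) (use XY in simp)
  show "S \<subseteq> gen ?G"
  proof (rule rcs_subset[OF S G sub])
    show "Kp i \<in> gen ?G" if "Kp i \<in> S" for i
      by (rule Kp_in_gen[OF Gc gen_one[OF Gc] r[OF that]])
    fix d z assume z: "z \<in> S" "hw (int (Suc d)) z" "dle (Suc d) z"
    note zc = rcs_carrier[OF S z(1)]
    note D = unital_subalgebraD[OF U.kalg_axioms rcs_sub[OF G]]
    let ?d = "Suc d"
    let ?t = "\<lambda>a. \<chi> a (?d - a) 0 z \<odot>\<^bsub>U\<^esub> elmono l m a (?d - a)"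
    define y where "y = (\<Oplus>\<^bsub>U\<^esub>a\<in>{..?d}. ?t a)"
    have "elmono l m a b \<in> gen ?G" for a b
      unfolding elmono_def using subalgebra_generated_incl[of ?G U] by (intro D(5,8)) auto
    then have yB: "y \<in> gen ?G" unfolding y_def by (intro D(9) D(7))
    have chiy: "\<chi> a b i y = (\<Sum>a'\<le>?d. \<chi> a' (?d - a') 0 z * \<chi> a b i (elmono l m a' (?d - a')))" for a b i
      unfolding y_def by (subst functional_finsum[OF U.kalg_axioms chi_functional]) (auto simp: chi_smult)
    have "dle ?d y"
      unfolding dle_def chiy using dle_elmono[of _ "?d - _" l m]
      by (intro allI impI sum.neutral ballI) (auto simp: dle_def)
    moreover have "\<chi> a b 0 y = \<chi> a b 0 z" if ab: "a + b = ?d" for a b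
    proof -
      have "\<chi> a b 0 y = (\<Sum>a'\<le>?d. if a' = a then \<chi> a b 0 z else 0)"
        unfolding chiy
      proof (intro sum.cong refl)
        fix a' assume a': "a' \<in> {..?d}"
        show "\<chi> a' (?d - a') 0 z * \<chi> a b 0 (elmono l m a' (?d - a')) = (if a' = a then \<chi> a b 0 z else 0)"
        proof (cases "a' < N \<and> ?d - a' < N")
          case True
          then have "\<chi> a b 0 (elmono l m a' (?d - a')) = (if a = a' then 1 else 0)"
            by (intro top_elmono) (use ab a' in auto)
          moreover have "?d - a = b" using ab by simp
          ultimately show ?thesis by (cases "a' = a") simp_all
        next
          \<comment> \<open>Outside the range below \<open>N\<close> the coordinate of
            \<open>z\<close> is zero, so the leading form of this \<open>elmono\<close> does not
            matter.\<close>
          case False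
          then have "\<chi> a' (?d - a') 0 z = 0" using chi_support[OF zc] by (auto simp: not_less)
          moreover have "?d - a = b" using ab by simp
          ultimately show ?thesis by (cases "a' = a") simp_all
        qed
      qed
      also have "\<dots> = \<chi> a b 0 z" using ab by (simp add: sum.delta)
      finally show ?thesis .
    qed
    ultimately show "\<exists>y\<in>gen ?G. dle ?d y \<and> (\<forall>a b. a + b = ?d \<longrightarrow> \<chi> a b 0 y = \<chi> a b 0 z)"
      using yB by blast
  qed
qed

section \<open>The listed subalgebras are right coideals, and there are no others\<close>

definition "degree_one g \<longleftrightarrow> (\<exists>r::nat. g = K [^]\<^bsub>U\<^esub> r) \<or> (\<exists>x y c. g = el x y c)"

lemma degree_one_gens: "degree_one (K [^]\<^bsub>U\<^esub> (r::nat))" "degree_one (el x y c)" "degree_one E" "degree_one Ft" "degree_one K"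
proof -
  show e: "degree_one (el x y c)" for x y c unfolding degree_one_def by blast
  show "degree_one E" "degree_one Ft" "degree_one K" unfolding el_gens[symmetric] by (rule e)+
  show "degree_one (K [^]\<^bsub>U\<^esub> r)" for r :: nat unfolding degree_one_def by blast
qed

lemma rcs_generated_degree_one':
  assumes "\<forall>g\<in>G. degree_one g"
  shows "rcs (gen G)"
proof (rule rcs_generated_degree_one)
  fix g assume "g \<in> G"
  then have "degree_one g" using assms by blast
  then show "(\<exists>r::nat. g = K [^]\<^bsub>U\<^esub> r) \<or> (\<exists>x y z. g = x \<odot>\<^bsub>U\<^esub> E \<oplus>\<^bsub>U\<^esub> y \<odot>\<^bsub>U\<^esub> Ft \<oplus>\<^bsub>U\<^esub> z \<odot>\<^bsub>U\<^esub> K)"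
    unfolding degree_one_def el_def .
qed

lemma rcs_gens:
  "rcs (gen {K [^]\<^bsub>U\<^esub> (r::nat)})" "rcs (gen {K [^]\<^bsub>U\<^esub> (r::nat), E})" "rcs (gen {K [^]\<^bsub>U\<^esub> (r::nat), Ft})"
  "rcs (gen {el x y c})" "rcs (gen {el x y c, el x' y' c'})" "rcs (carrier U)"
proof -
  have "K \<in> gen {K, E, Ft}" "E \<in> gen {K, E, Ft}" "Ft \<in> gen {K, E, Ft}"
    by (rule subsetD[OF subalgebra_generated_incl], simp)+
  moreover have "{K, E, Ft} \<subseteq> carrier U" by simp
  ultimately have "gen {K, E, Ft} = carrier U" by (intro U_generated' gen_sub)
  moreover have "rcs (gen {K, E, Ft})"
    by (rule rcs_generated_degree_one') (simp add: degree_one_gens)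
  ultimately show "rcs (carrier U)" by simp
qed (rule rcs_generated_degree_one', simp add: degree_one_gens)+

text \<open>The cases follow the \<open>E\<close> and \<open>Ft\<close> parts of the degree-one
  elements of \<open>S\<close>: a plane, a line with nonzero \<open>E\<close> part, the line of
  \<open>Ft\<close>, or zero. Within each case the exponents of \<open>K\<close> and the constants
  decide the family.\<close>

lemma rcs_classification:
  assumes S: "rcs S"
  shows "S = carrier U \<or> (\<exists>r::nat. r > 0 \<and> r dvd N \<and> S = gen {K [^]\<^bsub>U\<^esub> r})
    \<or> (\<exists>r::nat. r > 0 \<and> r dvd N \<and> S = gen {K [^]\<^bsub>U\<^esub> r, E}) \<or> (\<exists>r::nat. r > 0 \<and> r dvd N \<and> S = gen {K [^]\<^bsub>U\<^esub> r, Ft})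
    \<or> (\<exists>\<alpha> \<beta>. (\<alpha>, \<beta>) \<noteq> (0, 0) \<and> S = gen {el 1 \<alpha> \<beta>}) \<or> (\<exists>\<beta>. \<beta> \<noteq> 0 \<and> S = gen {el 0 1 \<beta>})
    \<or> (\<exists>l m. (1 - q ^ 2) * l * m = 1 \<and> S = gen {el 1 0 l, el 0 1 m})"
proof -
  note sub = rcs_sub[OF S]
  note D = unital_subalgebraD[OF U.kalg_axioms sub]
  obtain r where r: "r > 0" "r dvd N" "\<And>i. Kp i \<in> S \<longleftrightarrow> int r dvd i" using K_exponents[OF S] by blast
  have rK: "Kp (int r) \<in> S" "K [^]\<^bsub>U\<^esub> r \<in> S" using r(3)[of "int r"] by (simp_all add: Kp_nat)
  have rd: "int r dvd i" if "Kp i \<in> S" for i using r(3) that by blast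
  have proper: "\<not> N dvd r" if "r \<noteq> N" using that r by (meson dvd_antisym)
  have comb: "el (a * x + b * x') (a * y + b * y') (a * c + b * c') \<in> S"
    if "el x y c \<in> S" "el x' y' c' \<in> S" for a b x y c x' y' c'
    unfolding el_add[symmetric] el_smult[symmetric] using D(4,7) that by blast
  have incl: "g \<in> gen G" if "g \<in> G" for g G
    using that by (rule subsetD[OF subalgebra_generated_incl])
  consider (both) x y c y' c' where "x \<noteq> 0" "el x y c \<in> S" "y' \<noteq> 0" "el 0 y' c' \<in> S"
    | (E) x y c where "x \<noteq> 0" "el x y c \<in> S" "\<And>y c. el 0 y c \<in> S \<Longrightarrow> y = 0"
    | (Ft) y c where "y \<noteq> 0" "el 0 y c \<in> S" "\<And>x y c. el x y c \<in> S \<Longrightarrow> x = 0"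
    | (none) "\<And>x y c. el x y c \<in> S \<Longrightarrow> x = 0 \<and> y = 0"
  proof (cases "\<exists>x y c. x \<noteq> 0 \<and> el x y c \<in> S")
    case True
    then obtain x y c where x: "x \<noteq> 0" "el x y c \<in> S" by blast
    show thesis
    proof (cases "\<exists>y c. y \<noteq> 0 \<and> el 0 y c \<in> S")
      case True
      then show thesis using both x by blast
    next
      case False
      then show thesis using E[OF x] by blast
    qed
  next
    case no: False
    then have x0: "x = 0" if "el x y c \<in> S" for x y c using that by blast
    show thesis
    proof (cases "\<exists>y c. y \<noteq> 0 \<and> el 0 y c \<in> S")
      case True
      then show thesis using Ft x0 by blast
    next
      case False
      then show thesis using none x0 by metis
    qed
  qed
  then show ?thesis
  proof cases
    case both
    \<comment> \<open>Gaussian elimination in the \<open>E\<close> and \<open>Ft\<close>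
      coefficients normalises the two elements to \<open>Ft + m K\<close> and
      \<open>E + l K\<close>.\<close>
    define m where "m = c' / y'"
    have Y: "el 0 1 m \<in> S" using comb[OF both(4,4), of "1 / y'" 0] both(3) by (simp add: m_def)
    define l where "l = (c - y * m) / x"
    have X: "el 1 0 l \<in> S"
      using comb[OF both(2) Y, of "1 / x" "- y / x"] both(1) by (simp add: l_def diff_divide_distrib)
    show ?thesis
    proof (cases "r = N \<and> (1 - q ^ 2) * l * m = 1")
      case True
      then have "S = gen {el 1 0 l, el 0 1 m}"
        by (intro classify_two_generators[OF S _ X Y rcs_gens(5)]) (use rd in blast)
      then show ?thesis using True by blast
    next
      case False
      \<comment> \<open>Either the two elements already generate everything, or a nontrivial power
        of \<open>K\<close> splits off \<open>E\<close> and \<open>Ft\<close>, and the same lemma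
        applies to them with both constants equal to 0.\<close>
      have "S = carrier U"
      proof (cases "(1 - q ^ 2) * l * m = 1")
        case True
        then have "\<not> N dvd r" using False proper by blast
        then have "el 1 0 0 \<in> S" "el 0 1 0 \<in> S"
          using el_separate(1)[OF sub rK(1) _ X] el_separate(2)[OF sub rK(1) _ Y] by blast+
        then show ?thesis by (rule two_generators_full[OF sub]) simp
      qed (rule two_generators_full[OF sub X Y])
      then show ?thesis by blast
    qed
  next
    case E
    define \<alpha> where "\<alpha> = y / x"
    define \<beta> where "\<beta> = c / x"
    have L: "el 1 \<alpha> \<beta> \<in> S"
      using comb[OF E(2,2), of "1 / x" 0] E(1) by (simp add: \<alpha>_def \<beta>_def)
    show ?thesis
    proof (cases "r = N \<and> (\<alpha>, \<beta>) \<noteq> (0, 0)")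
      case True
      have "S = gen {el 1 \<alpha> \<beta>}"
        by (rule classify_pivot_E[OF S rd E(3) _ rcs_gens(4) _ incl]) (use L True gen_one in auto)
      then show ?thesis using True by blast
    next
      case False
      \<comment> \<open>Either \<open>r = N\<close> and both constants vanish, so the element is
        \<open>E\<close> itself, or a nontrivial power of \<open>K\<close> splits off
        \<open>E\<close>.\<close>
      have ES: "E \<in> S"
      proof (cases "r = N")
        case True
        then show ?thesis using False L by (simp add: el_gens)
      next
        case False
        then show ?thesis using el_separate(1)[OF sub rK(1) proper L] by (simp add: el_gens)
      qed
      have "S = gen {K [^]\<^bsub>U\<^esub> r, E}"
        by (rule classify_pivot_E[OF S rd E(3) _ rcs_gens(2) incl, where y = 0 and c = 0])
          (use ES rK incl in \<open>auto simp: el_gens\<close>)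
      then show ?thesis using r(1,2) by blast
    qed
  next
    case Ft
    define \<beta> where "\<beta> = c / y"
    have L: "el 0 1 \<beta> \<in> S"
      using comb[OF Ft(2,2), of "1 / y" 0] Ft(1) by (simp add: \<beta>_def)
    show ?thesis
    proof (cases "r = N \<and> \<beta> \<noteq> 0")
      case True
      have "S = gen {el 0 1 \<beta>}"
        by (rule classify_pivot_Ft[OF S rd Ft(3) _ rcs_gens(4) _ incl]) (use L True gen_one in auto)
      then show ?thesis using True by blast
    next
      case False
      have FS: "Ft \<in> S"
      proof (cases "r = N")
        case True
        then show ?thesis using False L by (simp add: el_gens)
      next
        case False
        then show ?thesis using el_separate(2)[OF sub rK(1) proper L] by (simp add: el_gens)
      qed
      have "S = gen {K [^]\<^bsub>U\<^esub> r, Ft}"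
        by (rule classify_pivot_Ft[OF S rd Ft(3) _ rcs_gens(3) incl, where c = 0])
          (use FS rK incl in \<open>auto simp: el_gens\<close>)
      then show ?thesis using r(1,2) by blast
    qed
  next
    case none
    have "S = gen {K [^]\<^bsub>U\<^esub> r}" by (rule classify_none[OF S rd none rK(2) rcs_gens(1)])
    then show ?thesis using r(1,2) by blast
  qed
qed

end

theorem theorem4p1:
  fixes q :: "'k::{alg_closed_field, field_char_0}" and N :: nat
  assumes "N > 1" and "odd N" and "primitive_root_of_unity N q"
  shows "{S. right_coideal_subalgebra (Ubar q N) (Ubar_comult q N) S} =
     (let U = Ubar q N; K = Ubar_K q N; E = Ubar_E q N; Ft = Ubar_Ftilde q N in
        {carrier U}
      \<union> {subalgebra_generated U {K [^]\<^bsub>U\<^esub> r} | r :: nat. r > 0 \<and> r dvd N}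
      \<union> {subalgebra_generated U {K [^]\<^bsub>U\<^esub> r, E} | r :: nat. r > 0 \<and> r dvd N}
      \<union> {subalgebra_generated U {K [^]\<^bsub>U\<^esub> r, Ft} | r :: nat. r > 0 \<and> r dvd N}
      \<union> {subalgebra_generated U {E \<oplus>\<^bsub>U\<^esub> \<alpha> \<odot>\<^bsub>U\<^esub> Ft \<oplus>\<^bsub>U\<^esub> \<beta> \<odot>\<^bsub>U\<^esub> K} | \<alpha> \<beta>. (\<alpha>, \<beta>) \<noteq> (0, 0)}
      \<union> {subalgebra_generated U {Ft \<oplus>\<^bsub>U\<^esub> \<beta> \<odot>\<^bsub>U\<^esub> K} | \<beta>. \<beta> \<noteq> 0}
      \<union> {subalgebra_generated U {E \<oplus>\<^bsub>U\<^esub> lam \<odot>\<^bsub>U\<^esub> K, Ft \<oplus>\<^bsub>U\<^esub> mu \<odot>\<^bsub>U\<^esub> K} | lam mu.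
            (1 - q ^ 2) * lam * mu = 1})"
proof -
  interpret odd_root0 q N by (intro odd_root0.intro odd_root.intro assms)
  show ?thesis
    \<comment> \<open>The generators of degree one in the list are rewritten with \<open>el\<close>,
      the form used in the classification.\<close>
    unfolding Let_def el_forms
  proof (rule equalityI; rule subsetI)
    fix S assume "S \<in> {S. rcs S}"
    then show "S \<in> {carrier U} \<union> {gen {K [^]\<^bsub>U\<^esub> r} | r :: nat. r > 0 \<and> r dvd N}
      \<union> {gen {K [^]\<^bsub>U\<^esub> r, E} | r :: nat. r > 0 \<and> r dvd N}
      \<union> {gen {K [^]\<^bsub>U\<^esub> r, Ft} | r :: nat. r > 0 \<and> r dvd N}
      \<union> {gen {el 1 \<alpha> \<beta>} | \<alpha> \<beta>. (\<alpha>, \<beta>) \<noteq> (0, 0)}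
      \<union> {gen {el 0 1 \<beta>} | \<beta>. \<beta> \<noteq> 0}
      \<union> {gen {el 1 0 lam, el 0 1 mu} | lam mu. (1 - q ^ 2) * lam * mu = 1}"
      using rcs_classification[of S] unfolding mem_Collect_eq Un_iff singleton_iff by blast
  next
    fix S assume "S \<in> {carrier U} \<union> {gen {K [^]\<^bsub>U\<^esub> r} | r :: nat. r > 0 \<and> r dvd N}
      \<union> {gen {K [^]\<^bsub>U\<^esub> r, E} | r :: nat. r > 0 \<and> r dvd N}
      \<union> {gen {K [^]\<^bsub>U\<^esub> r, Ft} | r :: nat. r > 0 \<and> r dvd N}
      \<union> {gen {el 1 \<alpha> \<beta>} | \<alpha> \<beta>. (\<alpha>, \<beta>) \<noteq> (0, 0)}
      \<union> {gen {el 0 1 \<beta>} | \<beta>. \<beta> \<noteq> 0}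
      \<union> {gen {el 1 0 lam, el 0 1 mu} | lam mu. (1 - q ^ 2) * lam * mu = 1}"
    then show "S \<in> {S. rcs S}" using rcs_gens by blast
  qed
qed

end
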